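(* Let $d\ge 1$ and let $(S^\star,\phi^\star,(G^\star_n)_{n\ge1})$ be one of the three triples defined in the context (Euclidean unit ball, unit box, canonical simplex of $\mathbb{R}^d$). Let $n\ge 1$ be a fixed, arbitrary integer, and consider the problems $(P_n)$, $(R_n)$, $(D_n)$ defined in the context. Then: (i) The equilibrium measure $\phi^\star$ of $S^\star$ is an optimal solution of $(P_n)$; the optimal moment matrices $\mathbf{M}_{n-d_g}(g\,\phi^\star)$, $g\in G^\star_n$, are unique (every optimal solution of $(P_n)$ has these same matrices); and the vector of moments $\boldsymbol{\phi}^\star=(\phi^\star_{\boldsymbol{\alpha}})_{\boldsymbol{\alpha}\in\mathbb{N}^d_{2n}}$, $\phi^\star_{\boldsymbol{\alpha}}=\int \mathbf{x}^{\boldsymbol{\alpha}}\,d\phi^\star$, is the unique optimal solution of $(R_n)$. (ii) The unique optimal solution $(\mathbf{A}^\star_g)_{g\in G^\star_n}$ of $(D_n)$ satisfies $\mathbf{A}^\star_g=\mathbf{M}_{n-d_g}(g\,\phi^\star)^{-1}$ for all $g\in G_n^\star$, and therefore $$\sum_{g\in G^\star_n}s_{n-d_g}\,=\,\sum_{g\in G^\star_n}\Lambda^{g\phi^\star}_{n-d_g}(\mathbf{x})^{-1}\,g(\mathbf{x})\,=\,\sum_{g\in G^\star_n}K^{g\phi^\star}_{n-d_g}(\mathbf{x},\mathbf{x})\,g(\mathbf{x})\,,\qquad\forall\,\mathbf{x}\in\mathbb{R}^d.$$ (iii) There are an integer $m$ with $s_n\le m\le s_{2n}$, distinct points $\mathbf{x}^*_1,\dots,\mathbf{x}^*_m\in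 S^\star$, and a positive vector $0<\boldsymbol{\gamma}\in\mathbb{R}^m$ such that the atomic probability measure $\nu^\star_n:=\sum_{j=1}^m\gamma_j\,\delta_{\mathbf{x}^*_j}$ has the same moments as $\phi^\star$ up to degree $2n$. Moreover, the polynomial $\mathbf{x}\mapsto K^{\phi^\star}_n(\mathbf{x},\mathbf{x})$ attains its maximum over $S^\star$, equal to $\sum_{g\in G^\star_n}s_{n-d_g}$: at all points of the boundary $\partial S^\star$ if $S^\star$ is the Euclidean unit ball; only at the $2^d$ vertices of $S^\star$ if $S^\star$ is the unit box; and only at the $d+1$ vertices of $S^\star$ if $S^\star$ is the canonical simplex. (iv) If for each $n\ge1$ $\nu^\star_n$ is a measure as in (iii), then the sequence $(\nu^\star_n)_{n}$ converges to $\phi^\star$ in the weak-star topology, i.e. $$\lim_{n\to\infty}\int_{S^\star} f\,d\nu^\star_n=\int_{S^\star} f\,d\phi^\star\qquad\text{for every continuous function } f:S^\star\to\mathbb{R}.$$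
   Context: Notation. $\mathbb{N}^d_n=\{\boldsymbol{\alpha}\in\mathbb{N}^d:|\boldsymbol{\alpha}|=\sum_i\alpha_i\le n\}$ (with $0\in\mathbb{N}$), $s_n=\binom{n+d}{d}$, $\mathbf{v}_n(\mathbf{x})=(\mathbf{x}^{\boldsymbol{\alpha}})_{\boldsymbol{\alpha}\in\mathbb{N}^d_n}$ is the vector of monomials of degree at most $n$. For a polynomial $g\in\mathbb{R}[\mathbf{x}]$, $d_g=\lceil\deg(g)/2\rceil$. For a compact set $S\subset\mathbb{R}^d$, $\mathscr{P}(S)$ is the set of Borel probability measures on $S$. Moment and localizing matrices. For a real vector $\boldsymbol{\phi}=(\phi_{\boldsymbol{\alpha}})_{\boldsymbol{\alpha}\in\mathbb{N}^d_{2n}}$ (a vector of pseudo-moments), let $\phi$ be the linear functional $\phi(\sum p_{\boldsymbol{\alpha}}\mathbf{x}^{\boldsymbol{\alpha}})=\sum p_{\boldsymbol{\alpha}}\phi_{\boldsymbol{\alpha}}$ on polynomials of degree at most $2n$. For a polynomial $g=\sum_{\boldsymbol{\beta}} g_{\boldsymbol{\beta}}\mathbf{x}^{\boldsymbol{\beta}}$ with $d_g\le n$, $\mathbf{M}_{n-d_g}(g\,\boldsymbol{\phi})$ is the real symmetric matrix with rows and columns indexed by $\mathbb{N}^d_{n-d_g}$ and with $(\boldsymbol{\alpha},\boldsymbol{\alpha}')$ entry $\phi(g\,\mathbf{x}^{\boldsymbol{\alpha}+\boldsymbol{\alpha}'})=\sum_{\boldsymbol{\beta}}g_{\boldsymbol{\beta}}\phi_{\boldsymbol{\beta}+\boldsymbol{\alpha}+\boldsymbol{\alpha}'}$.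 For a measure $\phi$, $\mathbf{M}_{k}(g\,\phi)=\int \mathbf{v}_k(\mathbf{x})\mathbf{v}_k(\mathbf{x})^T g(\mathbf{x})\,d\phi(\mathbf{x})$, where $g\phi$ is the measure with density $g$ with respect to $\phi$; $\mathbf{M}_k(\phi)$ is the case $g=1$. Christoffel–Darboux kernel and Christoffel function. For a measure $\psi$ with $\mathbf{M}_k(\psi)\succ0$, $K^\psi_k(\mathbf{x},\mathbf{y})=\mathbf{v}_k(\mathbf{x})^T\mathbf{M}_k(\psi)^{-1}\mathbf{v}_k(\mathbf{y})$ and $\Lambda^\psi_k(\mathbf{x})=1/K^\psi_k(\mathbf{x},\mathbf{x})$. The three cases (sets, equilibrium probability measures in the sense of pluripotential theory, and generators). Unit ball: $S^{O}=\{\mathbf{x}\in\mathbb{R}^d:1-\|\mathbf{x}\|^2\ge0\}$ (Euclidean norm), $\phi^{O}=c_d\,\dfrac{d\mathbf{x}}{\sqrt{1-\|\mathbf{x}\|^2}}$ on $S^{O}$, $G^{O}_n=\{\,1,\ 1-\|\mathbf{x}\|^2\,\}$. Unit box: $S^{\square}=\{\mathbf{x}\in\mathbb{R}^d:1-x_j^2\ge0,\ j=1,\dots,d\}$, $\phi^{\square}=\dfrac{d\mathbf{x}}{\pi^d\sqrt{(1-x_1^2)\cdots(1-x_d^2)}}$ on $S^\square$, $G^{\square}_n=\{\prod_{j=1}^d(1-x_j^2)^{\varepsilon_j}:\boldsymbol{\varepsilon}\in\{0,1\}^d,\ |\boldsymbol{\varepsilon}|\le n\}$. Canonical simplex: $S^{\triangle}=\{\mathbf{x}\in\mathbb{R}^d: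 x_1,\dots,x_d\ge0,\ 1-\sum_{j=1}^d x_j\ge0\}$, $\phi^{\triangle}=c_d\,\dfrac{d\mathbf{x}}{\sqrt{x_1\cdots x_d\,(1-\sum_{j=1}^d x_j)}}$ on $S^\triangle$, $G^{\triangle}_n=\{x_1^{\varepsilon_1}\cdots x_d^{\varepsilon_d}(1-\sum_{j=1}^d x_j)^{\varepsilon_{d+1}}:\boldsymbol{\varepsilon}\in\{0,1\}^{d+1},\ |\boldsymbol{\varepsilon}|\text{ even},\ |\boldsymbol{\varepsilon}|/2\le n\}$. Here $|\boldsymbol{\varepsilon}|=\sum_j\varepsilon_j$ and $c_d=\Gamma((d+1)/2)/\pi^{(d+1)/2}$ is the constant making $\phi^{O}$ and $\phi^{\triangle}$ probability measures. The optimization problems (with the convention $\log\det\mathbf{X}=-\infty$ for singular $\mathbf{X}\succeq0$): $(P_n)$: $\displaystyle\max_{\phi\in\mathscr{P}(S^\star)}\ \sum_{g\in G^\star_n}\log\det\mathbf{M}_{n-d_g}(g\,\phi)$. $(R_n)$: $\displaystyle\max_{\boldsymbol{\phi}}\Big\{\sum_{g\in G^\star_n}\log\det\mathbf{M}_{n-d_g}(g\,\boldsymbol{\phi}):\ \phi(1)=1;\ \mathbf{M}_{n-d_g}(g\,\boldsymbol{\phi})\succeq0\ \ \forall g\in G^\star_n\Big\}$, the maximum being over real vectors $\boldsymbol{\phi}=(\phi_{\boldsymbol{\alpha}})_{\boldsymbol{\alpha}\in\mathbb{N}^d_{2n}}$. $(D_n)$: $\displaystyle\max_{(\mathbf{A}_g)_{g\in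 G_n^\star},\ \mathbf{A}_g\succeq0}\Big\{\sum_{g\in G^\star_n}\log\det\mathbf{A}_g:\ \sum_{g\in G^\star_n}s_{n-d_g}=\sum_{g\in G^\star_n}\mathbf{v}_{n-d_g}(\mathbf{x})^T\mathbf{A}_g\mathbf{v}_{n-d_g}(\mathbf{x})\,g(\mathbf{x})\ \ \forall\mathbf{x}\in\mathbb{R}^d\Big\}$, where $\mathbf{A}_g$ is a real symmetric matrix of size $s_{n-d_g}$. *)

theory Defs
  imports
    "HOL-Analysis.Analysis"
    "HOL-Probability.Probability_Measure"
    "HOL-Library.Poly_Mapping"
    "HOL-Library.Multiset"
    "Jordan_Normal_Form.Determinant"
    "Jordan_Normal_Form.Gauss_Jordan_Elimination"
begin

text \<open>
  The points of d-dimensional space are elements of \<open>real^'d\<close>, so that d is \<open>CARD('d)\<close>.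
  Multi-indices and real polynomials in d variables are finitely supported maps; the ring operations
  on polynomials are the convolution product of \<^theory>\<open>HOL-Library.Poly_Mapping\<close>.
\<close>

type_synonym 'd mindex = "'d \<Rightarrow>\<^sub>0 nat"
type_synonym 'd mpoly = "('d \<Rightarrow>\<^sub>0 nat) \<Rightarrow>\<^sub>0 real"

definition mindex_deg :: "'d::finite mindex \<Rightarrow> nat" where
  "mindex_deg \<alpha> = (\<Sum>i\<in>UNIV. Poly_Mapping.lookup \<alpha> i)"

definition mindices :: "nat \<Rightarrow> 'd::finite mindex set" where
  "mindices n = {\<alpha>. mindex_deg \<alpha> \<le> n}"

definition num_mindices :: "'d::finite itself \<Rightarrow> nat \<Rightarrow> nat" where
  "num_mindices _ n = (n + CARD('d)) choose CARD('d)"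

definition monom_at :: "'d::finite mindex \<Rightarrow> real^'d \<Rightarrow> real" where
  "monom_at \<alpha> x = (\<Prod>i\<in>UNIV. vec_nth x i ^ Poly_Mapping.lookup \<alpha> i)"

definition mpoly_at :: "'d::finite mpoly \<Rightarrow> real^'d \<Rightarrow> real" where
  "mpoly_at p x = (\<Sum>\<alpha>\<in>Poly_Mapping.keys p. Poly_Mapping.lookup p \<alpha> * monom_at \<alpha> x)"

definition mpoly_var :: "'d \<Rightarrow> 'd::finite mpoly" where
  "mpoly_var i = Poly_Mapping.single (Poly_Mapping.single i 1) 1"

definition mpoly_deg :: "'d::finite mpoly \<Rightarrow> nat" where
  "mpoly_deg p = Max (insert 0 (mindex_deg ` Poly_Mapping.keys p))"

definition half_deg :: "'d::finite mpoly \<Rightarrow> nat" where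
  "half_deg g = nat \<lceil>real (mpoly_deg g) / 2\<rceil>"

lemma
  shows finite_mindices: "finite (mindices n :: 'd::finite mindex set)"
    and card_mindices: "card (mindices n :: 'd mindex set) = num_mindices TYPE('d) n"
proof -
  define f :: "'d mindex \<Rightarrow> 'd option multiset" where
    "f = (\<lambda>\<alpha>. Abs_multiset (\<lambda>i. case i of Some j \<Rightarrow> Poly_Mapping.lookup \<alpha> j | None \<Rightarrow> n - mindex_deg \<alpha>))"
  have count_f: "count (f \<alpha>) i = (case i of Some j \<Rightarrow> Poly_Mapping.lookup \<alpha> j | None \<Rightarrow> n - mindex_deg \<alpha>)"
    for \<alpha> i
    unfolding f_def by (subst Abs_multiset_inverse) auto
  have UNIV_sum: "(\<Sum>i\<in>UNIV. h i) = h None + (\<Sum>j\<in>UNIV. h (Some j))" for h :: "'d option \<Rightarrow> nat"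
    by (simp add: UNIV_option_conv sum.reindex)
  have size_conv: "size X = (\<Sum>i\<in>UNIV. count X i)" for X :: "'d option multiset"
    unfolding size_multiset_overloaded_eq
    by (rule sum.mono_neutral_left) (auto simp: not_in_iff)
  have bij: "bij_betw f (mindices n) (multisets_of_size UNIV n)"
    unfolding bij_betw_def
  proof (intro conjI equalityI subsetI inj_onI)
    fix \<alpha> \<beta> :: "'d mindex" assume "f \<alpha> = f \<beta>"
    then have "count (f \<alpha>) (Some j) = count (f \<beta>) (Some j)" for j by simp
    then show "\<alpha> = \<beta>" by (simp add: count_f poly_mapping_eq_iff fun_eq_iff)
  next
    fix X assume "X \<in> f ` mindices n"
    then show "X \<in> multisets_of_size UNIV n"
      by (auto simp: multisets_of_size_def size_conv UNIV_sum count_f mindices_def mindex_deg_def)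
  next
    fix X :: "'d option multiset" assume "X \<in> multisets_of_size UNIV n"
    then have X: "count X None + (\<Sum>j\<in>UNIV. count X (Some j)) = n"
      by (simp add: multisets_of_size_def size_conv UNIV_sum)
    define \<alpha> :: "'d mindex" where "\<alpha> = Abs_poly_mapping (\<lambda>j. count X (Some j))"
    have \<alpha>: "Poly_Mapping.lookup \<alpha> j = count X (Some j)" for j
      unfolding \<alpha>_def by (simp add: Abs_poly_mapping_inverse)
    have "\<alpha> \<in> mindices n" "f \<alpha> = X"
      using X by (auto simp: mindices_def mindex_deg_def \<alpha> multiset_eq_iff count_f split: option.split)
    then show "X \<in> f ` mindices n" by blast
  qed
  show "finite (mindices n :: 'd mindex set)"
    using bij_betw_finite[OF bij] by (simp add: finite_multisets_of_size)
  show "card (mindices n :: 'd mindex set) = num_mindices TYPE('d) n"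
    using bij_betw_same_card[OF bij] binomial_symmetric[of "CARD('d)" "n + CARD('d)"]
    by (simp add: card_multisets_of_size num_mindices_def card_UNIV_option add.commute)
qed

text \<open>
  Matrices and vectors indexed by multi-indices of degree at most k are matrices and vectors of the
  library, via an enumeration of these multi-indices.  Which enumeration is chosen is immaterial:
  another one permutes rows and columns of all matrices (and all vectors) of that size simultaneously.
\<close>

definition mindex_enum :: "nat \<Rightarrow> nat \<Rightarrow> 'd::finite mindex" where
  "mindex_enum k = (SOME e. bij_betw e {..<num_mindices TYPE('d) k} (mindices k))"

lemma bij_betw_mindex_enum:
  "bij_betw (mindex_enum k :: nat \<Rightarrow> 'd::finite mindex) {..<num_mindices TYPE('d) k} (mindices k)"
proof -
  have "\<exists>e :: nat \<Rightarrow> 'd mindex. bij_betw e {..<num_mindices TYPE('d) k} (mindices k)"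
    using ex_bij_betw_nat_finite[OF finite_mindices, where ?'d1 = 'd and n1 = k]
    by (simp add: card_mindices atLeast0LessThan)
  then show ?thesis
    unfolding mindex_enum_def by (rule someI_ex)
qed

definition monom_vec :: "nat \<Rightarrow> real^'d::finite \<Rightarrow> real Matrix.vec" where
  "monom_vec k x = Matrix.vec (num_mindices TYPE('d) k) (\<lambda>i. monom_at (mindex_enum k i) x)"

definition psd_mat :: "nat \<Rightarrow> real mat \<Rightarrow> bool" where
  "psd_mat m A \<longleftrightarrow> A \<in> carrier_mat m m \<and> transpose_mat A = A \<and>
     (\<forall>v\<in>carrier_vec m. 0 \<le> scalar_prod v (A *\<^sub>v v))"

text \<open>Used for positive semidefinite matrices only.\<close>

definition log_det :: "real mat \<Rightarrow> ereal" where
  "log_det A = (if Determinant.det A > 0 then ereal (ln (Determinant.det A)) else -\<infinity>)"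

definition moment_mat :: "nat \<Rightarrow> (real^'d::finite) measure \<Rightarrow> real mat" where
  "moment_mat k \<psi> = Matrix.mat (num_mindices TYPE('d) k) (num_mindices TYPE('d) k)
     (\<lambda>(i, j). \<integral>x. monom_at (mindex_enum k i) x * monom_at (mindex_enum k j) x \<partial>\<psi>)"

definition pseudo_functional :: "('d::finite mindex \<Rightarrow> real) \<Rightarrow> 'd mpoly \<Rightarrow> real" where
  "pseudo_functional y p = (\<Sum>\<alpha>\<in>Poly_Mapping.keys p. Poly_Mapping.lookup p \<alpha> * y \<alpha>)"

definition localizing_mat :: "nat \<Rightarrow> 'd::finite mpoly \<Rightarrow> ('d mindex \<Rightarrow> real) \<Rightarrow> real mat" where
  "localizing_mat k g y = Matrix.mat (num_mindices TYPE('d) k) (num_mindices TYPE('d) k)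
     (\<lambda>(i, j). pseudo_functional y (g * Poly_Mapping.single (mindex_enum k i + mindex_enum k j) 1))"

text \<open>The measure with density g with respect to \<open>\<phi>\<close>; it is used where g is nonnegative \<open>\<phi>\<close>-a.e.\<close>

definition weighted :: "'d::finite mpoly \<Rightarrow> (real^'d) measure \<Rightarrow> (real^'d) measure" where
  "weighted g \<phi> = density \<phi> (\<lambda>x. ennreal (mpoly_at g x))"

lemma continuous_on_monom_at [continuous_intros]: "continuous_on A (monom_at \<alpha>)"
  unfolding monom_at_def by (intro continuous_intros)

lemma continuous_on_mpoly_at [continuous_intros]: "continuous_on A (mpoly_at p)"
  unfolding mpoly_at_def by (intro continuous_intros)

lemma borel_measurable_monom_at [measurable]: "monom_at \<alpha> \<in> borel_measurable borel"
  by (intro borel_measurable_continuous_onI continuous_intros)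

lemma borel_measurable_mpoly_at [measurable]: "mpoly_at p \<in> borel_measurable borel"
  by (intro borel_measurable_continuous_onI continuous_intros)

lemma moment_mat_weighted:
  fixes \<phi> :: "(real^'d::finite) measure"
  assumes [measurable_cong]: "sets \<phi> = sets borel" and "AE x in \<phi>. 0 \<le> mpoly_at g x"
  shows "moment_mat k (weighted g \<phi>) =
    Matrix.mat (num_mindices TYPE('d) k) (num_mindices TYPE('d) k)
      (\<lambda>(i, j). \<integral>x. monom_at (mindex_enum k i) x * monom_at (mindex_enum k j) x * mpoly_at g x \<partial>\<phi>)"
  unfolding moment_mat_def weighted_def
  by (rule cong_mat) (use assms(2) in \<open>auto simp: integral_real_density mult_ac\<close>)

text \<open>
  Christoffel--Darboux kernel and Christoffel function.  They are meaningful only when the moment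
  matrix is nonsingular: \<open>mat_inverse\<close> returns \<open>None\<close> for singular matrices.
\<close>

definition cd_kernel :: "nat \<Rightarrow> (real^'d::finite) measure \<Rightarrow> real^'d \<Rightarrow> real^'d \<Rightarrow> real" where
  "cd_kernel k \<psi> x y =
     scalar_prod (monom_vec k x) (the (mat_inverse (moment_mat k \<psi>)) *\<^sub>v monom_vec k y)"

definition christoffel :: "nat \<Rightarrow> (real^'d::finite) measure \<Rightarrow> real^'d \<Rightarrow> real" where
  "christoffel k \<psi> x = 1 / cd_kernel k \<psi> x x"

datatype shape = UnitBall | UnitBox | UnitSimplex

definition region :: "shape \<Rightarrow> (real^'d::finite) set" where
  "region sh = (case sh of
      UnitBall \<Rightarrow> {x. 0 \<le> 1 - (norm x)\<^sup>2}
    | UnitBox \<Rightarrow> {x. \<forall>j. 0 \<le> 1 - (vec_nth x j)\<^sup>2}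
    | UnitSimplex \<Rightarrow> {x. (\<forall>j. 0 \<le> vec_nth x j) \<and> 0 \<le> 1 - (\<Sum>j\<in>UNIV. vec_nth x j)})"

definition norm_const :: "nat \<Rightarrow> real" where
  "norm_const d = Gamma ((real d + 1) / 2) / pi powr ((real d + 1) / 2)"

definition equil_density :: "shape \<Rightarrow> real^'d::finite \<Rightarrow> real" where
  "equil_density sh x = (case sh of
      UnitBall \<Rightarrow> norm_const CARD('d) / sqrt (1 - (norm x)\<^sup>2)
    | UnitBox \<Rightarrow> 1 / (pi ^ CARD('d) * sqrt (\<Prod>j\<in>UNIV. 1 - (vec_nth x j)\<^sup>2))
    | UnitSimplex \<Rightarrow> norm_const CARD('d) /
        sqrt ((\<Prod>j\<in>UNIV. vec_nth x j) * (1 - (\<Sum>j\<in>UNIV. vec_nth x j))))"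

text \<open>The boundary, where the formula for the density divides by zero, is a null set.\<close>

definition equil :: "shape \<Rightarrow> (real^'d::finite) measure" where
  "equil sh = density lborel (\<lambda>x. ennreal (indicator (region sh) x * equil_density sh x))"

text \<open>
  Distinct exponent vectors give distinct generators, so a sum over the set of generators is a sum
  over the exponent vectors.  Every generator g in \<open>gens sh n\<close> (with n at least 1) satisfies
  \<open>half_deg g \<le> n\<close>, so that the natural number \<open>n - half_deg g\<close> is never truncated.
\<close>

definition gens :: "shape \<Rightarrow> nat \<Rightarrow> 'd::finite mpoly set" where
  "gens sh n = (case sh of
      UnitBall \<Rightarrow> {1, 1 - (\<Sum>j\<in>UNIV. mpoly_var j ^ 2)}
    | UnitBox \<Rightarrow> {(\<Prod>j\<in>UNIV. (1 - mpoly_var j ^ 2) ^ \<epsilon> j) | \<epsilon> :: 'd \<Rightarrow> nat.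
        range \<epsilon> \<subseteq> {0, 1} \<and> (\<Sum>j\<in>UNIV. \<epsilon> j) \<le> n}
    | UnitSimplex \<Rightarrow> {(\<Prod>j\<in>UNIV. mpoly_var j ^ \<epsilon> j) * (1 - (\<Sum>j\<in>UNIV. mpoly_var j)) ^ \<epsilon>' |
        (\<epsilon> :: 'd \<Rightarrow> nat) \<epsilon>'. range \<epsilon> \<subseteq> {0, 1} \<and> \<epsilon>' \<in> {0, 1} \<and>
          even ((\<Sum>j\<in>UNIV. \<epsilon> j) + \<epsilon>') \<and> ((\<Sum>j\<in>UNIV. \<epsilon> j) + \<epsilon>') div 2 \<le> n})"

lemma finite_gens: "finite (gens sh n :: 'd::finite mpoly set)"
proof -
  have fin: "finite {\<epsilon> :: 'd \<Rightarrow> nat. range \<epsilon> \<subseteq> {0, 1}}"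
    using finite_PiE[of "UNIV :: 'd set" "\<lambda>_. {0, 1 :: nat}"]
    by (auto elim!: rev_finite_subset simp: PiE_UNIV_domain)
  show ?thesis
  proof (cases sh)
    case UnitBall
    then show ?thesis by (simp add: gens_def)
  next
    case UnitBox
    have "gens UnitBox n \<subseteq> (\<lambda>\<epsilon>. \<Prod>j\<in>UNIV. (1 - mpoly_var (j :: 'd) ^ 2) ^ \<epsilon> j) ` {\<epsilon>. range \<epsilon> \<subseteq> {0, 1}}"
      by (auto simp: gens_def)
    then show ?thesis using UnitBox fin by (meson finite_imageI finite_subset)
  next
    case UnitSimplex
    define F :: "('d \<Rightarrow> nat) \<times> nat \<Rightarrow> 'd mpoly" where
      "F = (\<lambda>(\<epsilon>, \<epsilon>'). (\<Prod>j\<in>UNIV. mpoly_var j ^ \<epsilon> j) * (1 - (\<Sum>j\<in>UNIV. mpoly_var j)) ^ \<epsilon>')"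
    have "gens UnitSimplex n \<subseteq> F ` ({\<epsilon>. range \<epsilon> \<subseteq> {0, 1}} \<times> {0, 1})"
    proof
      fix g :: "'d mpoly" assume "g \<in> gens UnitSimplex n"
      then obtain \<epsilon> \<epsilon>' where "g = F (\<epsilon>, \<epsilon>')" "range \<epsilon> \<subseteq> {0, 1}" "\<epsilon>' \<in> {0, 1}"
        unfolding gens_def F_def shape.case prod.case by blast
      then show "g \<in> F ` ({\<epsilon>. range \<epsilon> \<subseteq> {0, 1}} \<times> {0, 1})" by blast
    qed
    then show ?thesis using UnitSimplex fin by (simp add: finite_subset)
  qed
qed

text \<open>Borel probability measures on S, as Borel probability measures on the whole space carried by S.\<close>

definition prob_measures_on :: "(real^'d::finite) set \<Rightarrow> (real^'d) measure set" where
  "prob_measures_on S = {\<mu>. sets \<mu> = sets borel \<and> prob_space \<mu> \<and> emeasure \<mu> (- S) = 0}"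

definition P_objective :: "shape \<Rightarrow> nat \<Rightarrow> (real^'d::finite) measure \<Rightarrow> ereal" where
  "P_objective sh n \<phi> = (\<Sum>g\<in>gens sh n. log_det (moment_mat (n - half_deg g) (weighted g \<phi>)))"

definition P_optimal :: "shape \<Rightarrow> nat \<Rightarrow> (real^'d::finite) measure \<Rightarrow> bool" where
  "P_optimal sh n \<phi> \<longleftrightarrow> is_arg_max (P_objective sh n) (\<lambda>\<mu>. \<mu> \<in> prob_measures_on (region sh)) \<phi>"

text \<open>
  Vectors indexed by the finite set \<open>mindices (2 * n)\<close>, and families of matrices indexed by the
  finite set \<open>gens sh n\<close>, are extensional functions, so that equality of functions is equality of
  vectors (of families).
\<close>

definition R_feasible :: "shape \<Rightarrow> nat \<Rightarrow> ('d::finite mindex \<Rightarrow> real) \<Rightarrow> bool" where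
  "R_feasible sh n y \<longleftrightarrow> y \<in> extensional (mindices (2 * n)) \<and> pseudo_functional y 1 = 1 \<and>
     (\<forall>g\<in>gens sh n. psd_mat (num_mindices TYPE('d) (n - half_deg g)) (localizing_mat (n - half_deg g) g y))"

definition R_objective :: "shape \<Rightarrow> nat \<Rightarrow> ('d::finite mindex \<Rightarrow> real) \<Rightarrow> ereal" where
  "R_objective sh n y = (\<Sum>g\<in>gens sh n. log_det (localizing_mat (n - half_deg g) g y))"

definition R_optimal :: "shape \<Rightarrow> nat \<Rightarrow> ('d::finite mindex \<Rightarrow> real) \<Rightarrow> bool" where
  "R_optimal sh n y \<longleftrightarrow> is_arg_max (R_objective sh n) (R_feasible sh n) y"

definition moments :: "nat \<Rightarrow> (real^'d::finite) measure \<Rightarrow> 'd mindex \<Rightarrow> real" where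
  "moments k \<phi> = (\<lambda>\<alpha>\<in>mindices k. \<integral>x. monom_at \<alpha> x \<partial>\<phi>)"

definition total_size :: "'d::finite itself \<Rightarrow> shape \<Rightarrow> nat \<Rightarrow> nat" where
  "total_size _ sh n = (\<Sum>g\<in>(gens sh n :: 'd mpoly set). num_mindices TYPE('d) (n - half_deg g))"

definition D_feasible :: "shape \<Rightarrow> nat \<Rightarrow> ('d::finite mpoly \<Rightarrow> real mat) \<Rightarrow> bool" where
  "D_feasible sh n A \<longleftrightarrow> A \<in> extensional (gens sh n) \<and>
     (\<forall>g\<in>gens sh n. psd_mat (num_mindices TYPE('d) (n - half_deg g)) (A g)) \<and>
     (\<forall>x. real (total_size TYPE('d) sh n) = (\<Sum>g\<in>gens sh n.
        scalar_prod (monom_vec (n - half_deg g) x) (A g *\<^sub>v monom_vec (n - half_deg g) x) * mpoly_at g x))"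

definition D_objective :: "shape \<Rightarrow> nat \<Rightarrow> ('d::finite mpoly \<Rightarrow> real mat) \<Rightarrow> ereal" where
  "D_objective sh n A = (\<Sum>g\<in>gens sh n. log_det (A g))"

definition D_optimal :: "shape \<Rightarrow> nat \<Rightarrow> ('d::finite mpoly \<Rightarrow> real mat) \<Rightarrow> bool" where
  "D_optimal sh n A \<longleftrightarrow> is_arg_max (D_objective sh n) (D_feasible sh n) A"

text \<open>The sum of the point masses \<open>\<gamma> j\<close> at \<open>X j\<close> over \<open>j < m\<close>, as a Borel measure.\<close>

definition atomic_measure :: "nat \<Rightarrow> (nat \<Rightarrow> real^'d::finite) \<Rightarrow> (nat \<Rightarrow> real) \<Rightarrow> (real^'d) measure" where
  "atomic_measure m X \<gamma> = distr (point_measure {..<m} (\<lambda>j. ennreal (\<gamma> j))) borel X"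

lemma emeasure_atomic_measure:
  assumes "A \<in> sets borel"
  shows "emeasure (atomic_measure m X \<gamma>) A = (\<Sum>j<m. ennreal (\<gamma> j) * indicator A (X j))"
proof -
  have "emeasure (atomic_measure m X \<gamma>) A = (\<Sum>j\<in>X -` A \<inter> {..<m}. ennreal (\<gamma> j))"
    unfolding atomic_measure_def
    by (subst emeasure_distr) (use assms in \<open>auto simp: space_point_measure emeasure_point_measure_finite\<close>)
  also have "\<dots> = (\<Sum>j<m. ennreal (\<gamma> j) * indicator A (X j))"
    by (rule sum.mono_neutral_cong_left) (auto simp: indicator_def)
  finally show ?thesis .
qed

definition is_cubature :: "shape \<Rightarrow> nat \<Rightarrow> (real^'d::finite) measure \<Rightarrow> bool" where
  "is_cubature sh n \<nu> \<longleftrightarrow>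
     (\<exists>m X \<gamma>. num_mindices TYPE('d) n \<le> m \<and> m \<le> num_mindices TYPE('d) (2 * n) \<and>
        inj_on X {..<m} \<and> X ` {..<m} \<subseteq> region sh \<and> (\<forall>j<m. 0 < \<gamma> j) \<and>
        \<nu> = atomic_measure m X \<gamma>) \<and>
     prob_space \<nu> \<and>
     (\<forall>\<alpha>\<in>mindices (2 * n). (\<integral>x. monom_at \<alpha> x \<partial>\<nu>) = (\<integral>x. monom_at \<alpha> x \<partial>equil sh))"

definition vertices :: "'a::real_vector set \<Rightarrow> 'a set" where
  "vertices S = {x. x extreme_point_of S}"

end

theory Submission
  imports Defs "HOL-Probability.Distributions"
begin

text \<open>
  Everything follows from one polynomial identity, the partition of unity
  \<open>\<Sum>g. g(x) K_g(x, x) = \<Sum>g. s_g\<close>, where g runs through the generators, \<open>K_g\<close> is the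
  Christoffel--Darboux kernel of the measure with density g with respect to the equilibrium measure,
  and \<open>s_g\<close> is the size of its moment matrix.

  Why the identity holds.  Each region is the image of a homogeneous space: the ball of the sphere
  \<open>S^d\<close> under projection, the box of the torus under \<open>x_j = cos \<theta>_j\<close>, the simplex of the sphere
  under \<open>x_j = u_j^2\<close>; the equilibrium measure is the image of the invariant measure.  The functions
  \<open>sqrt g * p\<close> with p of degree at most \<open>n - d_g\<close> lift to a space of functions on the covering that
  is invariant under the group, and the kernel of an invariant space is constant on the diagonal.
  The proof below is the infinitesimal form of this argument and never leaves the coordinates x.
  For every direction j there is a polynomial \<open>a_j\<close> (\<open>face_poly\<close>) such that \<open>sqrt a_j * d/dx_j\<close> is the
  image of a vector field that generates rotations.  It is skew-symmetric for the equilibrium measure;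
  this is the integration by parts formula \<open>equil_integration_by_parts\<close>.  It maps the space of a
  generator g into that of a partner generator, with which it exchanges the factors of g that
  divide \<open>a_j\<close>.  Skew-symmetry and the reproducing property make the contributions of partners to
  the derivative of the sum cancel (\<open>kernel_pair_cancel\<close>), so that all partial derivatives of the
  sum vanish (\<open>partition_of_unity_gen\<close>); its constant value is found by integration.

  The three cases are treated at once by writing each generator as a product of factors that are
  indexed by a set of options: \<open>Some j\<close> stands for the coordinate j and \<open>None\<close> for the constraint that
  involves all coordinates (for the simplex, the additional barycentric coordinate).

  Optimality is weak duality.  For positive definite A and B of size s one has
  \<open>ln (det A) + ln (det B) \<le> tr (A B) - s\<close>, with equality only if A B is the identity
  (\<open>ln_det_le_frob\<close>).  Applying a feasible pseudo-moment functional to the identity, or integrating the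
  constraint of the dual problem, shows that the sum of the traces equals the sum of the sizes; this
  bounds both objectives and identifies the optimal solutions.  The first problem is
  the second one restricted to the pseudo-moments that are the moments of a measure on the region.

  The identity also gives the maximum of \<open>K_1(x, x)\<close> on the region: the other summands are nonnegative
  there, so the maximum is attained exactly where all generators other than 1 vanish.  Cubatures exist
  by Tchakaloff's theorem; the lower bound for the number of atoms is the nonsingularity of the moment
  matrix, and weak convergence is the theorem of Stone and Weierstrass.
\<close>

section \<open>Polynomials in several variables\<close>

lemma pseudo_functional_superset:
  assumes "finite A" "Poly_Mapping.keys p \<subseteq> A"
  shows "pseudo_functional y p = (\<Sum>\<alpha>\<in>A. Poly_Mapping.lookup p \<alpha> * y \<alpha>)"
  unfolding pseudo_functional_def
  by (rule sum.mono_neutral_left) (use assms in \<open>auto simp: in_keys_iff\<close>)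

lemma pseudo_functional_single [simp]:
  "pseudo_functional y (Poly_Mapping.single \<alpha> c) = c * y \<alpha>"
  by (subst pseudo_functional_superset[of "{\<alpha>}"]) auto

lemma pseudo_functional_zero [simp]: "pseudo_functional y 0 = 0"
  by (simp add: pseudo_functional_def)

lemma pseudo_functional_add:
  "pseudo_functional y (p + q) = pseudo_functional y p + pseudo_functional y q"
proof -
  let ?A = "Poly_Mapping.keys p \<union> Poly_Mapping.keys q"
  have "Poly_Mapping.keys (p + q) \<subseteq> ?A" by (rule Poly_Mapping.keys_add)
  then show ?thesis
    by (simp add: pseudo_functional_superset[of ?A] lookup_add algebra_simps sum.distrib)
qed

lemma pseudo_functional_uminus: "pseudo_functional y (- p) = - pseudo_functional y p"
  using pseudo_functional_add[of y p "- p"] by simp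

lemma pseudo_functional_diff:
  "pseudo_functional y (p - q) = pseudo_functional y p - pseudo_functional y q"
  using pseudo_functional_add[of y p "- q"] by (simp add: pseudo_functional_uminus)

lemma pseudo_functional_sum:
  "pseudo_functional y (\<Sum>i\<in>I. p i) = (\<Sum>i\<in>I. pseudo_functional y (p i))"
  by (induction I rule: infinite_finite_induct) (auto simp: pseudo_functional_add)

lemma mpoly_at_eq_pseudo_functional: "mpoly_at p x = pseudo_functional (\<lambda>\<alpha>. monom_at \<alpha> x) p"
  by (simp add: mpoly_at_def pseudo_functional_def)

lemma mpoly_expand:
  fixes p :: "'d::finite mpoly"
  assumes "finite A" "Poly_Mapping.keys p \<subseteq> A"
  shows "p = (\<Sum>\<alpha>\<in>A. Poly_Mapping.single \<alpha> (Poly_Mapping.lookup p \<alpha>))"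
proof (rule poly_mapping_eqI)
  fix k
  have "Poly_Mapping.lookup (\<Sum>\<alpha>\<in>A. Poly_Mapping.single \<alpha> (Poly_Mapping.lookup p \<alpha>)) k
      = (\<Sum>\<alpha>\<in>A. if \<alpha> = k then Poly_Mapping.lookup p \<alpha> else 0)"
    by (auto simp: lookup_sum lookup_single when_def intro!: sum.cong)
  also have "\<dots> = Poly_Mapping.lookup p k"
    using assms by (auto simp: in_keys_iff)
  finally show "Poly_Mapping.lookup p k =
    Poly_Mapping.lookup (\<Sum>\<alpha>\<in>A. Poly_Mapping.single \<alpha> (Poly_Mapping.lookup p \<alpha>)) k" ..
qed

lemma mpoly_induct [case_names single add]:
  fixes p :: "'d::finite mpoly"
  assumes single: "\<And>\<alpha> c. P (Poly_Mapping.single \<alpha> c)"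
    and add: "\<And>p q. P p \<Longrightarrow> P q \<Longrightarrow> P (p + q)"
  shows "P p"
proof -
  have "P (\<Sum>\<alpha>\<in>A. Poly_Mapping.single \<alpha> (Poly_Mapping.lookup p \<alpha>))" if "finite A" for A
    using that
  proof (induction A rule: finite_induct)
    case empty
    show ?case using single[of 0 0] by simp
  qed (auto intro: single add)
  from this[of "Poly_Mapping.keys p"] show ?thesis
    using mpoly_expand[of "Poly_Mapping.keys p" p] by (metis finite_keys order_refl)
qed

lemma monom_at_add: "monom_at (\<alpha> + \<beta>) x = monom_at \<alpha> x * monom_at \<beta> x"
  by (simp add: monom_at_def lookup_add power_add prod.distrib)

lemma monom_at_0 [simp]: "monom_at 0 x = 1"
  by (simp add: monom_at_def)

lemma mpoly_at_single [simp]: "mpoly_at (Poly_Mapping.single \<alpha> c) x = c * monom_at \<alpha> x"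
  by (simp add: mpoly_at_eq_pseudo_functional)

lemma mpoly_at_0 [simp]: "mpoly_at 0 x = 0"
  by (simp add: mpoly_at_eq_pseudo_functional)

lemma mpoly_at_1 [simp]: "mpoly_at 1 x = 1"
  using mpoly_at_single[of 0 1 x] by simp

lemma mpoly_at_add [simp]: "mpoly_at (p + q) x = mpoly_at p x + mpoly_at q x"
  by (simp add: mpoly_at_eq_pseudo_functional pseudo_functional_add)

lemma mpoly_at_diff [simp]: "mpoly_at (p - q) x = mpoly_at p x - mpoly_at q x"
  by (simp add: mpoly_at_eq_pseudo_functional pseudo_functional_diff)

lemma mpoly_at_sum [simp]: "mpoly_at (\<Sum>i\<in>I. p i) x = (\<Sum>i\<in>I. mpoly_at (p i) x)"
  by (simp add: mpoly_at_eq_pseudo_functional pseudo_functional_sum)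

lemma mpoly_at_mult [simp]: "mpoly_at (p * q) x = mpoly_at p x * mpoly_at q x"
proof (induction p rule: mpoly_induct)
  case (single \<alpha> c)
  show ?case
  proof (induction q rule: mpoly_induct)
    case (single \<beta> b)
    show ?case by (simp add: mult_single monom_at_add)
  qed (simp add: algebra_simps)
qed (simp add: algebra_simps)

lemma mpoly_at_prod [simp]: "mpoly_at (\<Prod>i\<in>I. p i) x = (\<Prod>i\<in>I. mpoly_at (p i) x)"
  by (induction I rule: infinite_finite_induct) auto

lemma mpoly_at_power [simp]: "mpoly_at (p ^ k) x = mpoly_at p x ^ k"
  by (induction k) auto

lemma mpoly_at_var [simp]: "mpoly_at (mpoly_var i) x = vec_nth x i"
proof -
  have "monom_at (Poly_Mapping.single i 1) x = (\<Prod>j\<in>UNIV. if j = i then vec_nth x i else 1)"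
    unfolding monom_at_def by (rule prod.cong) (auto simp: lookup_single when_def)
  then show ?thesis by (simp add: mpoly_var_def)
qed

lemma mpoly_deg_le_iff:
  "mpoly_deg p \<le> k \<longleftrightarrow> (\<forall>\<alpha>\<in>Poly_Mapping.keys p. mindex_deg \<alpha> \<le> k)"
  by (simp add: mpoly_deg_def)

lemma mindex_deg_add: "mindex_deg (\<alpha> + \<beta>) = mindex_deg \<alpha> + mindex_deg \<beta>"
  by (simp add: mindex_deg_def lookup_add sum.distrib)

lemma mindex_deg_single [simp]: "mindex_deg (Poly_Mapping.single i n) = n"
  by (simp add: mindex_deg_def lookup_single when_def)

lemma mindex_deg_zero [simp]: "mindex_deg 0 = 0"
  by (simp add: mindex_deg_def)

lemma mpoly_deg_add: "mpoly_deg p \<le> k \<Longrightarrow> mpoly_deg q \<le> k \<Longrightarrow> mpoly_deg (p + q) \<le> k"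
  using Poly_Mapping.keys_add[of p q] by (auto simp: mpoly_deg_le_iff)

lemma mpoly_deg_diff: "mpoly_deg p \<le> k \<Longrightarrow> mpoly_deg q \<le> k \<Longrightarrow> mpoly_deg (p - q) \<le> k"
  using mpoly_deg_add[of p k "- q"] by (simp add: mpoly_deg_le_iff)

lemma mpoly_deg_sum: "(\<And>i. i \<in> I \<Longrightarrow> mpoly_deg (p i) \<le> k) \<Longrightarrow> mpoly_deg (\<Sum>i\<in>I. p i) \<le> k"
proof (induction I rule: infinite_finite_induct)
  case (insert i I)
  then show ?case by (simp add: mpoly_deg_add)
qed (simp_all add: mpoly_deg_le_iff)

lemma mpoly_deg_mult:
  assumes "mpoly_deg p \<le> k" "mpoly_deg q \<le> l"
  shows "mpoly_deg (p * q) \<le> k + l"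
  using Poly_Mapping.keys_mult[of p q] assms by (fastforce simp: mpoly_deg_le_iff mindex_deg_add)

lemma mpoly_deg_single_le: "mindex_deg \<alpha> \<le> k \<Longrightarrow> mpoly_deg (Poly_Mapping.single \<alpha> c) \<le> k"
  by (simp add: mpoly_deg_le_iff)

lemma mpoly_deg_0 [simp]: "mpoly_deg 0 = 0" and mpoly_deg_1 [simp]: "mpoly_deg 1 = 0"
  by (simp_all add: mpoly_deg_def)

lemma mpoly_deg_var_le: "mpoly_deg (mpoly_var i) \<le> 1"
  unfolding mpoly_var_def by (rule mpoly_deg_single_le) simp

lemma mpoly_deg_power: "mpoly_deg p \<le> k \<Longrightarrow> mpoly_deg (p ^ m) \<le> m * k"
proof (induction m)
  case (Suc m)
  then show ?case using mpoly_deg_mult[of p k "p ^ m" "m * k"] by simp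
qed simp

lemma mpoly_deg_prod:
  "(\<And>i. i \<in> I \<Longrightarrow> mpoly_deg (p i) \<le> k i) \<Longrightarrow> mpoly_deg (\<Prod>i\<in>I. p i) \<le> (\<Sum>i\<in>I. k i)"
proof (induction I rule: infinite_finite_induct)
  case (insert i I)
  then show ?case using mpoly_deg_mult[of "p i" "k i"] by simp
qed simp_all

definition pdiff :: "'d::finite \<Rightarrow> 'd mpoly \<Rightarrow> 'd mpoly" where
  "pdiff j p = (\<Sum>\<alpha>\<in>Poly_Mapping.keys p. Poly_Mapping.single (\<alpha> - Poly_Mapping.single j 1)
     (Poly_Mapping.lookup p \<alpha> * real (Poly_Mapping.lookup \<alpha> j)))"

lemma pdiff_superset:
  assumes "finite A" "Poly_Mapping.keys p \<subseteq> A"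
  shows "pdiff j p = (\<Sum>\<alpha>\<in>A. Poly_Mapping.single (\<alpha> - Poly_Mapping.single j 1)
     (Poly_Mapping.lookup p \<alpha> * real (Poly_Mapping.lookup \<alpha> j)))"
  unfolding pdiff_def
  by (rule sum.mono_neutral_left) (use assms in \<open>auto simp: in_keys_iff\<close>)

lemma pdiff_add: "pdiff j (p + q) = pdiff j p + pdiff j q"
proof -
  let ?A = "Poly_Mapping.keys p \<union> Poly_Mapping.keys q"
  have "Poly_Mapping.keys (p + q) \<subseteq> ?A" by (rule Poly_Mapping.keys_add)
  then show ?thesis
    by (simp add: pdiff_superset[of ?A] lookup_add distrib_right single_add sum.distrib)
qed

lemma pdiff_single: "pdiff j (Poly_Mapping.single \<alpha> c) =
    Poly_Mapping.single (\<alpha> - Poly_Mapping.single j 1) (c * real (Poly_Mapping.lookup \<alpha> j))"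
  by (subst pdiff_superset[of "{\<alpha>}"]) auto

lemma mindex_diff_add_single:
  "Poly_Mapping.lookup \<alpha> j \<noteq> 0 \<Longrightarrow> (\<alpha> - Poly_Mapping.single j 1) + Poly_Mapping.single j 1 = (\<alpha> :: 'd mindex)"
  by (rule poly_mapping_eqI) (auto simp: lookup_add minus_poly_mapping.rep_eq lookup_single when_def)

lemma lookup_pdiff:
  "Poly_Mapping.lookup (pdiff j p) \<beta> =
     Poly_Mapping.lookup p (\<beta> + Poly_Mapping.single j 1) * real (Poly_Mapping.lookup \<beta> j + 1)"
proof (induction p rule: mpoly_induct)
  case (single \<alpha> c)
  have *: "\<alpha> - Poly_Mapping.single j 1 = \<beta> \<longleftrightarrow> \<alpha> = \<beta> + Poly_Mapping.single j 1"
    if "Poly_Mapping.lookup \<alpha> j \<noteq> 0"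
  proof
    assume "\<alpha> - Poly_Mapping.single j 1 = \<beta>"
    then show "\<alpha> = \<beta> + Poly_Mapping.single j 1"
      using that mindex_diff_add_single[of \<alpha> j] by simp
  qed simp
  have **: "\<alpha> \<noteq> \<beta> + Poly_Mapping.single j 1" if "Poly_Mapping.lookup \<alpha> j = 0"
    using that by (auto simp: lookup_add)
  show ?case
    using * ** by (cases "Poly_Mapping.lookup \<alpha> j = 0")
      (auto simp: pdiff_single lookup_single when_def lookup_add)
qed (simp add: pdiff_add lookup_add algebra_simps)

lemma has_derivative_mpoly_at_line:
  "((\<lambda>t. mpoly_at p (x + t *\<^sub>R axis j 1)) has_real_derivative
      mpoly_at (pdiff j p) (x + t *\<^sub>R axis j 1)) (at t within A)"
proof (induction p rule: mpoly_induct)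
  case (single \<alpha> c)
  let ?R = "\<Prod>i\<in>UNIV - {j}. vec_nth x i ^ Poly_Mapping.lookup \<alpha> i"
  have split: "monom_at \<beta> (x + s *\<^sub>R axis j 1) =
      (vec_nth x j + s) ^ Poly_Mapping.lookup \<beta> j *
        (\<Prod>i\<in>UNIV - {j}. vec_nth x i ^ Poly_Mapping.lookup \<beta> i)" for s \<beta>
    unfolding monom_at_def
    by (subst prod.remove[of _ j]) (auto simp: axis_def intro!: prod.cong)
  have R: "(\<Prod>i\<in>UNIV - {j}. vec_nth x i ^ Poly_Mapping.lookup (\<alpha> - Poly_Mapping.single j 1) i) = ?R"
    by (rule prod.cong) (auto simp: minus_poly_mapping.rep_eq lookup_single when_def)
  have L: "Poly_Mapping.lookup (\<alpha> - Poly_Mapping.single j 1) j = Poly_Mapping.lookup \<alpha> j - 1"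
    by (simp add: minus_poly_mapping.rep_eq lookup_single)
  show ?case
    unfolding pdiff_single mpoly_at_single split R L
    by (auto intro!: derivative_eq_intros)
next
  case (add p q)
  then show ?case by (auto simp: pdiff_add intro!: derivative_eq_intros)
qed

lemma mpoly_at_pdiff_mult:
  "mpoly_at (pdiff j (p * q)) x = mpoly_at (pdiff j p) x * mpoly_at q x + mpoly_at p x * mpoly_at (pdiff j q) x"
proof (rule DERIV_unique)
  show "((\<lambda>t. mpoly_at (p * q) (x + t *\<^sub>R axis j 1)) has_real_derivative mpoly_at (pdiff j (p * q)) x) (at 0)"
    using has_derivative_mpoly_at_line[of "p * q" x j 0 UNIV] by simp
  show "((\<lambda>t. mpoly_at (p * q) (x + t *\<^sub>R axis j 1)) has_real_derivative
      mpoly_at (pdiff j p) x * mpoly_at q x + mpoly_at p x * mpoly_at (pdiff j q) x) (at 0)"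
    using DERIV_mult[OF has_derivative_mpoly_at_line[of p x j 0 UNIV] has_derivative_mpoly_at_line[of q x j 0 UNIV]]
    by (simp add: algebra_simps)
qed

lemma pdiff_deg0: "mpoly_deg p = 0 \<Longrightarrow> pdiff j p = 0"
proof (rule poly_mapping_eqI)
  fix \<beta> assume "mpoly_deg p = 0"
  then have "\<forall>\<alpha>\<in>Poly_Mapping.keys p. mindex_deg \<alpha> \<le> 0" by (subst mpoly_deg_le_iff [symmetric]) simp
  then have "\<beta> + Poly_Mapping.single j 1 \<notin> Poly_Mapping.keys p"
    by (metis mindex_deg_add mindex_deg_single add_is_0 le_zero_eq one_neq_zero)
  then show "Poly_Mapping.lookup (pdiff j p) \<beta> = Poly_Mapping.lookup 0 \<beta>"
    by (simp add: lookup_pdiff in_keys_iff)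
qed

lemma mpoly_deg_pdiff: "mpoly_deg p \<le> k \<Longrightarrow> mpoly_deg (pdiff j p) \<le> k - 1"
  unfolding mpoly_deg_le_iff
proof
  fix \<beta> assume *: "\<forall>\<alpha>\<in>Poly_Mapping.keys p. mindex_deg \<alpha> \<le> k" and "\<beta> \<in> Poly_Mapping.keys (pdiff j p)"
  then have "\<beta> + Poly_Mapping.single j 1 \<in> Poly_Mapping.keys p"
    by (auto simp: in_keys_iff lookup_pdiff)
  with * have "mindex_deg (\<beta> + Poly_Mapping.single j 1) \<le> k" by blast
  then show "mindex_deg \<beta> \<le> k - 1" by (simp add: mindex_deg_add)
qed

lemma mpoly_const:
  fixes p :: "'d::finite mpoly"
  assumes "\<And>j. pdiff j p = 0"
  obtains c where "p = Poly_Mapping.single 0 c"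
proof (rule that, rule poly_mapping_eqI)
  fix \<alpha>
  show "Poly_Mapping.lookup p \<alpha> = Poly_Mapping.lookup (Poly_Mapping.single 0 (Poly_Mapping.lookup p 0)) \<alpha>"
  proof (cases "\<alpha> = 0")
    case False
    then obtain j where j: "Poly_Mapping.lookup \<alpha> j \<noteq> 0" by (metis lookup_zero poly_mapping_eqI)
    define \<beta> where "\<beta> = \<alpha> - Poly_Mapping.single j 1"
    have \<alpha>: "\<alpha> = \<beta> + Poly_Mapping.single j 1"
      using j mindex_diff_add_single[of \<alpha> j] by (simp add: \<beta>_def)
  have "Poly_Mapping.lookup p \<alpha> * real (Poly_Mapping.lookup \<beta> j + 1) = 0"
      using lookup_pdiff[of j p \<beta>] assms[of j] \<alpha> by simp
    then show ?thesis using False by (simp add: lookup_single)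
  qed simp
qed

text \<open>
  The partial derivatives of p vanish on U as well and have smaller degree, so by induction they are
  zero; hence p is constant.
\<close>

lemma mpoly_eq_0_if_zero_on_open:
  fixes p :: "'d::finite mpoly"
  assumes "open U" "U \<noteq> {}" "\<And>x. x \<in> U \<Longrightarrow> mpoly_at p x = 0"
  shows "p = 0"
  using assms(3)
proof (induction "mpoly_deg p" arbitrary: p rule: less_induct)
  case less
  have zero: "mpoly_at (pdiff j p) x = 0" if "x \<in> U" for j x
  proof -
    obtain e where e: "e > 0" "ball x e \<subseteq> U" using assms(1) \<open>x \<in> U\<close> open_contains_ball by blast
    have "((\<lambda>t. mpoly_at p (x + t *\<^sub>R axis j 1)) has_real_derivative mpoly_at (pdiff j p) x) (at 0)"
      using has_derivative_mpoly_at_line[of p x j 0 UNIV] by simp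
    moreover have "((\<lambda>t. mpoly_at p (x + t *\<^sub>R axis j 1)) has_real_derivative 0) (at 0)"
    proof (rule has_field_derivative_transform_within_open[of "\<lambda>_. 0" 0 0 "{-e<..<e}"])
      fix t :: real assume "t \<in> {-e<..<e}"
      then have "x + t *\<^sub>R axis j 1 \<in> U" using e by (auto simp: dist_norm)
      then show "0 = mpoly_at p (x + t *\<^sub>R axis j 1)" using less.prems by simp
    qed (use e in auto)
    ultimately show ?thesis by (rule DERIV_unique)
  qed
  have "pdiff j p = 0" for j
  proof (cases "mpoly_deg p = 0")
    case False
    then have "mpoly_deg (pdiff j p) < mpoly_deg p"
      using mpoly_deg_pdiff[of p "mpoly_deg p" j] by simp
    then show ?thesis using less.hyps zero by blast
  qed (rule pdiff_deg0)
  then obtain c where p: "p = Poly_Mapping.single 0 c" using mpoly_const by blast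
  obtain x where "x \<in> U" using assms(2) by blast
  then have "mpoly_at p x = 0" by (rule less.prems)
  then show ?case by (simp add: p)
qed

lemma mpoly_eqI:
  fixes p q :: "'d::finite mpoly"
  assumes "\<And>x. mpoly_at p x = mpoly_at q x"
  shows "p = q"
  using mpoly_eq_0_if_zero_on_open[of UNIV "p - q"] assms by simp

text \<open>
  This bounds degrees of products from below: on the line \<open>(t, ..., t)\<close> the degree of a univariate
  polynomial is additive under multiplication.
\<close>

lemma mpoly_deg_on_diagonal:
  fixes p :: "'d::finite mpoly"
  assumes "\<And>t. mpoly_at p (\<chi> i. t) = poly q t"
  shows "degree q \<le> mpoly_deg p"
proof -
  define r where "r = (\<Sum>\<alpha>\<in>Poly_Mapping.keys p. Polynomial.monom (Poly_Mapping.lookup p \<alpha>) (mindex_deg \<alpha>))"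
  have "poly r t = poly q t" for t
  proof -
    have "monom_at \<alpha> (\<chi> i. t) = t ^ mindex_deg \<alpha>" for \<alpha> :: "'d mindex"
      by (simp add: monom_at_def mindex_deg_def power_sum)
    then show ?thesis
      using assms[of t] by (simp add: r_def poly_sum poly_monom mpoly_at_def)
  qed
  then have "q = r" by (metis poly_eq_poly_eq_iff ext)
  moreover have "degree r \<le> mpoly_deg p"
    unfolding r_def
  proof (rule degree_sum_le)
    fix \<alpha> assume "\<alpha> \<in> Poly_Mapping.keys p"
    then have "mindex_deg \<alpha> \<le> mpoly_deg p" using mpoly_deg_le_iff by blast
    then show "degree (Polynomial.monom (Poly_Mapping.lookup p \<alpha>) (mindex_deg \<alpha>)) \<le> mpoly_deg p"
      using degree_monom_le order_trans by blast
  qed simp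
  ultimately show ?thesis by simp
qed

section \<open>Cholesky factorization and the determinant-trace inequality\<close>

lemma scalar_prod_mat_sum:
  assumes "A \<in> carrier_mat n m" "v \<in> carrier_vec n" "w \<in> carrier_vec m"
  shows "scalar_prod v (A *\<^sub>v w) = (\<Sum>i<n. \<Sum>j<m. vec_index v i * A $$ (i, j) * vec_index w j)"
proof -
  have "scalar_prod v (A *\<^sub>v w) = (\<Sum>i<n. vec_index v i * (\<Sum>j<m. A $$ (i, j) * vec_index w j))"
    using assms unfolding scalar_prod_def
    by (intro sum.cong) (auto simp: atLeast0LessThan scalar_prod_def intro!: sum.cong)
  then show ?thesis by (simp add: sum_distrib_left mult.assoc)
qed

text \<open>
  Induction on n: the Schur complement of the last diagonal entry is positive definite again, because
  its quadratic form at v is the quadratic form of C at the extension of v that minimizes it.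
\<close>

lemma cholesky_fun:
  fixes C :: "nat \<Rightarrow> nat \<Rightarrow> real"
  assumes "\<And>i j. i < n \<Longrightarrow> j < n \<Longrightarrow> C i j = C j i"
    and "\<And>v. \<exists>i<n. v i \<noteq> 0 \<Longrightarrow> 0 < (\<Sum>i<n. \<Sum>j<n. v i * C i j * v j)"
  shows "\<exists>R. (\<forall>k<n. 0 < R k k) \<and> (\<forall>k i. k < i \<longrightarrow> i < n \<longrightarrow> R k i = 0) \<and>
     (\<forall>i<n. \<forall>j<n. C i j = (\<Sum>k<n. R k i * R k j))"
  using assms
proof (induction n arbitrary: C)
  case 0
  show ?case by simp
next
  case (Suc n)
  define c where "c = C n n"
  define S where "S = (\<lambda>i j. C i j - C i n * C n j / c)"
  have sym: "C i j = C j i" if "i \<le> n" "j \<le> n" for i j using Suc.prems(1) that by simp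
  have c: "0 < c"
    using Suc.prems(2)[of "\<lambda>i. if i = n then 1 else 0"] by (simp add: c_def if_distrib sum.delta cong: if_cong)
  have pd: "0 < (\<Sum>i<n. \<Sum>j<n. v i * S i j * v j)" if v: "\<exists>i<n. v i \<noteq> 0" for v
  proof -
    define b where "b = (\<Sum>i<n. v i * C i n)"
    \<comment> \<open>the minimizer of the form of C among the extensions of v\<close>
    define w where "w = (\<lambda>i. if i = n then - b / c else v i)"
    have b': "(\<Sum>j<n. C n j * v j) = b"
      unfolding b_def by (rule sum.cong) (auto simp: sym)
    have "(\<Sum>i<Suc n. \<Sum>j<Suc n. w i * C i j * w j) =
        (\<Sum>i<n. (\<Sum>j<n. v i * C i j * v j) + v i * C i n * (- b / c)) +
        ((\<Sum>j<n. (- b / c) * C n j * v j) + (- b / c) * c * (- b / c))"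
      by (simp add: w_def c_def)
    also have "\<dots> = (\<Sum>i<n. \<Sum>j<n. v i * C i j * v j) + b * (- b / c) + ((- b / c) * b + b * b / c)"
    proof -
      have "(\<Sum>i<n. v i * C i n * (- b / c)) = b * (- b / c)" unfolding b_def by (rule sum_distrib_right [symmetric])
      moreover have "(\<Sum>j<n. (- b / c) * C n j * v j) = (- b / c) * b"
        unfolding b'[symmetric] by (simp add: sum_distrib_left mult.assoc)
      ultimately show ?thesis using c by (simp only: sum.distrib) simp
    qed
    also have "\<dots> = (\<Sum>i<n. \<Sum>j<n. v i * C i j * v j) - b * b / c" using c by (simp add: field_simps)
    also have "\<dots> = (\<Sum>i<n. \<Sum>j<n. v i * S i j * v j)"
    proof -
      have "b * b / c = (\<Sum>i<n. \<Sum>j<n. (v i * C i n) * (C n j * v j) / c)"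
        unfolding sum_divide_distrib [symmetric] sum_product [symmetric] b' by (simp add: b_def)
      moreover have "v i * S i j * v j = v i * C i j * v j - (v i * C i n) * (C n j * v j) / c" for i j
        by (simp add: S_def algebra_simps)
      ultimately show ?thesis by (simp only: sum_subtractf)
    qed
    finally have "(\<Sum>i<n. \<Sum>j<n. v i * S i j * v j) = (\<Sum>i<Suc n. \<Sum>j<Suc n. w i * C i j * w j)" ..
    moreover have "\<exists>i<Suc n. w i \<noteq> 0" using v by (auto simp: w_def)
    ultimately show ?thesis using Suc.prems(2)[of w] by simp
  qed
  have "S i j = S j i" if "i < n" "j < n" for i j using that sym by (simp add: S_def)
  from Suc.IH[of S, OF this pd] obtain R where
    R': "(\<forall>k<n. 0 < R k k) \<and> (\<forall>k i. k < i \<longrightarrow> i < n \<longrightarrow> R k i = 0) \<and>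
     (\<forall>i<n. \<forall>j<n. S i j = (\<Sum>k<n. R k i * R k j))" ..
  have R: "\<And>k. k < n \<Longrightarrow> 0 < R k k" "\<And>k i. k < i \<Longrightarrow> i < n \<Longrightarrow> R k i = 0"
      "\<And>i j. i < n \<Longrightarrow> j < n \<Longrightarrow> S i j = (\<Sum>k<n. R k i * R k j)"
    using R' by simp_all
  define Q where "Q = (\<lambda>k i. if k = n then C i n / sqrt c else if i = n then 0 else R k i)"
  have "C i j = (\<Sum>k<Suc n. Q k i * Q k j)" if ij: "i < Suc n" "j < Suc n" for i j
  proof -
    have last: "Q n i * Q n j = C i n * C n j / c"
      using c that sym[of j n] by (simp add: Q_def)
    consider "i < n" "j < n" | "i = n" | "j = n" "i < n" using ij by linarith
    then show ?thesis
    proof cases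
      case 1
      then have "(\<Sum>k<n. Q k i * Q k j) = S i j" by (simp add: R(3) Q_def)
      then show ?thesis by (simp add: last S_def)
    qed (use c last in \<open>auto simp: Q_def c_def\<close>)
  qed
  moreover have "0 < Q k k" if "k < Suc n" for k using that R(1) c by (auto simp: Q_def c_def)
  moreover have "Q k i = 0" if "k < i" "i < Suc n" for k i using that R(2) by (auto simp: Q_def)
  ultimately show ?case by blast
qed

lemma psd_matD:
  assumes "psd_mat n A"
  shows "A \<in> carrier_mat n n" "transpose_mat A = A" "v \<in> carrier_vec n \<Longrightarrow> 0 \<le> scalar_prod v (A *\<^sub>v v)"
  using assms by (auto simp: psd_mat_def)

lemma psd_mat_sym:
  assumes "psd_mat n A" "i < n" "j < n"
  shows "A $$ (i, j) = A $$ (j, i)"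
  using psd_matD(1,2)[OF assms(1)] assms(2,3) by (metis index_transpose_mat(1) carrier_matD)

text \<open>
  If the form vanished at v, then it would be negative at \<open>v + t w\<close> with \<open>w = A v\<close> and small negative t,
  because its derivative in the direction of w is \<open>2 (w, w) > 0\<close>.
\<close>

lemma psd_mat_pos:
  assumes A: "psd_mat n A" and "Determinant.det A \<noteq> 0" and v: "v \<in> carrier_vec n" "v \<noteq> 0\<^sub>v n"
  shows "0 < scalar_prod v (A *\<^sub>v v)"
proof (rule ccontr)
  note A' = psd_matD[OF A]
  assume "\<not> ?thesis"
  with A'(3)[OF v(1)] have z: "scalar_prod v (A *\<^sub>v v) = 0" by simp
  define w where "w = A *\<^sub>v v"
  have w: "w \<in> carrier_vec n" using A'(1) v by (simp add: w_def)
  have "w \<noteq> 0\<^sub>v n" using assms det_0_iff_vec_prod_zero_field[OF A'(1)] v by (auto simp: w_def)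
  then have ww: "0 < scalar_prod w w" using conjugate_square_greater_0_vec[OF w] w by simp
  define b where "b = scalar_prod w (A *\<^sub>v w)"
  have b: "0 \<le> b" using A'(3)[OF w] by (simp add: b_def)
  have Aw: "A *\<^sub>v w \<in> carrier_vec n" using A'(1) w by simp
  have cross: "scalar_prod v (A *\<^sub>v w) = scalar_prod w w"
    using transpose_vec_mult_scalar[OF A'(1) w v(1)] A'(2) by (simp add: w_def)
  \<comment> \<open>the summand 1 avoids a division by zero and keeps t short of the second zero of the parabola\<close>
  define t where "t = - scalar_prod w w / (b + 1)"
  have "0 \<le> scalar_prod (v + t \<cdot>\<^sub>v w) (A *\<^sub>v (v + t \<cdot>\<^sub>v w))"
    using A'(3) v w by simp
  also have "A *\<^sub>v (v + t \<cdot>\<^sub>v w) = w + t \<cdot>\<^sub>v (A *\<^sub>v w)"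
    using mult_add_distrib_mat_vec[OF A'(1) v(1), of "t \<cdot>\<^sub>v w"] mult_mat_vec[OF A'(1) w] w by (simp add: w_def)
  also have "scalar_prod (v + t \<cdot>\<^sub>v w) (w + t \<cdot>\<^sub>v (A *\<^sub>v w)) = 2 * t * scalar_prod w w + t * t * b"
    using v w Aw z cross
    by (simp add: add_scalar_prod_distrib[of _ n] scalar_prod_add_distrib[of _ n] b_def w_def[symmetric])
  also have "\<dots> < 0"
  proof -
    let ?a = "scalar_prod w w"
    have tb: "t * (b + 1) = - ?a" using b by (simp add: t_def)
    have "(2 * t * ?a + t * t * b) * (b + 1) ^ 2 =
        2 * ?a * (t * (b + 1)) * (b + 1) + (t * (b + 1))\<^sup>2 * b"
      by (simp add: algebra_simps power2_eq_square)
    also have "\<dots> = - (?a\<^sup>2 * (b + 2))"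
      unfolding tb by (simp add: algebra_simps power2_eq_square)
    also have "\<dots> < 0" using ww b by (simp add: add_nonneg_pos)
    finally show ?thesis using b by (smt (verit) mult_nonneg_nonneg zero_le_power2)
  qed
  finally show False by simp
qed

lemma det_triangular_fun:
  fixes R :: "nat \<Rightarrow> nat \<Rightarrow> real"
  assumes "\<forall>k i. k < i \<longrightarrow> i < n \<longrightarrow> R k i = 0"
  shows "Determinant.det (Matrix.mat n n (\<lambda>(i, j). R i j)) = (\<Prod>k<n. R k k)"
  by (subst det_lower_triangular[of n])
     (use assms in \<open>auto simp: prod_list_diag_prod atLeast0LessThan intro!: prod.cong\<close>)

lemma cholesky:
  assumes A: "psd_mat n A" and "Determinant.det A \<noteq> 0"
  obtains R where "R \<in> carrier_mat n n" "A = transpose_mat R * R"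
    "\<forall>k i. k < i \<longrightarrow> i < n \<longrightarrow> R $$ (k, i) = 0" "\<forall>k<n. 0 < R $$ (k, k)"
    "Determinant.det R = (\<Prod>k<n. R $$ (k, k))"
proof -
  note A' = psd_matD[OF A]
  have "\<exists>R. (\<forall>k<n. 0 < R k k) \<and> (\<forall>k i. k < i \<longrightarrow> i < n \<longrightarrow> R k i = 0) \<and>
     (\<forall>i<n. \<forall>j<n. A $$ (i, j) = (\<Sum>k<n. R k i * R k j))"
  proof (rule cholesky_fun)
    fix v :: "nat \<Rightarrow> real" assume v: "\<exists>i<n. v i \<noteq> 0"
    let ?v = "Matrix.vec n v"
    have "?v \<noteq> 0\<^sub>v n" using v by (metis index_vec index_zero_vec(1))
    then have "0 < scalar_prod ?v (A *\<^sub>v ?v)" using psd_mat_pos[OF assms, of ?v] by simp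
    then show "0 < (\<Sum>i<n. \<Sum>j<n. v i * A $$ (i, j) * v j)"
      by (subst (asm) scalar_prod_mat_sum[OF A'(1)]) auto
  qed (rule psd_mat_sym[OF A])
  then obtain R where R: "\<forall>k<n. 0 < R k k" "\<forall>k i. k < i \<longrightarrow> i < n \<longrightarrow> R k i = 0"
     "\<forall>i<n. \<forall>j<n. A $$ (i, j) = (\<Sum>k<n. R k i * R k j)" by blast
  define M where "M = Matrix.mat n n (\<lambda>(i, j). R i j)"
  have "A = transpose_mat M * M"
    by (rule eq_matI) (use A'(1) R(3) in \<open>auto simp: M_def scalar_prod_def atLeast0LessThan\<close>)
  moreover have "Determinant.det M = (\<Prod>k<n. M $$ (k, k))"
    using det_triangular_fun[OF R(2)] by (simp add: M_def)
  ultimately show ?thesis using that[of M] R by (simp add: M_def)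
qed

text \<open>
  For a triangular Cholesky factor R the determinant is the product of the squares of the diagonal
  entries, whereas the trace is the sum of the squares of all entries.  So the inequality is
  \<open>ln r \<le> r - 1\<close>, and equality forces the diagonal to be 1 and all other entries to vanish.
\<close>

lemma ln_det_le_trace:
  assumes C: "psd_mat n C" and det: "0 < Determinant.det C"
  shows "ln (Determinant.det C) \<le> (\<Sum>i<n. C $$ (i, i)) - real n"
    and "ln (Determinant.det C) = (\<Sum>i<n. C $$ (i, i)) - real n \<Longrightarrow> C = 1\<^sub>m n"
proof -
  obtain R where R: "R \<in> carrier_mat n n" "C = transpose_mat R * R"
    "\<forall>k i. k < i \<longrightarrow> i < n \<longrightarrow> R $$ (k, i) = 0" "\<forall>k<n. 0 < R $$ (k, k)"
    "Determinant.det R = (\<Prod>k<n. R $$ (k, k))"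
    using cholesky[OF C less_imp_neq[OF det, symmetric]] by blast
  define r where "r k = (R $$ (k, k))\<^sup>2" for k
  have r: "0 < r k" if "k < n" for k using R(4) that by (auto simp: r_def)
  have "Determinant.det C = (Determinant.det R)\<^sup>2"
    using R(1) det_mult[of "transpose_mat R" n R] det_transpose[OF R(1)] by (simp add: R(2) power2_eq_square)
  also have "\<dots> = (\<Prod>k<n. r k)" by (simp add: R(5) prod_power_distrib r_def)
  finally have detC: "Determinant.det C = (\<Prod>k<n. r k)" .
  have "r k \<noteq> 0" if "k < n" for k using r[OF that] by simp
  then have ln: "ln (Determinant.det C) = (\<Sum>k<n. ln (r k))"
    unfolding detC using r by (intro ln_prod) auto
  have tr: "(\<Sum>i<n. C $$ (i, i)) = (\<Sum>i<n. \<Sum>k<n. (R $$ (k, i))\<^sup>2)"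
    unfolding R(2) using R(1) by (intro sum.cong refl) (auto simp: scalar_prod_def atLeast0LessThan power2_eq_square)
  have le2: "r i \<le> (\<Sum>k<n. (R $$ (k, i))\<^sup>2)" if "i < n" for i
    unfolding r_def using that by (intro member_le_sum) auto
  have le1: "ln (r k) \<le> r k - 1" if "k < n" for k using ln_le_minus_one r that by blast
  have a: "(\<Sum>k<n. ln (r k)) \<le> (\<Sum>k<n. r k - 1)" using le1 by (intro sum_mono) simp
  have b: "(\<Sum>k<n. r k) \<le> (\<Sum>i<n. C $$ (i, i))" unfolding tr using le2 by (intro sum_mono) simp
  show "ln (Determinant.det C) \<le> (\<Sum>i<n. C $$ (i, i)) - real n"
    unfolding ln using a b by (simp add: sum_subtractf)
  assume "ln (Determinant.det C) = (\<Sum>i<n. C $$ (i, i)) - real n"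
  with a b have eqs: "(\<Sum>k<n. ln (r k)) = (\<Sum>k<n. r k - 1)" "(\<Sum>k<n. r k) = (\<Sum>i<n. C $$ (i, i))"
    unfolding ln by (simp_all add: sum_subtractf)
  have r1: "r k = 1" if "k < n" for k
  proof -
    have "ln (r k) = r k - 1"
      using sum_mono_inv[OF eqs(1), of k] le1 that by auto
    then show ?thesis using ln_eq_minus_one r that by blast
  qed
  have diag: "R $$ (k, k) = 1" if "k < n" for k
    using r1[OF that] R(4) that by (auto simp: r_def power2_eq_1_iff)
  have "(\<Sum>k<n. (R $$ (k, i))\<^sup>2) = r i" if "i < n" for i
    using sum_mono_inv[OF eqs(2)[unfolded tr], of i] le2 that by auto
  then have "(\<Sum>k\<in>{..<n} - {i}. (R $$ (k, i))\<^sup>2) = 0" if "i < n" for i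
    using that sum.remove[of "{..<n}" i "\<lambda>k. (R $$ (k, i))\<^sup>2"] by (simp add: r_def)
  then have off: "R $$ (k, i) = 0" if "i < n" "k < n" "k \<noteq> i" for i k
    using that by (subst (asm) sum_nonneg_eq_0_iff) auto
  have "R = 1\<^sub>m n" by (rule eq_matI) (use R(1) diag off in auto)
  then show "C = 1\<^sub>m n" by (simp add: R(2))
qed

text \<open>
  The trace of the product, for symmetric matrices.
\<close>

definition frob :: "nat \<Rightarrow> real mat \<Rightarrow> real mat \<Rightarrow> real" where
  "frob n A B = (\<Sum>i<n. \<Sum>j<n. A $$ (i, j) * B $$ (i, j))"

text \<open>
  With \<open>B = R^T R\<close>, this is the preceding inequality for \<open>R A R^T\<close>, whose determinant is
  \<open>det A det B\<close> and whose trace is that of \<open>A B\<close>.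
\<close>

lemma ln_det_le_frob:
  assumes A: "psd_mat n A" "0 < Determinant.det A" and B: "psd_mat n B" "0 < Determinant.det B"
  shows "ln (Determinant.det A) + ln (Determinant.det B) \<le> frob n A B - real n"
    and "ln (Determinant.det A) + ln (Determinant.det B) = frob n A B - real n \<Longrightarrow> A * B = 1\<^sub>m n"
proof -
  note A' = psd_matD[OF A(1)]
  obtain R where R: "R \<in> carrier_mat n n" "B = transpose_mat R * R"
    using cholesky[OF B(1) less_imp_neq[OF B(2), symmetric]] by blast
  have Rt: "transpose_mat R \<in> carrier_mat n n" using R(1) by simp
  define C where "C = R * (A * transpose_mat R)"
  have C: "C \<in> carrier_mat n n" using R(1) A'(1) by (simp add: C_def)
  have "transpose_mat C = C"
    using R(1) Rt A'(1,2) by (simp add: C_def transpose_mult[of _ n n _ n] assoc_mult_mat[of _ n n _ n _ n])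
  moreover have "0 \<le> scalar_prod v (C *\<^sub>v v)" if v: "v \<in> carrier_vec n" for v
  proof -
    have u: "transpose_mat R *\<^sub>v v \<in> carrier_vec n" using Rt v by simp
    have Au: "A *\<^sub>v (transpose_mat R *\<^sub>v v) \<in> carrier_vec n" using A'(1) u by simp
    have "C *\<^sub>v v = R *\<^sub>v (A *\<^sub>v (transpose_mat R *\<^sub>v v))"
      using R(1) Rt A'(1) v
      by (simp add: C_def assoc_mult_mat_vec[of _ n n _ n])
    then have "scalar_prod v (C *\<^sub>v v) = scalar_prod (transpose_mat R *\<^sub>v v) (A *\<^sub>v (transpose_mat R *\<^sub>v v))"
      using transpose_vec_mult_scalar[OF R(1) Au v] by simp
    then show ?thesis using A'(3)[OF u] by simp
  qed
  ultimately have psd: "psd_mat n C" using C by (simp add: psd_mat_def)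
  have "Determinant.det B = Determinant.det R * Determinant.det R"
    using det_mult[OF Rt R(1)] det_transpose[OF R(1)] by (simp add: R(2))
  moreover have "Determinant.det C = Determinant.det R * (Determinant.det A * Determinant.det R)"
    using R(1) Rt A'(1) det_transpose[OF R(1)] by (simp add: C_def det_mult[of _ n])
  ultimately have detC: "Determinant.det C = Determinant.det A * Determinant.det B" by simp
  then have pos: "0 < Determinant.det C" using A B by simp
  have ln: "ln (Determinant.det C) = ln (Determinant.det A) + ln (Determinant.det B)"
    unfolding detC using A(2) B(2) by (simp add: ln_mult)
  have tr: "(\<Sum>i<n. C $$ (i, i)) = frob n A B"
  proof -
    have "(\<Sum>i<n. C $$ (i, i)) = (\<Sum>i<n. \<Sum>j<n. \<Sum>k<n. R $$ (i, j) * (A $$ (j, k) * R $$ (i, k)))"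
      using R(1) A'(1)
      by (intro sum.cong refl)
        (auto simp: C_def scalar_prod_def atLeast0LessThan sum_distrib_left)
    also have "\<dots> = (\<Sum>j<n. \<Sum>i<n. \<Sum>k<n. R $$ (i, j) * (A $$ (j, k) * R $$ (i, k)))"
      by (rule sum.swap)
    also have "\<dots> = (\<Sum>j<n. \<Sum>k<n. \<Sum>i<n. R $$ (i, j) * (A $$ (j, k) * R $$ (i, k)))"
      by (intro sum.cong refl sum.swap)
    also have "\<dots> = frob n A B"
      unfolding frob_def R(2) using R(1)
      by (intro sum.cong refl) (auto simp: scalar_prod_def atLeast0LessThan sum_distrib_left mult_ac)
    finally show ?thesis .
  qed
  show "ln (Determinant.det A) + ln (Determinant.det B) \<le> frob n A B - real n"
    using ln_det_le_trace(1)[OF psd pos] by (simp add: ln tr)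
  assume "ln (Determinant.det A) + ln (Determinant.det B) = frob n A B - real n"
  then have "C = 1\<^sub>m n"
    using ln_det_le_trace(2)[OF psd pos] by (simp add: ln tr)
  then have "R * (A * transpose_mat R) = 1\<^sub>m n" by (simp add: C_def)
  then have "(A * transpose_mat R) * R = 1\<^sub>m n"
    using mat_mult_left_right_inverse[OF R(1)] A'(1) Rt by simp
  then show "A * B = 1\<^sub>m n"
    using A'(1) R Rt by (simp add: assoc_mult_mat[of _ n n _ n _ n])
qed

lemma sum_ereal_minus_infinity:
  fixes f :: "'a \<Rightarrow> ereal"
  assumes "finite G" "g \<in> G" "f g = -\<infinity>" "\<And>h. h \<in> G \<Longrightarrow> f h \<noteq> \<infinity>"
  shows "sum f G = -\<infinity>"
proof -
  have "sum f (G - {g}) \<noteq> \<infinity>" using assms by (auto simp: sum_Pinfty)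
  then show ?thesis using assms by (subst sum.remove[of G g]) auto
qed

lemma sum_log_det:
  assumes "finite G" "\<And>g. g \<in> G \<Longrightarrow> 0 < Determinant.det (A g)"
  shows "(\<Sum>g\<in>G. log_det (A g)) = ereal (\<Sum>g\<in>G. ln (Determinant.det (A g)))"
  using assms by (simp add: log_det_def)

text \<open>
  Weak duality in the form used for both the relaxation and its dual: one family consists of the
  matrices of a feasible point, the other one of a fixed family of nonsingular matrices.
\<close>

lemma sum_log_det_le:
  fixes G :: "'g set" and m :: "'g \<Rightarrow> nat"
  assumes fin: "finite G"
    and A: "\<And>g. g \<in> G \<Longrightarrow> psd_mat (m g) (A g)"
    and B: "\<And>g. g \<in> G \<Longrightarrow> psd_mat (m g) (B g)" "\<And>g. g \<in> G \<Longrightarrow> 0 < Determinant.det (B g)"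
    and frob: "(\<Sum>g\<in>G. frob (m g) (A g) (B g)) = (\<Sum>g\<in>G. real (m g))"
  shows "(\<Sum>g\<in>G. log_det (A g)) \<le> ereal (- (\<Sum>g\<in>G. ln (Determinant.det (B g))))"
    and "(\<Sum>g\<in>G. log_det (A g)) = ereal (- (\<Sum>g\<in>G. ln (Determinant.det (B g)))) \<Longrightarrow> g \<in> G \<Longrightarrow>
      A g * B g = 1\<^sub>m (m g)"
proof -
  have fin': "log_det (A g) \<noteq> \<infinity>" for g by (simp add: log_det_def)
  have "(\<Sum>g\<in>G. log_det (A g)) \<le> ereal (- (\<Sum>g\<in>G. ln (Determinant.det (B g)))) \<and>
    ((\<Sum>g\<in>G. log_det (A g)) = ereal (- (\<Sum>g\<in>G. ln (Determinant.det (B g)))) \<longrightarrow>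
      (\<forall>g\<in>G. A g * B g = 1\<^sub>m (m g)))"
  proof (cases "\<forall>g\<in>G. 0 < Determinant.det (A g)")
    case True
    note le = ln_det_le_frob[OF A _ B]
    have sum: "(\<Sum>g\<in>G. log_det (A g)) = ereal (\<Sum>g\<in>G. ln (Determinant.det (A g)))"
      using sum_log_det[OF fin] True by blast
    have mono: "(\<Sum>g\<in>G. ln (Determinant.det (A g)) + ln (Determinant.det (B g))) \<le> (\<Sum>g\<in>G. frob (m g) (A g) (B g) - real (m g))"
      using True by (intro sum_mono le(1)) auto
    moreover have "(\<Sum>g\<in>G. frob (m g) (A g) (B g) - real (m g)) = 0" using frob by (simp add: sum_subtractf)
    ultimately have 1: "(\<Sum>g\<in>G. ln (Determinant.det (A g))) \<le> - (\<Sum>g\<in>G. ln (Determinant.det (B g)))"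
      by (simp add: sum.distrib)
    have 2: "\<forall>g\<in>G. A g * B g = 1\<^sub>m (m g)"
      if "(\<Sum>g\<in>G. ln (Determinant.det (A g))) = - (\<Sum>g\<in>G. ln (Determinant.det (B g)))"
    proof
      fix g assume g: "g \<in> G"
      have "(\<Sum>g\<in>G. ln (Determinant.det (A g)) + ln (Determinant.det (B g))) = (\<Sum>g\<in>G. frob (m g) (A g) (B g) - real (m g))"
        using that frob by (simp add: sum_subtractf sum.distrib)
      from sum_mono_inv[OF this _ g fin] True
      have "ln (Determinant.det (A g)) + ln (Determinant.det (B g)) = frob (m g) (A g) (B g) - real (m g)"
        using le(1) by auto
      then show "A g * B g = 1\<^sub>m (m g)" using le(2) g True by blast
    qed
    show ?thesis using 1 2 by (simp add: sum)
  next
    case False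
    then obtain g where "g \<in> G" "log_det (A g) = -\<infinity>" by (auto simp: log_det_def)
    then have "(\<Sum>g\<in>G. log_det (A g)) = -\<infinity>"
      by (intro sum_ereal_minus_infinity[OF fin _ _ fin'])
    then show ?thesis by simp
  qed
  then show "(\<Sum>g\<in>G. log_det (A g)) \<le> ereal (- (\<Sum>g\<in>G. ln (Determinant.det (B g))))"
    and "(\<Sum>g\<in>G. log_det (A g)) = ereal (- (\<Sum>g\<in>G. ln (Determinant.det (B g)))) \<Longrightarrow> g \<in> G \<Longrightarrow>
      A g * B g = 1\<^sub>m (m g)" by blast+
qed

lemma mat_inverse_nonsingular:
  fixes M :: "real mat"
  assumes M: "M \<in> carrier_mat n n" "Determinant.det M \<noteq> 0"
  obtains B where "mat_inverse M = Some B" "M * B = 1\<^sub>m n" "B * M = 1\<^sub>m n" "B \<in> carrier_mat n n"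
proof (cases "mat_inverse M")
  case None
  then show ?thesis
    using mat_inverse(1)[OF M(1), of "()"] det_non_zero_imp_unit[OF M, of "()"] by simp
next
  case (Some B)
  then show ?thesis using mat_inverse(2)[OF M(1) Some] that by simp
qed

lemma mat_inverse_unique:
  fixes M :: "real mat"
  assumes M: "M \<in> carrier_mat n n" and B: "B \<in> carrier_mat n n" "B * M = 1\<^sub>m n"
  shows "mat_inverse M = Some B"
proof -
  have "Determinant.det B * Determinant.det M = 1"
    using det_mult[OF B(1) M] B(2) by simp
  then have "Determinant.det M \<noteq> 0" by auto
  then obtain C where C: "mat_inverse M = Some C" "M * C = 1\<^sub>m n" "C \<in> carrier_mat n n"
    using mat_inverse_nonsingular[OF M] by metis
  have "B = B * (M * C)" using B(1) C(2) by simp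
  also have "\<dots> = (B * M) * C" by (rule assoc_mult_mat[OF B(1) M C(3), symmetric])
  also have "\<dots> = C" using B(2) C(3) by simp
  finally show ?thesis using C(1) by simp
qed

lemma psd_mat_inverse:
  assumes M: "psd_mat n M" and B: "M * B = 1\<^sub>m n" "B \<in> carrier_mat n n"
  shows "psd_mat n B" "Determinant.det B * Determinant.det M = 1"
proof -
  note M' = psd_matD[OF M]
  show "Determinant.det B * Determinant.det M = 1"
    using det_mult[OF M'(1) B(2)] B(1) by (simp add: mult.commute)
  have Bt: "transpose_mat B \<in> carrier_mat n n" using B(2) by simp
  have "transpose_mat B * M = 1\<^sub>m n"
    using transpose_mult[OF M'(1) B(2)] B(1) M'(2) by simp
  then have "transpose_mat B = transpose_mat B * (M * B)" using B Bt by simp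
  also have "\<dots> = (transpose_mat B * M) * B" by (rule assoc_mult_mat[OF Bt M'(1) B(2), symmetric])
  also have "\<dots> = B" using \<open>transpose_mat B * M = 1\<^sub>m n\<close> B(2) by simp
  finally have sym: "transpose_mat B = B" .
  moreover have "0 \<le> scalar_prod v (B *\<^sub>v v)" if v: "v \<in> carrier_vec n" for v
  proof -
    have u: "B *\<^sub>v v \<in> carrier_vec n" using B(2) v by simp
    have "M *\<^sub>v (B *\<^sub>v v) = v" using B M'(1) v by (simp flip: assoc_mult_mat_vec[of M n n B n])
    then show ?thesis using M'(3)[OF u] comm_scalar_prod[OF u v] by simp
  qed
  ultimately show "psd_mat n B" using B(2) by (simp add: psd_mat_def)
qed

lemma pos_def_det_pos:
  assumes A: "psd_mat n A" and pos: "\<And>v. v \<in> carrier_vec n \<Longrightarrow> v \<noteq> 0\<^sub>v n \<Longrightarrow> scalar_prod v (A *\<^sub>v v) \<noteq> 0"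
  shows "0 < Determinant.det A"
proof -
  note A' = psd_matD[OF A]
  have "Determinant.det A \<noteq> 0"
  proof
    assume "Determinant.det A = 0"
    then obtain v where v: "v \<in> carrier_vec n" "v \<noteq> 0\<^sub>v n" "A *\<^sub>v v = 0\<^sub>v n"
      using det_0_iff_vec_prod_zero_field[OF A'(1)] by blast
    then show False using pos[OF v(1,2)] by simp
  qed
  then obtain R where R: "R \<in> carrier_mat n n" "A = transpose_mat R * R"
    using cholesky[OF A] by blast
  then have "Determinant.det A = (Determinant.det R)\<^sup>2"
    using det_mult[of "transpose_mat R" n R] det_transpose[OF R(1)] by (simp add: power2_eq_square)
  with \<open>Determinant.det A \<noteq> 0\<close> show ?thesis by (simp add: zero_less_power2)
qed

text \<open>
  A homogeneous system with more unknowns than equations becomes a square system with a zero row.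
\<close>

lemma linear_dependence:
  fixes a :: "nat \<Rightarrow> nat \<Rightarrow> real"
  assumes "m < N"
  obtains c where "\<exists>j<N. c j \<noteq> 0" "\<And>i. i < m \<Longrightarrow> (\<Sum>j<N. c j * a i j) = 0"
proof -
  define A where "A = Matrix.mat N N (\<lambda>(i, j). if i < m then a i j else 0)"
  have A: "A \<in> carrier_mat N N" by (simp add: A_def)
  have "transpose_mat A *\<^sub>v unit_vec N (N - 1) = 0\<^sub>v N"
    using assms by (intro eq_vecI) (auto simp: A_def)
  moreover have "unit_vec N (N - 1) \<noteq> (0\<^sub>v N :: real Matrix.vec)"
  proof
    assume "unit_vec N (N - 1) = (0\<^sub>v N :: real Matrix.vec)"
    then have "vec_index (unit_vec N (N - 1) :: real Matrix.vec) (N - 1) = vec_index (0\<^sub>v N) (N - 1)" by simp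
    then show False using assms by simp
  qed
  moreover have At: "transpose_mat A \<in> carrier_mat N N" using A by simp
  ultimately have "Determinant.det (transpose_mat A) = 0"
    unfolding det_0_iff_vec_prod_zero_field[OF At] by (intro exI[of _ "unit_vec N (N - 1)"]) simp
  then have "Determinant.det A = 0" using det_transpose[OF A] by simp
  then obtain v where v: "v \<in> carrier_vec N" "v \<noteq> 0\<^sub>v N" "A *\<^sub>v v = 0\<^sub>v N"
    using det_0_iff_vec_prod_zero_field[OF A] by blast
  show ?thesis
  proof (rule that[of "vec_index v"])
    show "\<exists>j<N. vec_index v j \<noteq> 0"
      using v(1,2) by (metis eq_vecI carrier_vecD index_zero_vec)
    fix i assume "i < m"
    then have "vec_index (A *\<^sub>v v) i = (\<Sum>j<N. a i j * vec_index v j)"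
      using assms v(1) by (auto simp: A_def scalar_prod_def atLeast0LessThan intro!: sum.cong)
    then show "(\<Sum>j<N. vec_index v j * a i j) = 0"
      using v(3) \<open>i < m\<close> assms by (simp add: mult.commute)
  qed
qed

section \<open>Tchakaloff's theorem\<close>

text \<open>
  If there are more than N atoms, subtract a multiple of a linear relation between them that makes one
  weight vanish and keeps the other ones nonnegative.
\<close>

lemma conic_caratheodory:
  fixes f :: "nat \<Rightarrow> 'a \<Rightarrow> real" and w :: "'a \<Rightarrow> real"
  assumes "finite P" "\<And>p. p \<in> P \<Longrightarrow> 0 < w p"
  shows "\<exists>Q u. Q \<subseteq> P \<and> card Q \<le> N \<and> (\<forall>p\<in>Q. 0 < u p) \<and>
    (\<forall>i<N. (\<Sum>p\<in>Q. u p * f i p) = (\<Sum>p\<in>P. w p * f i p))"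
  using assms
proof (induction "card P" arbitrary: P w rule: less_induct)
  case less
  show ?case
  proof (cases "card P \<le> N")
    case True
    then show ?thesis using less.prems by blast
  next
    case False
    define e where "e = from_nat_into P"
    have e: "bij_betw e {..<card P} P"
      unfolding e_def using less.prems(1) by (rule bij_betw_from_nat_into_finite)
    obtain c where c: "\<exists>j<card P. c j \<noteq> 0" "\<And>i. i < N \<Longrightarrow> (\<Sum>j<card P. c j * f i (e j)) = 0"
      using linear_dependence[of N "card P" "\<lambda>i j. f i (e j)"] False by (metis not_le)
    define g where "g p = c (inv_into {..<card P} e p)" for p
    have g_e: "g (e j) = c j" if "j < card P" for j
      using that bij_betw_inv_into_left[OF e, of j] by (simp add: g_def)
    have g: "(\<Sum>p\<in>P. g p * f i p) = 0" if "i < N" for i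
      using c(2)[OF that] by (simp add: sum.reindex_bij_betw[OF e, symmetric] g_e)
    have "\<exists>p\<in>P. g p \<noteq> 0" using c(1) g_e bij_betwE[OF e] by (metis lessThan_iff)
    then obtain s :: real and p0 where s: "p0 \<in> P" "0 < s * g p0"
    proof -
      assume *: "\<And>p0 s. p0 \<in> P \<Longrightarrow> 0 < s * g p0 \<Longrightarrow> thesis"
      obtain p where "p \<in> P" "g p \<noteq> 0" using \<open>\<exists>p\<in>P. g p \<noteq> 0\<close> by blast
      then have "0 < g p * g p" using not_real_square_gt_zero[of "g p"] by blast
      then show thesis by (rule *[OF \<open>p \<in> P\<close>])
    qed
    define h where "h p = s * g p" for p
    have h: "(\<Sum>p\<in>P. h p * f i p) = 0" if "i < N" for i
      using g[OF that] by (simp add: h_def mult.assoc flip: sum_distrib_left)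
    define D where "D = {p \<in> P. 0 < h p}"
    have D: "finite D" "D \<noteq> {}" "D \<subseteq> P" using less.prems(1) s by (auto simp: D_def h_def)
    define t where "t = Min ((\<lambda>p. w p / h p) ` D)"
    have "t \<in> (\<lambda>p. w p / h p) ` D" unfolding t_def using D by (intro Min_in) auto
    then obtain q where q: "q \<in> D" "t = w q / h q" by blast
    have t_le: "t \<le> w p / h p" if "p \<in> D" for p unfolding t_def using D that by (intro Min_le) auto
    have t0: "0 \<le> t" using q less.prems(2)[of q] by (auto simp: D_def)
    define v where "v p = w p - t * h p" for p
    have v0: "0 \<le> v p" if "p \<in> P" for p
    proof (cases "p \<in> D")
      case True
      then show ?thesis using t_le[OF True] by (simp add: v_def D_def field_simps)
    next
      case False
      then have "t * h p \<le> 0" using t0 that by (intro mult_nonneg_nonpos) (auto simp: D_def)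
      then show ?thesis using less.prems(2)[OF that] by (simp add: v_def)
    qed
    have vq: "v q = 0" using q by (simp add: v_def D_def)
    define P' where "P' = {p \<in> P. v p \<noteq> 0}"
    have "P' \<subset> P" using q vq D by (auto simp: P'_def)
    then have "card P' < card P" using less.prems(1) by (rule psubset_card_mono[rotated])
    moreover have "finite P'" using less.prems(1) by (simp add: P'_def)
    moreover have "0 < v p" if "p \<in> P'" for p using that v0[of p] by (auto simp: P'_def less_le)
    ultimately obtain Q u where Q: "Q \<subseteq> P' \<and> card Q \<le> N \<and> (\<forall>p\<in>Q. 0 < u p) \<and>
        (\<forall>i<N. (\<Sum>p\<in>Q. u p * f i p) = (\<Sum>p\<in>P'. v p * f i p))"
      using less.hyps[of P' v] by blast
    moreover have "(\<Sum>p\<in>P'. v p * f i p) = (\<Sum>p\<in>P. w p * f i p)" if "i < N" for i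
    proof -
      have "(\<Sum>p\<in>P'. v p * f i p) = (\<Sum>p\<in>P. v p * f i p)"
        unfolding P'_def using less.prems(1) by (intro sum.mono_neutral_left) auto
      also have "\<dots> = (\<Sum>p\<in>P. w p * f i p) - t * (\<Sum>p\<in>P. h p * f i p)"
        by (simp add: v_def left_diff_distrib sum_subtractf sum_distrib_left mult.assoc)
      finally show ?thesis using h[OF that] by simp
    qed
    ultimately show ?thesis by (intro exI[of _ Q] exI[of _ u]) (auto simp: P'_def)
  qed
qed

text \<open>
  The identity is a limit of simple functions.  Projecting their values to S yields discrete
  measures with atoms in S whose integrals converge by dominated convergence.
\<close>

lemma discretize_measure:
  fixes \<phi> :: "'a::euclidean_space measure" and S :: "'a set"
  assumes S: "compact S" "convex S" "S \<noteq> {}"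
    and sets [simp]: "sets \<phi> = sets borel" and "prob_space \<phi>" and carried: "emeasure \<phi> (- S) = 0"
  shows "\<exists>(P :: nat \<Rightarrow> 'a set) w. (\<forall>k. finite (P k) \<and> P k \<subseteq> S \<and> (\<forall>p\<in>P k. 0 < w k p)) \<and>
    (\<forall>f :: 'a \<Rightarrow> real. continuous_on UNIV f \<longrightarrow> (\<lambda>k. \<Sum>p\<in>P k. w k p * f p) \<longlonglongrightarrow> (\<integral>x. f x \<partial>\<phi>))"
proof -
  interpret prob_space \<phi> by fact
  have [measurable_cong]: "sets \<phi> = sets borel" by simp
  have [simp]: "space \<phi> = UNIV" using sets_eq_imp_space_eq[OF sets] by simp
  have "(\<lambda>x. x) \<in> borel_measurable \<phi>" by simp
  from borel_measurable_implies_sequence_metric[OF this, of undefined] obtain F where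
    F: "\<And>i. simple_function \<phi> (F i)" "\<And>x. (\<lambda>i. F i x) \<longlonglongrightarrow> x" by auto
  define G where "G i x = closest_point S (F i x)" for i x
  have G: "simple_function \<phi> (G i)" for i
    unfolding G_def[abs_def] using F(1) by (rule simple_function_compose1)
  have GS: "G i x \<in> S" for i x
    unfolding G_def using S by (intro closest_point_in_set compact_imp_closed) auto
  have G_lim: "(\<lambda>i. G i x) \<longlonglongrightarrow> x" if "x \<in> S" for x
  proof -
    have "isCont (closest_point S) x"
      using S continuous_at_closest_point compact_imp_closed by blast
    then have "(\<lambda>i. closest_point S (F i x)) \<longlonglongrightarrow> closest_point S x"
      using F(2) by (rule isCont_tendsto_compose)
    then show ?thesis using that by (simp add: G_def closest_point_self)
  qed
  define R where "R i = range (G i)" for i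
  have R: "finite (R i)" for i using simple_functionD(1)[OF G] by (simp add: R_def)
  define w where "w i p = measure \<phi> (G i -` {p})" for i p
  define P where "P i = {p \<in> R i. 0 < w i p}" for i
  have eq: "(\<integral>x. f (G i x) \<partial>\<phi>) = (\<Sum>p\<in>P i. w i p * f p)" for f :: "'a \<Rightarrow> real" and i
  proof -
    have m: "G i -` {p} \<in> events" for p using simple_functionD(2)[OF G, of i "{p}"] by simp
    have "f (G i x) = (\<Sum>p\<in>R i. f p * indicator (G i -` {p}) x)" for x
    proof -
      have "(\<Sum>p\<in>R i. f p * indicator (G i -` {p}) x) = (\<Sum>p\<in>R i. if p = G i x then f p else 0)"
        by (intro sum.cong) (auto simp: indicator_def)
      then show ?thesis using R by (simp add: R_def)
    qed
    then have "(\<integral>x. f (G i x) \<partial>\<phi>) = (\<Sum>p\<in>R i. f p * measure \<phi> (G i -` {p}))"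
      using m by (simp add: Bochner_Integration.integral_sum less_top[symmetric])
    also have "\<dots> = (\<Sum>p\<in>P i. f p * measure \<phi> (G i -` {p}))"
      unfolding P_def using R by (intro sum.mono_neutral_right) (auto simp: w_def less_le)
    finally show ?thesis by (simp add: w_def mult.commute)
  qed
  have "(\<lambda>k. \<integral>x. f (G k x) \<partial>\<phi>) \<longlonglongrightarrow> (\<integral>x. f x \<partial>\<phi>)" if f: "continuous_on UNIV f" for f :: "'a \<Rightarrow> real"
  proof -
    have "compact (f ` S)" using f S by (intro compact_continuous_image) (auto intro: continuous_on_subset)
    then obtain C where C: "\<And>x. x \<in> S \<Longrightarrow> \<bar>f x\<bar> \<le> C"
      using compact_imp_bounded bounded_iff by (metis imageI real_norm_def)
    show ?thesis
    proof (rule integral_dominated_convergence[where w = "\<lambda>_. C"])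
      show "f \<in> borel_measurable \<phi>"
        by (subst measurable_cong_sets[OF sets refl]) (rule borel_measurable_continuous_onI[OF f])
      show "(\<lambda>x. f (G i x)) \<in> borel_measurable \<phi>" for i
        using simple_function_compose1[OF G, of f i] by (rule borel_measurable_simple_function)
      show "AE x in \<phi>. norm (f (G i x)) \<le> C" for i using C GS by simp
      show "AE x in \<phi>. (\<lambda>i. f (G i x)) \<longlonglongrightarrow> f x"
      proof (rule AE_I[where N = "- S"])
        show "{x \<in> space \<phi>. \<not> (\<lambda>i. f (G i x)) \<longlonglongrightarrow> f x} \<subseteq> - S"
        proof
          fix x assume "x \<in> {x \<in> space \<phi>. \<not> (\<lambda>i. f (G i x)) \<longlonglongrightarrow> f x}"
          moreover have "(\<lambda>i. f (G i x)) \<longlonglongrightarrow> f x" if "x \<in> S"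
            using f G_lim[OF that] continuous_on_eq_continuous_at isCont_tendsto_compose open_UNIV by blast
          ultimately show "x \<in> - S" by blast
        qed
        show "- S \<in> sets \<phi>" using S by (simp add: borel_compact borel_comp)
      qed (rule carried)
    qed simp
  qed
  then have "(\<lambda>k. \<Sum>p\<in>P k. w k p * f p) \<longlonglongrightarrow> (\<integral>x. f x \<partial>\<phi>)" if "continuous_on UNIV f" for f
    using that eq by simp
  then show ?thesis
    using R GS by (intro exI[of _ P] exI[of _ w]) (auto simp: P_def R_def)
qed

lemma compact_convergent_subsequence_finite:
  fixes K :: "'b::metric_space set" and Z :: "nat \<Rightarrow> nat \<Rightarrow> 'b"
  assumes "compact K" "\<And>k j. j < N \<Longrightarrow> Z k j \<in> K"
  shows "\<exists>r l. strict_mono r \<and> (\<forall>j<N. l j \<in> K \<and> (\<lambda>k. Z (r k) j) \<longlonglongrightarrow> l j)"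
  using assms(2)
proof (induction N)
  case 0
  show ?case by (intro exI[of _ id]) (auto simp: strict_mono_def)
next
  case (Suc N)
  then obtain r l where r: "strict_mono r" "\<And>j. j < N \<Longrightarrow> l j \<in> K" "\<And>j. j < N \<Longrightarrow> (\<lambda>k. Z (r k) j) \<longlonglongrightarrow> l j"
    by (metis less_Suc_eq)
  have "\<forall>k. Z (r k) N \<in> K" using Suc.prems by simp
  then obtain y s where s: "y \<in> K" "strict_mono (s :: nat \<Rightarrow> nat)" "((\<lambda>k. Z (r k) N) \<circ> s) \<longlonglongrightarrow> y"
    using assms(1) unfolding compact_def by metis
  have "(\<lambda>k. Z ((r \<circ> s) k) j) \<longlonglongrightarrow> (l(N := y)) j \<and> (l(N := y)) j \<in> K" if "j < Suc N" for j
  proof (cases "j = N")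
    case False
    then show ?thesis using that r(2,3)[of j] LIMSEQ_subseq_LIMSEQ[OF _ s(2), of "\<lambda>k. Z (r k) j" "l j"]
      by (simp add: o_def)
  qed (use s in \<open>simp add: o_def\<close>)
  then show ?case using strict_mono_o[OF r(1) s(2)] by blast
qed

text \<open>
  The moments of discrete approximations converge.  By Caratheodory's argument each approximation can be
  replaced by one with the same moments and at most N atoms; its atoms and weights stay in a
  compact set, so that a subsequence converges.  Finally atoms that have become equal are merged.
  The constant function among the \<open>f i\<close> bounds the weights.
\<close>

lemma tchakaloff:
  fixes \<phi> :: "'a::euclidean_space measure" and S :: "'a set" and f :: "nat \<Rightarrow> 'a \<Rightarrow> real"
  assumes S: "compact S" "convex S" "S \<noteq> {}"
    and \<phi>: "sets \<phi> = sets borel" "prob_space \<phi>" "emeasure \<phi> (- S) = 0"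
    and f: "\<And>i. i < N \<Longrightarrow> continuous_on UNIV (f i)" and one: "i0 < N" "f i0 = (\<lambda>_. 1)"
  shows "\<exists>P w. finite P \<and> P \<subseteq> S \<and> card P \<le> N \<and> (\<forall>p\<in>P. 0 < w p) \<and>
    (\<forall>i<N. (\<Sum>p\<in>P. w p * f i p) = (\<integral>x. f i x \<partial>\<phi>))"
proof -
  obtain P :: "nat \<Rightarrow> 'a set" and w :: "nat \<Rightarrow> 'a \<Rightarrow> real" where
    Pw: "(\<forall>k. finite (P k) \<and> P k \<subseteq> S \<and> (\<forall>p\<in>P k. 0 < w k p)) \<and>
    (\<forall>f :: 'a \<Rightarrow> real. continuous_on UNIV f \<longrightarrow> (\<lambda>k. \<Sum>p\<in>P k. w k p * f p) \<longlonglongrightarrow> (\<integral>x. f x \<partial>\<phi>))"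
    using discretize_measure[OF S \<phi>] by (elim exE)
  have P: "\<And>k. finite (P k)" "\<And>k. P k \<subseteq> S" "\<And>k p. p \<in> P k \<Longrightarrow> 0 < w k p"
    and lim: "\<And>f :: 'a \<Rightarrow> real. continuous_on UNIV f \<Longrightarrow> (\<lambda>k. \<Sum>p\<in>P k. w k p * f p) \<longlonglongrightarrow> (\<integral>x. f x \<partial>\<phi>)"
    using Pw by simp_all
  \<comment> \<open>used to pad the list of atoms to length N with weights zero\<close>
  obtain s0 where s0: "s0 \<in> S" using S(3) by blast
  define m where "m k = (\<Sum>p\<in>P k. w k p)" for k
  have m_lim: "m \<longlonglongrightarrow> 1"
    using lim[of "\<lambda>_. 1"] prob_space.prob_space[OF \<phi>(2)] by (simp add: m_def[abs_def])
  then obtain M where M: "\<And>k. m k \<le> M"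
    using convergent_imp_bounded[of m] unfolding bounded_iff convergent_def by (force simp: abs_le_iff)
  have "\<exists>X \<gamma>. \<forall>i<N. (\<forall>j<N. X j \<in> S \<and> \<gamma> j \<in> {0..M}) \<and> (\<Sum>j<N. \<gamma> j * f i (X j)) = (\<Sum>p\<in>P k. w k p * f i p)" for k
  proof -
    obtain Q u where Q: "Q \<subseteq> P k" "card Q \<le> N" "\<forall>p\<in>Q. 0 < u p"
      "\<forall>i<N. (\<Sum>p\<in>Q. u p * f i p) = (\<Sum>p\<in>P k. w k p * f i p)"
      using conic_caratheodory[of "P k" "w k" N f] P by blast
    have finQ: "finite Q" using Q(1) P(1) finite_subset by blast
    define e where "e = from_nat_into Q"
    have e: "bij_betw e {..<card Q} Q"
      unfolding e_def using finQ by (rule bij_betw_from_nat_into_finite)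
    define X where "X j = (if j < card Q then e j else s0)" for j
    define \<gamma> where "\<gamma> j = (if j < card Q then u (e j) else 0)" for j
    have sum: "(\<Sum>j<N. \<gamma> j * f i (X j)) = (\<Sum>p\<in>Q. u p * f i p)" for i
    proof -
      have "(\<Sum>j<N. \<gamma> j * f i (X j)) = (\<Sum>j<card Q. u (e j) * f i (e j))"
        by (rule sum.mono_neutral_cong_right) (use Q(2) in \<open>auto simp: \<gamma>_def X_def\<close>)
      then show ?thesis using sum.reindex_bij_betw[OF e, of "\<lambda>p. u p * f i p"] by simp
    qed
    have \<gamma>0: "0 \<le> \<gamma> j" for j using Q(3) bij_betwE[OF e] by (auto simp: \<gamma>_def less_imp_le)
    have "(\<Sum>p\<in>Q. u p) = m k" using Q(4)[rule_format, OF one(1)] by (simp add: one(2) m_def)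
    then have "(\<Sum>j<N. \<gamma> j) = m k" using sum[of i0] by (simp add: one(2))
    then have "\<gamma> j \<le> M" if "j < N" for j
      using member_le_sum[of j "{..<N}" \<gamma>] \<gamma>0 that M[of k] by fastforce
    moreover have "X j \<in> S" for j using bij_betwE[OF e] Q(1) P(2)[of k] s0 by (auto simp: X_def)
    ultimately show ?thesis using sum Q(4) \<gamma>0 by (intro exI[of _ X] exI[of _ \<gamma>]) auto
  qed
  then obtain X \<gamma> where X: "\<And>k j. j < N \<Longrightarrow> X k j \<in> S" "\<And>k j. j < N \<Longrightarrow> \<gamma> k j \<in> {0..M}"
    "\<And>k i. i < N \<Longrightarrow> (\<Sum>j<N. \<gamma> k j * f i (X k j)) = (\<Sum>p\<in>P k. w k p * f i p)"
    by metis
  have "\<exists>r l. strict_mono r \<and> (\<forall>j<N. l j \<in> S \<times> {0..M} \<and> (\<lambda>k. (X (r k) j, \<gamma> (r k) j)) \<longlonglongrightarrow> l j)"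
    by (rule compact_convergent_subsequence_finite) (use S X in \<open>auto intro: compact_Times\<close>)
  then obtain r l where r: "strict_mono r" and l: "\<And>j. j < N \<Longrightarrow> l j \<in> S \<times> {0..M}"
    "\<And>j. j < N \<Longrightarrow> (\<lambda>k. (X (r k) j, \<gamma> (r k) j)) \<longlonglongrightarrow> l j" by blast
  define x where "x j = fst (l j)" for j
  define c where "c j = snd (l j)" for j
  have lims: "(\<lambda>k. X (r k) j) \<longlonglongrightarrow> x j" "(\<lambda>k. \<gamma> (r k) j) \<longlonglongrightarrow> c j" if "j < N" for j
    using tendsto_fst[OF l(2)[OF that]] tendsto_snd[OF l(2)[OF that]] by (simp_all add: x_def c_def)
  have c0: "0 \<le> c j" and xS: "x j \<in> S" if "j < N" for j using l(1)[OF that] by (auto simp: c_def x_def mem_Times_iff)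
  have total: "(\<Sum>j<N. c j * f i (x j)) = (\<integral>x. f i x \<partial>\<phi>)" if "i < N" for i
  proof (rule LIMSEQ_unique)
    show "(\<lambda>k. \<Sum>j<N. \<gamma> (r k) j * f i (X (r k) j)) \<longlonglongrightarrow> (\<Sum>j<N. c j * f i (x j))"
    proof (intro tendsto_sum tendsto_mult)
      fix j assume "j \<in> {..<N}"
      moreover have "isCont (f i) (x j)"
        using f[OF that] continuous_on_eq_continuous_at[OF open_UNIV, of "f i"] by blast
      ultimately show "(\<lambda>k. \<gamma> (r k) j) \<longlonglongrightarrow> c j" "(\<lambda>k. f i (X (r k) j)) \<longlonglongrightarrow> f i (x j)"
        using lims[of j] isCont_tendsto_compose by auto
    qed
    show "(\<lambda>k. \<Sum>j<N. \<gamma> (r k) j * f i (X (r k) j)) \<longlonglongrightarrow> (\<integral>x. f i x \<partial>\<phi>)"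
      using LIMSEQ_subseq_LIMSEQ[OF lim[OF f[OF that]] r] that by (simp add: X(3) o_def)
  qed
  define J where "J = {j. j < N \<and> c j \<noteq> 0}"
  define Q where "Q = x ` J"
  define u where "u p = (\<Sum>j\<in>{j\<in>J. x j = p}. c j)" for p
  have J: "finite J" "card J \<le> N" "J \<subseteq> {..<N}" using card_mono[of "{..<N}" J] by (auto simp: J_def)
  have "(\<Sum>p\<in>Q. u p * f i p) = (\<integral>x. f i x \<partial>\<phi>)" if "i < N" for i
  proof -
    have "(\<Sum>p\<in>Q. u p * f i p) = (\<Sum>p\<in>Q. \<Sum>j\<in>{j\<in>J. x j = p}. c j * f i (x j))"
      by (simp add: u_def sum_distrib_right)
    also have "\<dots> = (\<Sum>j\<in>J. c j * f i (x j))"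
      unfolding Q_def using J(1) by (rule sum.image_gen [symmetric])
    also have "\<dots> = (\<Sum>j<N. c j * f i (x j))"
      by (rule sum.mono_neutral_left) (auto simp: J_def)
    finally show ?thesis using total[OF that] by simp
  qed
  moreover have "0 < u p" if pQ: "p \<in> Q" for p
  proof -
    obtain j where j: "j \<in> J" "x j = p" using pQ by (auto simp: Q_def)
    then have "0 < c j" using c0[of j] by (auto simp: J_def less_le)
    moreover have "c j \<le> u p" unfolding u_def using j J(1) c0 by (intro member_le_sum) (auto simp: J_def)
    ultimately show ?thesis by simp
  qed
  moreover have "card Q \<le> N" using card_image_le[OF J(1), of x] J(2) by (simp add: Q_def)
  moreover have "Q \<subseteq> S" using xS by (auto simp: Q_def J_def)
  moreover have "finite Q" using J(1) by (simp add: Q_def)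
  ultimately show ?thesis by blast
qed

lemma integral_atomic_measure:
  fixes f :: "real^'d::finite \<Rightarrow> real"
  assumes "\<And>j. j < m \<Longrightarrow> 0 \<le> \<gamma> j" and [measurable]: "f \<in> borel_measurable borel"
  shows "(\<integral>x. f x \<partial>atomic_measure m X \<gamma>) = (\<Sum>j<m. \<gamma> j * f (X j))"
proof -
  have "(\<integral>x. f x \<partial>atomic_measure m X \<gamma>) = (\<integral>j. f (X j) \<partial>point_measure {..<m} (\<lambda>j. ennreal (\<gamma> j)))"
    unfolding atomic_measure_def by (subst integral_distr) auto
  also have "\<dots> = (\<Sum>j<m. \<gamma> j *\<^sub>R f (X j))"
    by (rule lebesgue_integral_point_measure_finite) (use assms in auto)
  finally show ?thesis by simp
qed

lemma sets_atomic_measure [simp]: "sets (atomic_measure m X \<gamma>) = sets borel"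
  by (simp add: atomic_measure_def)

section \<open>Total mass of the equilibrium measures\<close>

text \<open>
  The value 0 at nonpositive numbers is that of the densities outside the region and, by the convention
  for division by zero, also on the boundary; so the densities become products of such factors on the
  whole space.
\<close>

definition inv_sqrt :: "real \<Rightarrow> real" where
  "inv_sqrt s = (if 0 < s then 1 / sqrt s else 0)"

lemma inv_sqrt_nonneg [simp]: "0 \<le> inv_sqrt s"
  by (simp add: inv_sqrt_def)

lemma inv_sqrt_nonpos [simp]: "s \<le> 0 \<Longrightarrow> inv_sqrt s = 0"
  by (simp add: inv_sqrt_def)

lemma inv_sqrt_eq: "0 \<le> s \<Longrightarrow> inv_sqrt s = 1 / sqrt s"
  by (auto simp: inv_sqrt_def)

lemma inv_sqrt_mult: "0 \<le> s \<Longrightarrow> 0 \<le> t \<Longrightarrow> inv_sqrt (s * t) = inv_sqrt s * inv_sqrt t"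
  by (simp add: inv_sqrt_eq real_sqrt_mult)

lemma inv_sqrt_prod: "(\<And>i. i \<in> I \<Longrightarrow> 0 \<le> f i) \<Longrightarrow> inv_sqrt (\<Prod>i\<in>I. f i) = (\<Prod>i\<in>I. inv_sqrt (f i))"
proof (induction I rule: infinite_finite_induct)
  case (insert i I)
  then show ?case by (simp add: inv_sqrt_mult prod_nonneg)
qed (simp_all add: inv_sqrt_def)

lemma borel_measurable_inv_sqrt [measurable]: "inv_sqrt \<in> borel_measurable borel"
  unfolding inv_sqrt_def[abs_def] by measurable

lemma borel_measurable_vec_nth' [measurable]: "(\<lambda>x :: real^'d::finite. vec_nth x i) \<in> borel_measurable borel"
  by (intro borel_measurable_continuous_onI continuous_intros)

lemma nn_integral_inv_sqrt_exp:
  "(\<integral>\<^sup>+s. ennreal (inv_sqrt s * exp (- s)) \<partial>lborel) = ennreal (sqrt pi)"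
proof -
  have "ennreal (sqrt pi) = (\<integral>\<^sup>+t. ennreal (indicator {0..} t * t powr (1 / 2 - 1) / exp t) \<partial>lborel)"
    using Gamma_conv_nn_integral_real[of "1 / 2"] by (simp add: Gamma_one_half_real)
  also have "\<dots> = (\<integral>\<^sup>+s. ennreal (inv_sqrt s * exp (- s)) \<partial>lborel)"
    by (intro nn_integral_cong arg_cong[where f = ennreal])
       (auto simp: inv_sqrt_def indicator_def powr_minus powr_half_sqrt exp_minus field_simps)
  finally show ?thesis ..
qed

lemma nn_integral_vec_prod:
  fixes f :: "real \<Rightarrow> ennreal"
  assumes [measurable]: "f \<in> borel_measurable borel"
  shows "(\<integral>\<^sup>+x. (\<Prod>i\<in>UNIV. f (vec_nth x i)) \<partial>(lborel :: (real^'d::finite) measure)) = (\<integral>\<^sup>+t. f t \<partial>lborel) ^ CARD('d)"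
proof -
  have B: "(Basis :: (real^'d) set) = range (\<lambda>i. axis i 1)" by (auto simp: Basis_vec_def)
  have inj: "inj (\<lambda>i :: 'd. axis i (1 :: real))" by (rule injI) (simp add: axis_eq_axis)
  have "(\<Prod>b\<in>Basis. f (x \<bullet> b)) = (\<Prod>i\<in>UNIV. f (vec_nth x i))" for x :: "real^'d"
    unfolding B by (subst prod.reindex[OF inj]) (simp add: inner_axis)
  moreover have "(\<integral>\<^sup>+x. (\<Prod>b\<in>Basis. f (x \<bullet> b)) \<partial>(lborel :: (real^'d) measure)) = (\<Prod>b\<in>(Basis :: (real^'d) set). \<integral>\<^sup>+t. f t \<partial>lborel)"
    by (rule nn_integral_lborel_prod) auto
  ultimately show ?thesis by simp
qed

lemma nn_integral_lborel_scale:
  fixes f :: "'a::euclidean_space \<Rightarrow> ennreal"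
  assumes [measurable]: "f \<in> borel_measurable borel" and "0 < c"
  shows "(\<integral>\<^sup>+x. f x \<partial>lborel) = ennreal (c ^ DIM('a)) * (\<integral>\<^sup>+x. f (c *\<^sub>R x) \<partial>lborel)"
  using assms(2)
  by (subst lborel_affine[of c 0])
     (simp_all add: nn_integral_density nn_integral_distr nn_integral_cmult ennreal_power)

text \<open>
  Write the Gamma factor as \<open>\<integral> r^((d-1)/2) exp (-r) dr\<close> and substitute \<open>x = r^(-\<kappa>) y\<close>.  The homogeneity of
  m and \<open>\<sigma>\<close> makes all powers of r cancel, and what remains is
  \<open>\<integral> m(y) \<integral> exp (-r) (r - \<sigma>(y))^(-1/2) dr dy\<close>, where the inner integral is
  \<open>exp (-\<sigma>(y)) Gamma(1/2)\<close>.  For the ball this yields a Gaussian integral and for the simplex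
  a product of Gamma integrals, both of which are products over the coordinates.
\<close>

lemma gamma_homogeneous_integral:
  fixes m \<sigma> :: "real^'d::finite \<Rightarrow> real" and \<kappa> :: real
  defines "d \<equiv> real CARD('d)"
  assumes [measurable]: "m \<in> borel_measurable borel" "\<sigma> \<in> borel_measurable borel"
    and m0: "\<And>x. 0 \<le> m x"
    and h\<sigma>: "\<And>r x. 0 < r \<Longrightarrow> \<sigma> (r powr \<kappa> *\<^sub>R x) = r * \<sigma> x"
    and hm: "\<And>r x. 0 < r \<Longrightarrow> m (r powr \<kappa> *\<^sub>R x) = r powr (d / 2 - \<kappa> * d) * m x"
    and \<sigma>0: "\<And>x. m x \<noteq> 0 \<Longrightarrow> 0 \<le> \<sigma> x"
  shows "ennreal (Gamma ((d + 1) / 2)) * (\<integral>\<^sup>+x. ennreal (m x * inv_sqrt (1 - \<sigma> x)) \<partial>lborel) =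
    ennreal (sqrt pi) * (\<integral>\<^sup>+x. ennreal (m x * exp (- \<sigma> x)) \<partial>lborel)"
proof -
  define G where "G r = indicator {0<..} r * (r powr ((d - 1) / 2) * exp (- r))" for r :: real
  define I where "I = (\<integral>\<^sup>+x. ennreal (m x * inv_sqrt (1 - \<sigma> x)) \<partial>lborel)"
  have d: "0 < d" by (simp add: d_def)
  have G: "ennreal (Gamma ((d + 1) / 2)) = (\<integral>\<^sup>+r. ennreal (G r) \<partial>lborel)"
    using d unfolding Gamma_conv_nn_integral_real[of "(d + 1) / 2", simplified] G_def
    by (subst Gamma_conv_nn_integral_real)
       (auto intro!: nn_integral_cong arg_cong[where f = ennreal] simp: indicator_def exp_minus field_simps)
  define H where "H r y = ennreal (indicator {0<..} r * (exp (- r) * (m y * inv_sqrt (r - \<sigma> y))))" for r :: real and y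
  have [measurable]: "case_prod H \<in> borel_measurable (borel \<Otimes>\<^sub>M borel)"
    unfolding H_def[abs_def] by measurable
  have scale: "ennreal (G r) * I = (\<integral>\<^sup>+y. H r y \<partial>lborel)" for r
  proof (cases "0 < r")
    case True
    define c where "c = (1 / r) powr \<kappa>"
    have c: "0 < c" using True by (simp add: c_def)
    have *: "m (c *\<^sub>R y) * inv_sqrt (1 - \<sigma> (c *\<^sub>R y)) =
        ((1 / r) powr (d / 2 - \<kappa> * d) * sqrt r) * (m y * inv_sqrt (r - \<sigma> y))" for y
    proof -
      have "1 - \<sigma> (c *\<^sub>R y) = (r - \<sigma> y) / r" using True h\<sigma>[of "1 / r" y] by (simp add: c_def field_simps)
      moreover have "inv_sqrt (s / r) = sqrt r * inv_sqrt s" for s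
        using True by (simp add: inv_sqrt_def real_sqrt_divide zero_less_divide_iff)
      ultimately show ?thesis using hm[of "1 / r" y] True by (simp add: c_def)
    qed
    \<comment> \<open>the powers of r from the Gamma integrand, the Jacobian, m, and the inverse square root cancel\<close>
    have one: "r powr ((d - 1) / 2) * (c ^ CARD('d) * ((1 / r) powr (d / 2 - \<kappa> * d) * sqrt r)) = 1"
    proof -
      have "c ^ CARD('d) = (1 / r) powr (\<kappa> * d)"
        using True c by (simp add: c_def d_def powr_powr flip: powr_realpow)
      then have "c ^ CARD('d) * (1 / r) powr (d / 2 - \<kappa> * d) = (1 / r) powr (d / 2)"
        by (simp flip: powr_add)
      also have "\<dots> = r powr (- (d / 2))" using True by (simp add: powr_minus_divide powr_divide)
      finally have "c ^ CARD('d) * (1 / r) powr (d / 2 - \<kappa> * d) = r powr (- (d / 2))" .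
      then have "r powr ((d - 1) / 2) * (c ^ CARD('d) * ((1 / r) powr (d / 2 - \<kappa> * d) * sqrt r)) =
        r powr ((d - 1) / 2) * r powr (- (d / 2)) * r powr (1 / 2)"
        using True by (simp add: powr_half_sqrt mult.assoc[symmetric])
      also have "\<dots> = r powr ((d - 1) / 2 + (- (d / 2)) + 1 / 2)" by (simp only: powr_add)
      also have "\<dots> = 1" using True by (simp add: field_simps)
      finally show ?thesis .
    qed
    have "I = ennreal (c ^ CARD('d)) * (\<integral>\<^sup>+y. ennreal (m (c *\<^sub>R y) * inv_sqrt (1 - \<sigma> (c *\<^sub>R y))) \<partial>lborel)"
      unfolding I_def by (subst nn_integral_lborel_scale[OF _ c]) auto
    also have "\<dots> = (\<integral>\<^sup>+y. ennreal (c ^ CARD('d) * ((1 / r) powr (d / 2 - \<kappa> * d) * sqrt r) * (m y * inv_sqrt (r - \<sigma> y))) \<partial>lborel)"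
      unfolding * using c by (subst nn_integral_cmult [symmetric]) (auto simp: ennreal_mult' [symmetric] mult.assoc)
    finally have I: "I = (\<integral>\<^sup>+y. ennreal (c ^ CARD('d) * ((1 / r) powr (d / 2 - \<kappa> * d) * sqrt r) * (m y * inv_sqrt (r - \<sigma> y))) \<partial>lborel)" .
    have "ennreal (G r) * I = (\<integral>\<^sup>+y. ennreal (G r * (c ^ CARD('d) * ((1 / r) powr (d / 2 - \<kappa> * d) * sqrt r) * (m y * inv_sqrt (r - \<sigma> y)))) \<partial>lborel)"
      unfolding I by (subst nn_integral_cmult [symmetric]) (auto simp: ennreal_mult' [symmetric] G_def indicator_def)
    also have "\<dots> = (\<integral>\<^sup>+y. H r y \<partial>lborel)"
    proof (intro nn_integral_cong)
      fix y
      have "G r * (c ^ CARD('d) * ((1 / r) powr (d / 2 - \<kappa> * d) * sqrt r) * (m y * inv_sqrt (r - \<sigma> y))) =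
        (r powr ((d - 1) / 2) * (c ^ CARD('d) * ((1 / r) powr (d / 2 - \<kappa> * d) * sqrt r))) * (exp (- r) * (m y * inv_sqrt (r - \<sigma> y)))"
        using True by (simp add: G_def)
      also have "\<dots> = exp (- r) * (m y * inv_sqrt (r - \<sigma> y))" unfolding one by simp
      finally have eq: "G r * (c ^ CARD('d) * ((1 / r) powr (d / 2 - \<kappa> * d) * sqrt r) * (m y * inv_sqrt (r - \<sigma> y))) =
        exp (- r) * (m y * inv_sqrt (r - \<sigma> y))" .
      show "ennreal (G r * (c ^ CARD('d) * ((1 / r) powr (d / 2 - \<kappa> * d) * sqrt r) * (m y * inv_sqrt (r - \<sigma> y)))) = H r y"
        unfolding eq H_def using True by simp
    qed
    finally show ?thesis .
  qed (simp add: G_def H_def)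
  have inner: "(\<integral>\<^sup>+r. H r y \<partial>lborel) = ennreal (sqrt pi) * ennreal (m y * exp (- \<sigma> y))" for y
  proof (cases "m y = 0")
    case False
    have "(\<integral>\<^sup>+r. H r y \<partial>lborel) = (\<integral>\<^sup>+s. H (\<sigma> y + 1 * s) y \<partial>lborel)"
      by (subst nn_integral_real_affine[of _ 1 "\<sigma> y"]) auto
    also have "\<dots> = (\<integral>\<^sup>+s. ennreal (m y * exp (- \<sigma> y)) * ennreal (inv_sqrt s * exp (- s)) \<partial>lborel)"
    proof (intro nn_integral_cong)
      fix s :: real
      have "indicator {0<..} (\<sigma> y + 1 * s) * (exp (- (\<sigma> y + 1 * s)) * (m y * inv_sqrt (\<sigma> y + 1 * s - \<sigma> y))) =
        (m y * exp (- \<sigma> y)) * (inv_sqrt s * exp (- s))"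
        using \<sigma>0[OF False] by (cases "0 < s") (auto simp: exp_diff exp_minus field_simps exp_add)
      then show "H (\<sigma> y + 1 * s) y = ennreal (m y * exp (- \<sigma> y)) * ennreal (inv_sqrt s * exp (- s))"
        unfolding H_def using m0[of y] by (simp only: ennreal_mult' [symmetric] mult_nonneg_nonneg exp_ge_zero)
    qed
    also have "\<dots> = ennreal (m y * exp (- \<sigma> y)) * ennreal (sqrt pi)"
      by (subst nn_integral_cmult) (auto simp: nn_integral_inv_sqrt_exp)
    finally show ?thesis by (simp add: mult.commute)
  qed (simp add: H_def)
  have "ennreal (Gamma ((d + 1) / 2)) * I = (\<integral>\<^sup>+r. ennreal (G r) * I \<partial>lborel)"
    unfolding G by (subst nn_integral_multc) (auto simp: G_def[abs_def])
  also have "\<dots> = (\<integral>\<^sup>+r. (\<integral>\<^sup>+y. H r y \<partial>lborel) \<partial>lborel)" by (simp only: scale)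
  also have "\<dots> = (\<integral>\<^sup>+y. (\<integral>\<^sup>+r. H r y \<partial>lborel) \<partial>lborel)"
    by (rule lborel_pair.Fubini' [symmetric]) simp
  also have "\<dots> = ennreal (sqrt pi) * (\<integral>\<^sup>+y. ennreal (m y * exp (- \<sigma> y)) \<partial>lborel)"
    unfolding inner by (rule nn_integral_cmult) simp
  finally show ?thesis by (simp add: I_def)
qed

lemma norm_const_pos: "0 < norm_const k"
  unfolding norm_const_def by (intro divide_pos_pos Gamma_real_pos) auto

definition weight :: "shape \<Rightarrow> real^'d::finite \<Rightarrow> real" where
  "weight sh x = indicator (region sh) x * equil_density sh x"

lemma weight_ball: "weight UnitBall (x :: real^'d::finite) = norm_const CARD('d) * inv_sqrt (1 - (norm x)\<^sup>2)"
  by (auto simp: weight_def region_def equil_density_def inv_sqrt_def indicator_def)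

lemma weight_box: "weight UnitBox (x :: real^'d::finite) = (\<Prod>i\<in>UNIV. inv_sqrt (1 - (vec_nth x i)\<^sup>2) / pi)"
proof (cases "x \<in> region UnitBox")
  case True
  then have 0: "0 \<le> 1 - (vec_nth x i)\<^sup>2" for i by (simp add: region_def)
  then have "equil_density UnitBox x = inv_sqrt (\<Prod>i\<in>UNIV. 1 - (vec_nth x i)\<^sup>2) / pi ^ CARD('d)"
    by (subst inv_sqrt_eq) (auto simp: equil_density_def intro: prod_nonneg)
  also have "\<dots> = (\<Prod>i\<in>UNIV. inv_sqrt (1 - (vec_nth x i)\<^sup>2)) / pi ^ CARD('d)"
    by (subst inv_sqrt_prod) (use 0 in auto)
  also have "\<dots> = (\<Prod>i\<in>UNIV. inv_sqrt (1 - (vec_nth x i)\<^sup>2) / pi)"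
    by (simp add: prod_dividef)
  finally show ?thesis using True by (simp add: weight_def)
next
  case False
  then obtain i where "\<not> 0 \<le> 1 - (vec_nth x i)\<^sup>2" by (auto simp: region_def)
  then have "inv_sqrt (1 - (vec_nth x i)\<^sup>2) / pi = 0" by (simp add: inv_sqrt_def)
  then have "(\<Prod>i\<in>UNIV. inv_sqrt (1 - (vec_nth x i)\<^sup>2) / pi) = 0" by (intro prod_zero) auto
  then show ?thesis using False by (simp add: weight_def)
qed

lemma weight_simplex: "weight UnitSimplex (x :: real^'d::finite) =
    norm_const CARD('d) * ((\<Prod>i\<in>UNIV. inv_sqrt (vec_nth x i)) * inv_sqrt (1 - (\<Sum>i\<in>UNIV. vec_nth x i)))"
proof (cases "x \<in> region UnitSimplex")
  case True
  then have 0: "0 \<le> vec_nth x i" "0 \<le> 1 - (\<Sum>i\<in>UNIV. vec_nth x i)" for i by (simp_all add: region_def)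
  have "equil_density UnitSimplex x = norm_const CARD('d) * inv_sqrt ((\<Prod>i\<in>UNIV. vec_nth x i) * (1 - (\<Sum>i\<in>UNIV. vec_nth x i)))"
    by (subst inv_sqrt_eq) (use 0 in \<open>auto simp: equil_density_def intro!: mult_nonneg_nonneg prod_nonneg\<close>)
  also have "\<dots> = norm_const CARD('d) * ((\<Prod>i\<in>UNIV. inv_sqrt (vec_nth x i)) * inv_sqrt (1 - (\<Sum>i\<in>UNIV. vec_nth x i)))"
    using 0 by (subst inv_sqrt_mult) (auto simp: inv_sqrt_prod prod_nonneg)
  finally show ?thesis using True by (simp add: weight_def)
next
  case False
  then consider i where "\<not> 0 \<le> vec_nth x i" | "\<not> 0 \<le> 1 - (\<Sum>i\<in>UNIV. vec_nth x i)"
    by (auto simp: region_def)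
  then have "(\<Prod>i\<in>UNIV. inv_sqrt (vec_nth x i)) * inv_sqrt (1 - (\<Sum>i\<in>UNIV. vec_nth x i)) = 0"
  proof cases
    case (1 i)
    then have "inv_sqrt (vec_nth x i) = 0" by simp
    then have "(\<Prod>i\<in>UNIV. inv_sqrt (vec_nth x i)) = 0" by (intro prod_zero) auto
    then show ?thesis by simp
  qed simp
  then show ?thesis using False by (simp add: weight_def)
qed

lemma weight_nonneg [simp]: "0 \<le> weight sh x"
  by (cases sh) (auto simp: weight_ball weight_box weight_simplex norm_const_pos less_imp_le intro!: mult_nonneg_nonneg prod_nonneg)

lemma borel_measurable_weight [measurable]: "weight sh \<in> borel_measurable borel"
  by (cases sh) (simp_all add: weight_ball[abs_def] weight_box[abs_def] weight_simplex[abs_def])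

lemma equil_eq: "equil sh = density lborel (\<lambda>x. ennreal (weight sh x))"
  by (simp add: equil_def weight_def)

lemma norm_const_eq: "norm_const k = Gamma ((real k + 1) / 2) / sqrt pi ^ (k + 1)"
proof -
  have "pi powr ((real k + 1) / 2) = (pi powr (1 / 2)) ^ (k + 1)"
    by (simp add: powr_powr add_divide_distrib powr_add flip: powr_realpow)
  then show ?thesis by (simp add: norm_const_def powr_half_sqrt)
qed

lemma nn_integral_gaussian: "(\<integral>\<^sup>+t. ennreal (exp (- t\<^sup>2)) \<partial>lborel) = ennreal (sqrt pi)"
proof -
  have "has_bochner_integral lborel (\<lambda>x :: real. exp (- x\<^sup>2)) (2 * (sqrt pi / 2))"
    using has_bochner_integral_even_function[OF gaussian_moment_0] by simp
  then have "integral\<^sup>N lborel (\<lambda>x :: real. ennreal (exp (- x\<^sup>2))) = ennreal (sqrt pi)"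
    by (subst nn_integral_eq_integral) (auto simp: has_bochner_integral_iff)
  then show ?thesis .
qed

text \<open>
  The right-hand side of the assumption is \<open>pi^((k+1)/2)\<close>.
\<close>

lemma norm_const_normalizes:
  fixes I :: ennreal
  assumes "ennreal (Gamma ((real k + 1) / 2)) * I = ennreal (sqrt pi) * ennreal (sqrt pi) ^ k"
  shows "ennreal (norm_const k) * I = 1"
proof -
  have G: "0 < Gamma ((real k + 1) / 2)" by (intro Gamma_real_pos) auto
  have "ennreal (norm_const k) * I = ennreal (1 / sqrt pi ^ (k + 1)) * (ennreal (Gamma ((real k + 1) / 2)) * I)"
    using G by (simp add: norm_const_eq mult.assoc[symmetric] ennreal_mult' [symmetric])
  also have "\<dots> = ennreal (1 / sqrt pi ^ (k + 1) * (sqrt pi * sqrt pi ^ k))"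
    unfolding assms by (simp add: ennreal_power ennreal_mult' [symmetric])
  also have "\<dots> = 1" by simp
  finally show ?thesis .
qed

lemma nn_integral_arcsine: "(\<integral>\<^sup>+t. ennreal (inv_sqrt (1 - t\<^sup>2) / pi) \<partial>lborel) = 1"
proof -
  \<comment> \<open>the integrand is unbounded at the end points, but its primitive is continuous there\<close>
  have "((\<lambda>t. inv_sqrt (1 - t\<^sup>2)) has_integral (arcsin 1 - arcsin (- 1))) {-1..1}"
  proof (rule fundamental_theorem_of_calculus_interior)
    fix x :: real assume x: "x \<in> {-1<..<1}"
    then have "x\<^sup>2 < 1" by (simp add: abs_square_less_1 abs_less_iff)
    then show "(arcsin has_vector_derivative inv_sqrt (1 - x\<^sup>2)) (at x)"
      using DERIV_arcsin[of x] x
      by (simp add: inv_sqrt_def inverse_eq_divide has_real_derivative_iff_has_vector_derivative)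
  qed (auto intro: continuous_intros)
  then have "((\<lambda>t. inv_sqrt (1 - t\<^sup>2) / pi) has_integral (pi / pi)) {-1..1}"
    by (intro has_integral_divide) simp
  then have "((\<lambda>t. inv_sqrt (1 - t\<^sup>2) / pi) has_integral 1) {-1..1}" by simp
  then have "((\<lambda>t. inv_sqrt (1 - t\<^sup>2) / pi) has_integral 1) UNIV"
  proof (rule has_integral_on_superset)
    fix t :: real assume "t \<notin> {-1..1}"
    then have "1 \<le> t\<^sup>2" using abs_square_less_1[of t] by (auto simp: abs_if split: if_splits)
    then show "inv_sqrt (1 - t\<^sup>2) / pi = 0" by simp
  qed auto
  then have "integral\<^sup>N lborel (\<lambda>t. inv_sqrt (1 - t\<^sup>2) / pi) = ennreal 1"
    by (intro nn_integral_has_integral_lborel) auto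
  then show ?thesis by simp
qed

lemma nn_integral_weight: "(\<integral>\<^sup>+x. ennreal (weight sh (x :: real^'d::finite)) \<partial>lborel) = 1"
proof (cases sh)
  case UnitBall
  have "ennreal (Gamma ((real CARD('d) + 1) / 2)) * (\<integral>\<^sup>+x. ennreal (1 * inv_sqrt (1 - (norm (x :: real^'d))\<^sup>2)) \<partial>lborel) =
    ennreal (sqrt pi) * (\<integral>\<^sup>+x. ennreal (1 * exp (- (norm (x :: real^'d))\<^sup>2)) \<partial>lborel)"
  proof (rule gamma_homogeneous_integral[of _ _ "1 / 2"])
    fix r :: real and x :: "real^'d" assume "0 < r"
    then show "(norm (r powr (1 / 2) *\<^sub>R x))\<^sup>2 = r * (norm x)\<^sup>2"
      by (simp add: power_mult_distrib powr_half_sqrt)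
  qed auto
  also have "(\<integral>\<^sup>+x. ennreal (1 * exp (- (norm (x :: real^'d))\<^sup>2)) \<partial>lborel) =
      (\<integral>\<^sup>+x. (\<Prod>i\<in>UNIV. ennreal (exp (- (vec_nth x i)\<^sup>2))) \<partial>(lborel :: (real^'d) measure))"
  proof (rule nn_integral_cong)
    fix x :: "real^'d"
    have "(norm x)\<^sup>2 = (\<Sum>i\<in>UNIV. (vec_nth x i)\<^sup>2)"
      unfolding power2_norm_eq_inner inner_vec_def by (simp add: power2_eq_square)
    then show "ennreal (1 * exp (- (norm x)\<^sup>2)) = (\<Prod>i\<in>UNIV. ennreal (exp (- (vec_nth x i)\<^sup>2)))"
      by (simp add: prod_ennreal exp_sum sum_negf [symmetric])
  qed
  also have "\<dots> = ennreal (sqrt pi) ^ CARD('d)"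
    by (subst nn_integral_vec_prod) (auto simp: nn_integral_gaussian)
  finally have "ennreal (norm_const CARD('d)) * (\<integral>\<^sup>+x. ennreal (1 * inv_sqrt (1 - (norm (x :: real^'d))\<^sup>2)) \<partial>lborel) = 1"
    by (rule norm_const_normalizes)
  then show ?thesis
    using norm_const_pos[of "CARD('d)"]
    by (simp add: UnitBall weight_ball ennreal_mult' nn_integral_cmult)
next
  case UnitBox
  have "(\<integral>\<^sup>+x. ennreal (weight UnitBox (x :: real^'d)) \<partial>lborel) =
     (\<integral>\<^sup>+x. (\<Prod>i\<in>UNIV. ennreal (inv_sqrt (1 - (vec_nth x i)\<^sup>2) / pi)) \<partial>(lborel :: (real^'d) measure))"
    by (simp add: weight_box prod_ennreal)
  also have "\<dots> = 1" by (subst nn_integral_vec_prod) (auto simp: nn_integral_arcsine)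
  finally show ?thesis by (simp add: UnitBox)
next
  case UnitSimplex
  have m0: "0 \<le> vec_nth x i" if "(\<Prod>i\<in>UNIV. inv_sqrt (vec_nth x i)) \<noteq> 0" for x :: "real^'d" and i
    using that by (auto simp: inv_sqrt_def split: if_splits) (metis less_imp_le)
  have "ennreal (Gamma ((real CARD('d) + 1) / 2)) * (\<integral>\<^sup>+x. ennreal ((\<Prod>i\<in>UNIV. inv_sqrt (vec_nth (x :: real^'d) i)) * inv_sqrt (1 - (\<Sum>i\<in>UNIV. vec_nth x i))) \<partial>lborel) =
    ennreal (sqrt pi) * (\<integral>\<^sup>+x. ennreal ((\<Prod>i\<in>UNIV. inv_sqrt (vec_nth (x :: real^'d) i)) * exp (- (\<Sum>i\<in>UNIV. vec_nth x i))) \<partial>lborel)"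
  proof (rule gamma_homogeneous_integral[of _ _ 1])
    fix r :: real and x :: "real^'d" assume r: "0 < r"
    then show "(\<Sum>i\<in>UNIV. vec_nth (r powr 1 *\<^sub>R x) i) = r * (\<Sum>i\<in>UNIV. vec_nth x i)"
      by (simp add: sum_distrib_left)
    have "inv_sqrt (r * t) = r powr (- 1 / 2) * inv_sqrt t" for t
      using r by (simp add: inv_sqrt_def real_sqrt_mult powr_minus powr_half_sqrt zero_less_mult_iff field_simps)
    then have "(\<Prod>i\<in>UNIV. inv_sqrt (vec_nth (r powr 1 *\<^sub>R x) i)) =
        (r powr (- 1 / 2)) ^ CARD('d) * (\<Prod>i\<in>UNIV. inv_sqrt (vec_nth x i))"
      using r by (simp add: prod.distrib)
    also have "(r powr (- 1 / 2)) ^ CARD('d) = r powr (real CARD('d) / 2 - 1 * real CARD('d))"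
      using r by (simp add: powr_powr field_simps flip: powr_realpow)
    finally show "(\<Prod>i\<in>UNIV. inv_sqrt (vec_nth (r powr 1 *\<^sub>R x) i)) =
      r powr (real CARD('d) / 2 - 1 * real CARD('d)) * (\<Prod>i\<in>UNIV. inv_sqrt (vec_nth x i))" .
  qed (use m0 in \<open>auto intro!: prod_nonneg sum_nonneg\<close>)
  also have "(\<integral>\<^sup>+x. ennreal ((\<Prod>i\<in>UNIV. inv_sqrt (vec_nth (x :: real^'d) i)) * exp (- (\<Sum>i\<in>UNIV. vec_nth x i))) \<partial>lborel) =
      (\<integral>\<^sup>+x. (\<Prod>i\<in>UNIV. ennreal (inv_sqrt (vec_nth x i) * exp (- vec_nth x i))) \<partial>(lborel :: (real^'d) measure))"
    by (rule nn_integral_cong) (simp add: prod_ennreal exp_sum sum_negf [symmetric] prod.distrib)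
  also have "\<dots> = ennreal (sqrt pi) ^ CARD('d)"
    by (subst nn_integral_vec_prod) (auto simp: nn_integral_inv_sqrt_exp)
  finally have "ennreal (norm_const CARD('d)) * (\<integral>\<^sup>+x. ennreal ((\<Prod>i\<in>UNIV. inv_sqrt (vec_nth (x :: real^'d) i)) * inv_sqrt (1 - (\<Sum>i\<in>UNIV. vec_nth x i))) \<partial>lborel) = 1"
    by (rule norm_const_normalizes)
  then show ?thesis
    using norm_const_pos[of "CARD('d)"]
    by (simp add: UnitSimplex weight_simplex ennreal_mult' nn_integral_cmult)
qed

section \<open>Integration by parts for the equilibrium measures\<close>

lemma region_ball: "region UnitBall = cball (0 :: real^'d::finite) 1"
  by (auto simp: region_def abs_square_le_1)

lemma region_box: "(region UnitBox :: (real^'d::finite) set) = cbox (\<chi> i. -1) (\<chi> i. 1)"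
  by (auto simp: region_def mem_box_cart abs_square_le_1 abs_le_iff)

lemma region_simplex: "region UnitSimplex = convex hull (insert 0 (Basis :: (real^'d::finite) set))"
proof -
  have B: "(Basis :: (real^'d) set) = range (\<lambda>i. axis i 1)" by (auto simp: Basis_vec_def)
  have inj: "inj (\<lambda>i :: 'd. axis i (1 :: real))" by (rule injI) (simp add: axis_eq_axis)
  have "sum ((\<bullet>) x) Basis = (\<Sum>i\<in>UNIV. vec_nth x i)" for x :: "real^'d"
    unfolding B by (subst sum.reindex[OF inj]) (simp add: inner_axis)
  moreover have "(\<forall>i\<in>Basis. 0 \<le> x \<bullet> i) \<longleftrightarrow> (\<forall>i. 0 \<le> vec_nth x i)" for x :: "real^'d"
    by (auto simp: B inner_axis)
  ultimately show ?thesis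
    unfolding std_simplex by (auto simp: region_def)
qed

lemma compact_region: "compact (region sh :: (real^'d::finite) set)"
  using compact_convex_hull[OF finite_imp_compact[of "insert 0 Basis"]]
  by (cases sh) (simp_all add: region_ball region_box region_simplex)

lemma convex_region: "convex (region sh :: (real^'d::finite) set)"
  by (cases sh) (auto simp: region_ball region_box region_simplex)

lemma region_borel [measurable]: "region sh \<in> sets borel"
  using compact_region by (rule borel_compact)

lemma region_nonempty: "(region sh :: (real^'d::finite) set) \<noteq> {}"
proof -
  have "(0 :: real^'d) \<in> region sh" by (cases sh) (auto simp: region_def)
  then show ?thesis by blast
qed

lemma mpoly_bounded_on_region:
  obtains C where "\<And>x. x \<in> region sh \<Longrightarrow> \<bar>mpoly_at p x\<bar> \<le> C"
proof -
  have "compact (mpoly_at p ` region sh)"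
    by (intro compact_continuous_image continuous_intros compact_region)
  then obtain C where "\<forall>y\<in>mpoly_at p ` region sh. norm y \<le> C"
    using compact_imp_bounded bounded_iff by blast
  then show ?thesis using that by auto
qed

lemma weight_outside: "x \<notin> region sh \<Longrightarrow> weight sh x = 0"
  by (simp add: weight_def)

lemma integrable_weight: "integrable lborel (weight sh :: real^'d::finite \<Rightarrow> real)"
  by (rule integrableI_nonneg) (simp_all add: nn_integral_weight)

lemma integrable_weight_mpoly: "integrable lborel (\<lambda>x :: real^'d::finite. weight sh x * mpoly_at p x)"
proof -
  obtain C where C: "\<And>x :: real^'d. x \<in> region sh \<Longrightarrow> \<bar>mpoly_at p x\<bar> \<le> C"
    using mpoly_bounded_on_region by metis
  show ?thesis
  proof (rule Bochner_Integration.integrable_bound)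
    show "integrable lborel (\<lambda>x :: real^'d. C * weight sh x)"
      by (intro integrable_mult_right integrable_weight)
    show "AE x in lborel. norm (weight sh x * mpoly_at p x) \<le> norm (C * weight sh x)"
    proof (intro AE_I2)
      fix x :: "real^'d"
      show "norm (weight sh x * mpoly_at p x) \<le> norm (C * weight sh x)"
      proof (cases "x \<in> region sh")
        case True
        then have "\<bar>mpoly_at p x\<bar> \<le> \<bar>C\<bar>" using C[OF True] by linarith
        from mult_right_mono[OF this weight_nonneg[of sh x]] show ?thesis by (simp add: abs_mult mult.commute)
      qed (simp add: weight_outside)
    qed
  qed measurable
qed

text \<open>
  By translation invariance, the integral of f equals the integral over x of the average of f over the
  segment from x to \<open>x + u\<close>.  This average is \<open>F(x + u) - F(x)\<close>, whose integral vanishes, again by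
  translation invariance.
\<close>

lemma integral_zero_if_line_primitive:
  fixes f F :: "'a::euclidean_space \<Rightarrow> real"
  assumes f: "integrable lborel f" and F: "integrable lborel F"
    and prim: "\<And>x. ((\<lambda>t. f (x + t *\<^sub>R u)) has_integral (F (x + u) - F x)) {0..1}"
  shows "(\<integral>x. f x \<partial>lborel) = 0"
proof -
  have trans: "integrable lborel (\<lambda>x. g (x + v)) \<and> (\<integral>x. g (x + v) \<partial>lborel) = (\<integral>x. g x \<partial>lborel)"
    if "integrable lborel g" for g :: "'a \<Rightarrow> real" and v
  proof -
    have [measurable]: "g \<in> borel_measurable borel" using that by auto
    have "integrable (distr lborel borel ((+) v)) g" using that by (simp add: lborel_distr_plus)
    then have "integrable lborel (\<lambda>x. g (v + x))" by (subst (asm) integrable_distr_eq) auto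
    moreover have "(\<integral>x. g x \<partial>(distr lborel borel ((+) v))) = (\<integral>x. g (v + x) \<partial>lborel)"
      by (subst integral_distr) auto
    ultimately show ?thesis by (simp add: lborel_distr_plus add.commute)
  qed
  have [measurable]: "f \<in> borel_measurable borel" using f by auto
  define g where "g t x = indicator {0..1} t * f (x + t *\<^sub>R u)" for t :: real and x
  have [measurable]: "case_prod g \<in> borel_measurable (lborel \<Otimes>\<^sub>M lborel)"
    unfolding g_def[abs_def] by measurable
  have norm_g: "(\<integral>x. norm (g t x) \<partial>lborel) = indicator {0..1} t * (\<integral>x. \<bar>f x\<bar> \<partial>lborel)" for t
    using trans[of "\<lambda>x. \<bar>f x\<bar>" "t *\<^sub>R u"] f by (simp add: g_def abs_mult)
  have g_int: "integrable (lborel \<Otimes>\<^sub>M lborel) (case_prod g)"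
  proof (rule lborel_pair.Fubini_integrable)
    have "integrable lborel (\<lambda>t :: real. indicator {0..1} t * (\<integral>x. \<bar>f x\<bar> \<partial>lborel))" by simp
    then show "integrable lborel (\<lambda>t. \<integral>x. norm (case (t, x) of (t, x) \<Rightarrow> g t x) \<partial>lborel)"
      by (simp add: norm_g[unfolded real_norm_def])
    show "AE t in lborel. integrable lborel (\<lambda>x. case (t, x) of (t, x) \<Rightarrow> g t x)"
      using trans[OF f] by (simp add: g_def)
  qed simp
  have "(\<integral>t. (\<integral>x. g t x \<partial>lborel) \<partial>lborel) = (\<integral>x. (\<integral>t. g t x \<partial>lborel) \<partial>lborel)"
    using lborel_pair.Fubini_integral[OF g_int] by simp
  also have "\<dots> = (\<integral>x. F (x + u) - F x \<partial>lborel)"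
  proof (rule integral_cong_AE)
    have [measurable]: "F \<in> borel_measurable borel" using F by auto
    show "(\<lambda>x. F (x + u) - F x) \<in> borel_measurable lborel" by measurable
    show "AE x in lborel. (\<integral>t. g t x \<partial>lborel) = F (x + u) - F x"
      using lborel_pair.AE_integrable_snd[OF g_int]
    proof eventually_elim
      fix x assume "integrable lborel (\<lambda>t. g t x)"
      then have "((\<lambda>t. g t x) has_integral (\<integral>t. g t x \<partial>lborel)) UNIV"
        by (rule has_integral_integral_lborel)
      moreover have "((\<lambda>t. g t x) has_integral (F (x + u) - F x)) UNIV"
      proof -
        have "(\<lambda>t. g t x) = (\<lambda>t. if t \<in> {0..1} then f (x + t *\<^sub>R u) else 0)"
          by (auto simp: g_def indicator_def)
        then show ?thesis using prim[of x] has_integral_restrict_UNIV[of "{0..1}"] by metis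
      qed
      ultimately show "(\<integral>t. g t x \<partial>lborel) = F (x + u) - F x" by (rule has_integral_unique)
    qed
  qed measurable
  also have "\<dots> = 0" using trans[OF F, of u] F by simp
  finally have "(\<integral>t. (\<integral>x. g t x \<partial>lborel) \<partial>lborel) = 0" .
  moreover have "(\<integral>x. g t x \<partial>lborel) = indicator {0..1} t * (\<integral>x. f x \<partial>lborel)" for t
    using trans[OF f, of "t *\<^sub>R u"] by (simp add: g_def)
  ultimately show ?thesis by simp
qed

text \<open>
  The polynomial \<open>a_j\<close> for which \<open>sqrt a_j * d/dx_j\<close> lifts to a rotation field: on a line in direction j
  that meets the interior of the region, it is positive exactly in the interior.
\<close>

definition face_poly :: "shape \<Rightarrow> 'd::finite \<Rightarrow> 'd mpoly" where
  "face_poly sh j = (case sh of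
      UnitBall \<Rightarrow> 1 - (\<Sum>i\<in>UNIV. mpoly_var i ^ 2)
    | UnitBox \<Rightarrow> 1 - mpoly_var j ^ 2
    | UnitSimplex \<Rightarrow> mpoly_var j * (1 - (\<Sum>i\<in>UNIV. mpoly_var i)))"

lemma sum_axis_shift:
  fixes f :: "'d::finite \<Rightarrow> real \<Rightarrow> real"
  shows "(\<Sum>i\<in>UNIV. f i (vec_nth (x + t *\<^sub>R axis j 1) i)) =
    f j (vec_nth x j + t) + (\<Sum>i\<in>UNIV - {j}. f i (vec_nth x i))"
  by (subst sum.remove[of _ j]) (auto simp: axis_def intro!: sum.cong)

lemma vec_nth_axis_shift: "i \<noteq> j \<Longrightarrow> vec_nth (x + t *\<^sub>R axis j 1) i = (vec_nth x i :: real)"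
  "vec_nth (x + t *\<^sub>R axis j 1) j = vec_nth x j + t"
  by (auto simp: axis_def)

lemma face_poly_line:
  obtains b where "\<And>t. mpoly_at (face_poly sh j) (x + t *\<^sub>R axis j 1) = mpoly_at (face_poly sh j) x + b * t - t\<^sup>2"
proof (cases sh)
  case UnitBall
  have "mpoly_at (face_poly sh j) (x + t *\<^sub>R axis j 1) = mpoly_at (face_poly sh j) x + (- 2 * vec_nth x j) * t - t\<^sup>2" for t
    using sum.remove[of UNIV j "\<lambda>i. (vec_nth x i)\<^sup>2"] sum_axis_shift[of "\<lambda>i y. y\<^sup>2" x t j]
    by (simp add: UnitBall face_poly_def power2_sum algebra_simps
        del: vector_add_component vector_scaleR_component)
  then show ?thesis by (rule that)
next
  case UnitBox
  have "mpoly_at (face_poly sh j) (x + t *\<^sub>R axis j 1) = mpoly_at (face_poly sh j) x + (- 2 * vec_nth x j) * t - t\<^sup>2" for t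
    by (simp add: UnitBox face_poly_def vec_nth_axis_shift power2_eq_square algebra_simps)
  then show ?thesis by (rule that)
next
  case UnitSimplex
  have "mpoly_at (face_poly sh j) (x + t *\<^sub>R axis j 1) = mpoly_at (face_poly sh j) x +
      ((1 - (\<Sum>i\<in>UNIV. vec_nth x i)) - vec_nth x j) * t - t\<^sup>2" for t
    using sum.remove[of UNIV j "\<lambda>i. vec_nth x i"] sum_axis_shift[of "\<lambda>i y. y" x t j] vec_nth_axis_shift(2)[of x t j]
    by (simp add: UnitSimplex face_poly_def power2_eq_square algebra_simps
        del: vector_add_component vector_scaleR_component)
  then show ?thesis by (rule that)
qed

text \<open>
  The density depends on the coordinate j only through \<open>a_j\<close>.  For the simplex this requires a cut-off
  of the remaining factor, because \<open>a_j\<close> is also positive where both of its factors are negative.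
\<close>

lemma weight_factor:
  "\<exists>\<rho> :: real^'d::finite \<Rightarrow> real.
    (\<forall>x. weight sh x = \<rho> x * inv_sqrt (mpoly_at (face_poly sh j) x)) \<and>
    (\<forall>x t. \<rho> (x + t *\<^sub>R axis j 1) = \<rho> x)"
proof (cases sh)
  case UnitBall
  have "weight sh x = norm_const CARD('d) * inv_sqrt (mpoly_at (face_poly sh j) x)" for x :: "real^'d"
  proof -
    have "(norm x)\<^sup>2 = (\<Sum>i\<in>UNIV. (vec_nth x i)\<^sup>2)"
      unfolding power2_norm_eq_inner inner_vec_def by (simp add: power2_eq_square)
    then show ?thesis by (simp add: UnitBall weight_ball face_poly_def)
  qed
  then show ?thesis by (intro exI[of _ "\<lambda>_. norm_const CARD('d)"]) simp
next
  case UnitBox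
  define \<rho> where "\<rho> x = (\<Prod>i\<in>UNIV - {j}. inv_sqrt (1 - (vec_nth x i)\<^sup>2) / pi) / pi" for x :: "real^'d"
  show ?thesis
  proof (intro exI[of _ \<rho>] conjI allI)
    show "weight sh x = \<rho> x * inv_sqrt (mpoly_at (face_poly sh j) x)" for x
      by (simp add: UnitBox weight_box face_poly_def \<rho>_def prod.remove[of UNIV j])
    show "\<rho> (x + t *\<^sub>R axis j 1) = \<rho> x" for x t
      unfolding \<rho>_def by (intro arg_cong2[where f = "(/)"] prod.cong refl) (simp add: vec_nth_axis_shift del: vector_add_component vector_scaleR_component)
  qed
next
  case UnitSimplex
  define \<rho> where "\<rho> x = norm_const CARD('d) * (\<Prod>i\<in>UNIV - {j}. inv_sqrt (vec_nth x i)) *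
    (if (\<Sum>i\<in>UNIV - {j}. vec_nth x i) \<le> 1 then 1 else 0)" for x :: "real^'d"
  show ?thesis
  proof (intro exI[of _ \<rho>] conjI allI)
    fix x :: "real^'d"
    define y where "y = vec_nth x j"
    define z where "z = 1 - (\<Sum>i\<in>UNIV. vec_nth x i)"
    have yz: "y + z = 1 - (\<Sum>i\<in>UNIV - {j}. vec_nth x i)"
      by (simp add: y_def z_def sum.remove[of UNIV j])
    have "inv_sqrt y * inv_sqrt z = (if (\<Sum>i\<in>UNIV - {j}. vec_nth x i) \<le> 1 then 1 else 0) * inv_sqrt (y * z)"
    proof (cases "0 \<le> y \<and> 0 \<le> z")
      case True
      then show ?thesis using yz by (auto simp: inv_sqrt_mult)
    next
      case False
      then consider "y < 0" "z \<le> 0" | "y \<le> 0" "z < 0" | "y < 0" "0 < z" | "0 < y" "z < 0" by linarith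
      then show ?thesis using yz
        by cases (auto simp: mult_nonneg_nonpos mult_nonpos_nonneg)
    qed
    then have "weight sh x = norm_const CARD('d) * ((\<Prod>i\<in>UNIV - {j}. inv_sqrt (vec_nth x i)) *
        ((if (\<Sum>i\<in>UNIV - {j}. vec_nth x i) \<le> 1 then 1 else 0) * inv_sqrt (y * z)))"
      by (simp add: UnitSimplex weight_simplex prod.remove[of UNIV j] z_def[symmetric] y_def[symmetric] mult_ac)
    then show "weight sh x = \<rho> x * inv_sqrt (mpoly_at (face_poly sh j) x)"
      by (simp add: UnitSimplex \<rho>_def face_poly_def y_def z_def)
  next
    fix x :: "real^'d" and t
    have 1: "(\<Sum>i\<in>UNIV - {j}. vec_nth (x + t *\<^sub>R axis j 1) i) = (\<Sum>i\<in>UNIV - {j}. vec_nth x i)"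
      by (intro sum.cong refl) (simp add: axis_def)
    have 2: "(\<Prod>i\<in>UNIV - {j}. inv_sqrt (vec_nth (x + t *\<^sub>R axis j 1) i)) = (\<Prod>i\<in>UNIV - {j}. inv_sqrt (vec_nth x i))"
      by (intro prod.cong refl) (simp add: axis_def)
    show "\<rho> (x + t *\<^sub>R axis j 1) = \<rho> x" unfolding \<rho>_def 1 2 ..
  qed
qed

text \<open>
  The integrand is the derivative in direction j of \<open>F = h a_j w\<close>, where w is the density.  On each line F is a
  constant multiple of \<open>h sqrt (max 0 a_j)\<close>; this is continuous, and differentiable except at the at most
  two zeros of the quadratic polynomial \<open>a_j\<close>.
\<close>

lemma weight_integration_by_parts:
  fixes h :: "'d::finite mpoly"
  shows "(\<integral>x. weight sh x * (mpoly_at (face_poly sh j) x * mpoly_at (pdiff j h) x +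
      mpoly_at (pdiff j (face_poly sh j)) x * mpoly_at h x / 2) \<partial>lborel) = 0"
proof -
  let ?a = "face_poly sh j" and ?e = "axis j 1 :: real^'d"
  from weight_factor[of sh j] obtain \<rho> :: "real^'d \<Rightarrow> real" where
    \<rho>': "(\<forall>x. weight sh x = \<rho> x * inv_sqrt (mpoly_at ?a x)) \<and> (\<forall>x t. \<rho> (x + t *\<^sub>R ?e) = \<rho> x)" ..
  have \<rho>: "weight sh x = \<rho> x * inv_sqrt (mpoly_at ?a x)" "\<rho> (x + t *\<^sub>R ?e) = \<rho> x" for x t
    using conjunct1[OF \<rho>', rule_format, of x] conjunct2[OF \<rho>', rule_format, of x t] by -
  define F where "F x = weight sh x * (mpoly_at ?a x * mpoly_at h x)" for x
  define f where "f x = weight sh x * (mpoly_at ?a x * mpoly_at (pdiff j h) x + mpoly_at (pdiff j ?a) x * mpoly_at h x / 2)" for x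
  have "f = (\<lambda>x. weight sh x * mpoly_at (?a * pdiff j h + Poly_Mapping.single 0 (1 / 2) * (pdiff j ?a * h)) x)"
    by (auto simp: f_def)
  then have f_int: "integrable lborel f" by (simp only: integrable_weight_mpoly)
  have "F = (\<lambda>x. weight sh x * mpoly_at (?a * h) x)" by (auto simp: F_def)
  then have F_int: "integrable lborel F" by (simp only: integrable_weight_mpoly)
  have "((\<lambda>t. f (x + t *\<^sub>R ?e)) has_integral (F (x + ?e) - F x)) {0..1}" for x
  proof -
    define q where "q t = mpoly_at ?a (x + t *\<^sub>R ?e)" for t
    define H where "H t = mpoly_at h (x + t *\<^sub>R ?e)" for t
    define q' where "q' t = mpoly_at (pdiff j ?a) (x + t *\<^sub>R ?e)" for t
    define H' where "H' t = mpoly_at (pdiff j h) (x + t *\<^sub>R ?e)" for t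
    have dq: "(q has_real_derivative q' t) (at t)" and dH: "(H has_real_derivative H' t) (at t)" for t
      unfolding q_def[abs_def] q'_def H_def[abs_def] H'_def by (rule has_derivative_mpoly_at_line)+
    have cq: "continuous_on A q" and cH: "continuous_on A H" for A
      using dq dH by (meson DERIV_isCont continuous_at_imp_continuous_on)+
    have F: "F (x + t *\<^sub>R ?e) = \<rho> x * (sqrt (max 0 (q t)) * H t)" for t
    proof -
      have "inv_sqrt s * s = sqrt (max 0 s)" for s by (auto simp: inv_sqrt_def real_div_sqrt)
      then show ?thesis by (simp add: F_def \<rho> q_def H_def mult.assoc[symmetric])
    qed
    have f: "f (x + t *\<^sub>R ?e) = \<rho> x * (inv_sqrt (q t) * (q t * H' t + q' t * H t / 2))" for t
      by (simp add: f_def \<rho> q_def H_def q'_def H'_def)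
    obtain b where "mpoly_at ?a (x + t *\<^sub>R ?e) = mpoly_at ?a x + b * t - t\<^sup>2" for t
      using face_poly_line[of sh j x] by metis
    then have "q t = poly [:mpoly_at ?a x, b, -1:] t" for t
      by (simp add: q_def power2_eq_square algebra_simps)
    then have fin: "finite {t. q t = 0}" using poly_roots_finite[of "[:mpoly_at ?a x, b, -1:]"] by simp
    have "((\<lambda>t. f (x + t *\<^sub>R ?e)) has_integral (F (x + 1 *\<^sub>R ?e) - F (x + 0 *\<^sub>R ?e))) {0..1}"
    proof (rule fundamental_theorem_of_calculus_interior_strong[OF fin])
      fix t assume "t \<in> {0<..<1} - {t. q t = 0}"
      then consider "0 < q t" | "q t < 0" by force
      then have "((\<lambda>t. F (x + t *\<^sub>R ?e)) has_real_derivative f (x + t *\<^sub>R ?e)) (at t)"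
      proof cases
        case 1
        have "((\<lambda>s. \<rho> x * (sqrt (q s) * H s)) has_real_derivative
            \<rho> x * (inverse (sqrt (q t)) / 2 * q' t * H t + H' t * sqrt (q t))) (at t)"
          by (intro DERIV_cmult DERIV_mult dH DERIV_chain2[OF DERIV_real_sqrt dq] 1)
        moreover have "\<rho> x * (inverse (sqrt (q t)) / 2 * q' t * H t + H' t * sqrt (q t)) = f (x + t *\<^sub>R ?e)"
        proof -
          have "inv_sqrt (q t) * (q t * H' t) = (q t / sqrt (q t)) * H' t" using 1 by (simp add: inv_sqrt_def)
          then have "H' t * sqrt (q t) = inv_sqrt (q t) * (q t * H' t)" using 1 by (auto simp: real_div_sqrt)
          then show ?thesis using 1 by (simp add: f inv_sqrt_def field_simps)
        qed
        ultimately have "((\<lambda>s. \<rho> x * (sqrt (q s) * H s)) has_real_derivative f (x + t *\<^sub>R ?e)) (at t)" by simp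
        then show ?thesis
        proof (rule has_field_derivative_transform_within_open)
          show "open {s. 0 < q s}" using cq by (intro open_Collect_less continuous_intros)
        qed (use 1 in \<open>auto simp: F\<close>)
      next
        case 2
        have "((\<lambda>s. 0) has_real_derivative f (x + t *\<^sub>R ?e)) (at t)" using 2 by (simp add: f)
        then show ?thesis
        proof (rule has_field_derivative_transform_within_open)
          show "open {s. q s < 0}" using cq by (intro open_Collect_less continuous_intros)
        qed (use 2 in \<open>auto simp: F\<close>)
      qed
      then show "((\<lambda>t. F (x + t *\<^sub>R ?e)) has_vector_derivative f (x + t *\<^sub>R ?e)) (at t)"
        by (simp add: has_real_derivative_iff_has_vector_derivative)
    qed (auto simp: F intro!: continuous_intros cq cH)
    then show ?thesis by simp
  qed
  from integral_zero_if_line_primitive[OF f_int F_int this] show ?thesis by (simp add: f_def)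
qed

lemma sets_equil [simp]: "sets (equil sh) = sets borel" and space_equil [simp]: "space (equil sh) = UNIV"
  by (simp_all add: equil_eq)

lemma prob_space_equil: "prob_space (equil sh :: (real^'d::finite) measure)"
  by (rule prob_spaceI) (simp add: equil_eq emeasure_density nn_integral_weight)

lemma integral_equil:
  fixes f :: "real^'d::finite \<Rightarrow> real"
  assumes [measurable]: "f \<in> borel_measurable borel"
  shows "(\<integral>x. f x \<partial>equil sh) = (\<integral>x. weight sh x * f x \<partial>lborel)"
  unfolding equil_eq by (subst integral_real_density) auto

lemma equil_carried: "emeasure (equil sh) (- region sh :: (real^'d::finite) set) = 0"
proof -
  have "emeasure (equil sh) (- region sh :: (real^'d) set) =
      (\<integral>\<^sup>+x. ennreal (weight sh x) * indicator (- region sh :: (real^'d) set) x \<partial>lborel)"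
    unfolding equil_eq by (rule emeasure_density) auto
  also have "\<dots> = (\<integral>\<^sup>+x. 0 \<partial>(lborel :: (real^'d) measure))"
    by (intro nn_integral_cong) (auto simp: weight_outside split: split_indicator)
  finally show ?thesis by simp
qed

lemma equil_in_prob_measures_on: "equil sh \<in> prob_measures_on (region sh)"
  by (simp add: prob_measures_on_def prob_space_equil equil_carried)

lemma equil_integration_by_parts:
  fixes h :: "'d::finite mpoly"
  shows "(\<integral>x. mpoly_at (face_poly sh j) x * mpoly_at (pdiff j h) x +
      mpoly_at (pdiff j (face_poly sh j)) x * mpoly_at h x / 2 \<partial>equil sh) = 0"
  by (subst integral_equil) (auto simp: weight_integration_by_parts)

section \<open>Gram matrices, reproducing kernels and skew-symmetric derivations\<close>

definition mexp :: "(real^'d::finite) measure \<Rightarrow> 'd mpoly \<Rightarrow> real" where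
  "mexp \<mu> p = (\<integral>x. mpoly_at p x \<partial>\<mu>)"

lemma prob_measures_onD:
  assumes "\<mu> \<in> prob_measures_on S"
  shows "sets \<mu> = sets borel" "prob_space \<mu>" "emeasure \<mu> (- S) = 0"
  using assms by (auto simp: prob_measures_on_def)

lemma AE_prob_measures_on:
  assumes "\<mu> \<in> prob_measures_on S" "S \<in> sets borel"
  shows "AE x in \<mu>. x \<in> S"
  by (rule AE_I[where N = "- S"]) (use prob_measures_onD[OF assms(1)] assms(2) in auto)

lemma integrable_mpoly:
  fixes \<mu> :: "(real^'d::finite) measure"
  assumes \<mu>: "\<mu> \<in> prob_measures_on (region sh)"
  shows "integrable \<mu> (mpoly_at p)"
proof -
  note m = prob_measures_onD[OF \<mu>]
  interpret prob_space \<mu> by (rule m(2))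
  obtain C where C: "\<And>x :: real^'d. x \<in> region sh \<Longrightarrow> \<bar>mpoly_at p x\<bar> \<le> C"
    using mpoly_bounded_on_region by metis
  show ?thesis
  proof (rule integrable_const_bound)
    show "AE x in \<mu>. norm (mpoly_at p x) \<le> C"
      using AE_prob_measures_on[OF \<mu> region_borel] by eventually_elim (simp add: C)
    show "mpoly_at p \<in> borel_measurable \<mu>"
      by (subst measurable_cong_sets[OF m(1) refl]) (rule borel_measurable_mpoly_at)
  qed
qed

lemma mexp_zero [simp]: "mexp \<mu> 0 = 0"
  by (simp add: mexp_def)

lemma mexp_add:
  assumes "\<mu> \<in> prob_measures_on (region sh)"
  shows "mexp \<mu> (p + q) = mexp \<mu> p + mexp \<mu> q"
proof -
  have "mpoly_at (p + q) = (\<lambda>x. mpoly_at p x + mpoly_at q x)" by auto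
  then show ?thesis using integrable_mpoly[OF assms] by (simp add: mexp_def)
qed

lemma mexp_sum:
  assumes "\<mu> \<in> prob_measures_on (region sh)"
  shows "mexp \<mu> (\<Sum>i\<in>I. p i) = (\<Sum>i\<in>I. mexp \<mu> (p i))"
  by (induction I rule: infinite_finite_induct) (simp_all add: mexp_add[OF assms])

lemma mexp_single: "mexp \<mu> (Poly_Mapping.single \<alpha> c) = c * (\<integral>x. monom_at \<alpha> x \<partial>\<mu>)"
  by (simp add: mexp_def)

lemma mexp_const:
  assumes "\<mu> \<in> prob_measures_on S"
  shows "mexp \<mu> (Poly_Mapping.single 0 c) = c"
  using prob_space.prob_space[OF prob_measures_onD(2)[OF assms]] by (simp add: mexp_single)

lemma mexp_cmult: "mexp \<mu> (p * Poly_Mapping.single \<alpha> c) = c * mexp \<mu> (p * Poly_Mapping.single \<alpha> 1)"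
proof -
  have "(\<lambda>x. mpoly_at (p * Poly_Mapping.single \<alpha> c) x) = (\<lambda>x. c * mpoly_at (p * Poly_Mapping.single \<alpha> 1) x)"
    by auto
  then show ?thesis by (simp add: mexp_def)
qed

lemma mexp_eq_pseudo_functional:
  assumes \<mu>: "\<mu> \<in> prob_measures_on (region sh)" and deg: "mpoly_deg p \<le> m"
  shows "pseudo_functional (moments m \<mu>) p = mexp \<mu> p"
proof -
  have p: "p = (\<Sum>\<alpha>\<in>Poly_Mapping.keys p. Poly_Mapping.single \<alpha> (Poly_Mapping.lookup p \<alpha>))"
    by (rule mpoly_expand) auto
  have "mexp \<mu> p = (\<Sum>\<alpha>\<in>Poly_Mapping.keys p. mexp \<mu> (Poly_Mapping.single \<alpha> (Poly_Mapping.lookup p \<alpha>)))"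
    by (subst (1) p) (rule mexp_sum[OF \<mu>])
  also have "\<dots> = pseudo_functional (moments m \<mu>) p"
    unfolding pseudo_functional_def
    using deg by (intro sum.cong refl) (auto simp: mexp_single moments_def mindices_def mpoly_deg_le_iff)
  finally show ?thesis ..
qed

text \<open>
  The common value of the moment matrix of the measure with density g and of the localizing matrix of
  the moments, if g is nonnegative on the region and the degrees are in range.
\<close>

definition gram :: "nat \<Rightarrow> 'd::finite mpoly \<Rightarrow> (real^'d) measure \<Rightarrow> real mat" where
  "gram k g \<mu> = Matrix.mat (num_mindices TYPE('d) k) (num_mindices TYPE('d) k)
     (\<lambda>(i, j). mexp \<mu> (g * Poly_Mapping.single (mindex_enum k i + mindex_enum k j) 1))"

lemma gram_carrier [simp]: "gram k (g :: 'd::finite mpoly) \<mu> \<in> carrier_mat (num_mindices TYPE('d) k) (num_mindices TYPE('d) k)"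
  by (simp add: gram_def)

lemma mindex_deg_enum: "i < num_mindices TYPE('d::finite) k \<Longrightarrow> mindex_deg (mindex_enum k i :: 'd mindex) \<le> k"
  using bij_betw_mindex_enum[of k, where ?'d = 'd] by (auto simp: bij_betw_def mindices_def)

lemma moment_mat_weighted_eq_gram:
  assumes \<mu>: "\<mu> \<in> prob_measures_on (region sh)" and g: "\<And>x. x \<in> region sh \<Longrightarrow> 0 \<le> mpoly_at g x"
  shows "moment_mat k (weighted g \<mu>) = gram k g \<mu>"
proof -
  have "AE x in \<mu>. 0 \<le> mpoly_at g x"
    using AE_prob_measures_on[OF \<mu> region_borel] by eventually_elim (rule g)
  then show ?thesis
    by (subst moment_mat_weighted[OF prob_measures_onD(1)[OF \<mu>]])
       (auto simp: gram_def mexp_def monom_at_add mult_ac intro!: cong_mat)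
qed

lemma gram_eq_localizing_mat:
  fixes g :: "'d::finite mpoly"
  assumes \<mu>: "\<mu> \<in> prob_measures_on (region sh)" and deg: "mpoly_deg g + 2 * k \<le> m"
  shows "localizing_mat k g (moments m \<mu>) = gram k g \<mu>"
  unfolding localizing_mat_def gram_def
proof (rule cong_mat, goal_cases)
  case (3 i j)
  then have "mindex_deg (mindex_enum k i + mindex_enum k j :: 'd mindex) \<le> 2 * k"
    using mindex_deg_enum[of i k, where ?'d = 'd] mindex_deg_enum[of j k, where ?'d = 'd] by (simp add: mindex_deg_add)
  then have "mpoly_deg (g * Poly_Mapping.single (mindex_enum k i + mindex_enum k j) 1) \<le> mpoly_deg g + 2 * k"
    by (intro mpoly_deg_mult mpoly_deg_single_le) auto
  then show ?case using deg mexp_eq_pseudo_functional[OF \<mu>] by simp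
qed auto

lemma mpoly_expand_enum:
  fixes p :: "'d::finite mpoly"
  assumes "mpoly_deg p \<le> k"
  shows "p = (\<Sum>i<num_mindices TYPE('d) k. Poly_Mapping.single (mindex_enum k i) (Poly_Mapping.lookup p (mindex_enum k i)))"
proof -
  have "Poly_Mapping.keys p \<subseteq> mindices k" using assms by (auto simp: mpoly_deg_le_iff mindices_def)
  then have "p = (\<Sum>\<alpha>\<in>mindices k. Poly_Mapping.single \<alpha> (Poly_Mapping.lookup p \<alpha>))"
    by (rule mpoly_expand[OF finite_mindices])
  also have "\<dots> = (\<Sum>i<num_mindices TYPE('d) k. Poly_Mapping.single (mindex_enum k i) (Poly_Mapping.lookup p (mindex_enum k i)))"
    by (rule sum.reindex_bij_betw[OF bij_betw_mindex_enum, symmetric])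
  finally show ?thesis .
qed

text \<open>
  Expanding p into monomials turns the inner sum into a product of B and the Gram matrix.
\<close>

lemma reproducing_property:
  fixes p :: "'d::finite mpoly" and k :: nat
  defines "s \<equiv> num_mindices TYPE('d) k"
  assumes \<mu>: "\<mu> \<in> prob_measures_on (region sh)"
    and B: "B \<in> carrier_mat s s" "B * gram k g \<mu> = 1\<^sub>m s" and p: "mpoly_deg p \<le> k"
  shows "(\<Sum>i<s. \<Sum>l<s. monom_at (mindex_enum k i) x * B $$ (i, l) * mexp \<mu> (g * Poly_Mapping.single (mindex_enum k l) 1 * p)) = mpoly_at p x"
proof -
  define c where "c m = Poly_Mapping.lookup p (mindex_enum k m)" for m
  have pe: "p = (\<Sum>m<s. Poly_Mapping.single (mindex_enum k m) (c m))"
    unfolding s_def c_def using p by (rule mpoly_expand_enum)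
  have 1: "mexp \<mu> (g * Poly_Mapping.single (mindex_enum k l) 1 * p) = (\<Sum>m<s. gram k g \<mu> $$ (l, m) * c m)" if l: "l < s" for l
  proof -
    have "g * Poly_Mapping.single (mindex_enum k l) 1 * p =
        (\<Sum>m<s. g * Poly_Mapping.single (mindex_enum k l + mindex_enum k m) (c m))"
      by (subst pe) (simp add: sum_distrib_left mult.assoc mult_single)
    then have "mexp \<mu> (g * Poly_Mapping.single (mindex_enum k l) 1 * p) =
        (\<Sum>m<s. mexp \<mu> (g * Poly_Mapping.single (mindex_enum k l + mindex_enum k m) (c m)))"
      by (simp only: mexp_sum[OF \<mu>])
    also have "\<dots> = (\<Sum>m<s. gram k g \<mu> $$ (l, m) * c m)"
      using l by (intro sum.cong refl) (subst mexp_cmult, simp add: gram_def s_def)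
    finally show ?thesis .
  qed
  have 2: "(\<Sum>l<s. B $$ (i, l) * (\<Sum>m<s. gram k g \<mu> $$ (l, m) * c m)) = c i" if i: "i < s" for i
  proof -
    have entry: "(\<Sum>l<s. B $$ (i, l) * gram k g \<mu> $$ (l, m)) = (if i = m then 1 else 0)" if m: "m < s" for m
    proof -
      have "(B * gram k g \<mu>) $$ (i, m) = (\<Sum>l<s. B $$ (i, l) * gram k g \<mu> $$ (l, m))"
        using i m B(1) by (auto simp: scalar_prod_def s_def atLeast0LessThan gram_def intro!: sum.cong)
      then show ?thesis using i m by (simp add: B(2))
    qed
    have "(\<Sum>l<s. B $$ (i, l) * (\<Sum>m<s. gram k g \<mu> $$ (l, m) * c m)) =
        (\<Sum>l<s. \<Sum>m<s. B $$ (i, l) * gram k g \<mu> $$ (l, m) * c m)"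
      by (simp add: sum_distrib_left mult.assoc)
    also have "\<dots> = (\<Sum>m<s. (\<Sum>l<s. B $$ (i, l) * gram k g \<mu> $$ (l, m)) * c m)"
      by (subst sum.swap) (simp add: sum_distrib_right)
    also have "\<dots> = (\<Sum>m<s. (if i = m then 1 else 0) * c m)"
      by (intro sum.cong refl) (simp add: entry)
    also have "\<dots> = (\<Sum>m<s. if i = m then c m else 0)" by (intro sum.cong) auto
    also have "\<dots> = c i" using i by simp
    finally show ?thesis .
  qed
  have "(\<Sum>i<s. \<Sum>l<s. monom_at (mindex_enum k i) x * B $$ (i, l) * mexp \<mu> (g * Poly_Mapping.single (mindex_enum k l) 1 * p)) =
      (\<Sum>i<s. monom_at (mindex_enum k i) x * (\<Sum>l<s. B $$ (i, l) * (\<Sum>m<s. gram k g \<mu> $$ (l, m) * c m)))"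
    unfolding sum_distrib_left by (intro sum.cong refl, subst 1) (auto simp: sum_distrib_left mult.assoc)
  also have "\<dots> = (\<Sum>i<s. monom_at (mindex_enum k i) x * c i)"
    by (intro sum.cong refl) (simp add: 2)
  also have "\<dots> = mpoly_at p x" by (subst pe) (simp add: mult.commute)
  finally show ?thesis .
qed

text \<open>
  For \<open>g = s c\<close> and \<open>g' = s c'\<close> with \<open>a_j = c c'\<close> and s independent of \<open>x_j\<close>, the derivation
  \<open>sqrt a_j * d/dx_j\<close> maps \<open>sqrt g * p\<close> to \<open>sqrt g' * twisted j c p\<close>.
\<close>

definition twisted :: "'d::finite \<Rightarrow> 'd mpoly \<Rightarrow> 'd mpoly \<Rightarrow> 'd mpoly" where
  "twisted j c p = c * pdiff j p + pdiff j c * p * Poly_Mapping.single 0 (1 / 2)"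

lemma mpoly_at_twisted: "mpoly_at (twisted j c p) x = mpoly_at c x * mpoly_at (pdiff j p) x + mpoly_at (pdiff j c) x * mpoly_at p x / 2"
  by (simp add: twisted_def)

text \<open>
  If k or e is 0, then the derivative in question vanishes; this takes the place of a degree -1.
\<close>

lemma mpoly_deg_twisted:
  assumes c: "mpoly_deg c \<le> e" and p: "mpoly_deg p \<le> k" and k': "k + e = k' + 1"
  shows "mpoly_deg (twisted j c p) \<le> k'"
proof -
  have "mpoly_deg (c * pdiff j p) \<le> k'"
  proof (cases "k = 0")
    case True
    then have "pdiff j p = 0" using p by (intro pdiff_deg0) simp
    then show ?thesis by simp
  next
    case False
    then show ?thesis using mpoly_deg_mult[OF c mpoly_deg_pdiff[OF p, of j]] k' by simp
  qed
  moreover have "mpoly_deg (pdiff j c * p * Poly_Mapping.single 0 (1 / 2)) \<le> k'"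
  proof (cases "e = 0")
    case True
    then have "pdiff j c = 0" using c by (intro pdiff_deg0) simp
    then show ?thesis by simp
  next
    case False
    have "mpoly_deg (pdiff j c * p * Poly_Mapping.single 0 (1 / 2)) \<le> ((e - 1) + k) + 0"
      by (intro mpoly_deg_mult mpoly_deg_pdiff c p mpoly_deg_single_le) simp
    then show ?thesis using False k' by simp
  qed
  ultimately show ?thesis unfolding twisted_def by (rule mpoly_deg_add)
qed

text \<open>
  The sum of both sides is the formula for integration by parts with \<open>h = s p q\<close>.
\<close>

lemma twisted_skew:
  assumes a: "face_poly sh j = c * c'" and s: "pdiff j s = 0"
  shows "mexp (equil sh) (s * c' * q * twisted j c p) = - mexp (equil sh) (s * c * p * twisted j c' q)"
proof -
  let ?a = "face_poly sh j" and ?h = "s * (p * q)"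
  have "mexp (equil sh) (s * c' * q * twisted j c p) + mexp (equil sh) (s * c * p * twisted j c' q) =
      mexp (equil sh) (s * c' * q * twisted j c p + s * c * p * twisted j c' q)"
    by (rule mexp_add[OF equil_in_prob_measures_on, symmetric])
  also have "\<dots> = (\<integral>x. mpoly_at ?a x * mpoly_at (pdiff j ?h) x + mpoly_at (pdiff j ?a) x * mpoly_at ?h x / 2 \<partial>equil sh)"
    unfolding mexp_def
  proof (rule Bochner_Integration.integral_cong[OF refl])
    fix x
    show "mpoly_at (s * c' * q * twisted j c p + s * c * p * twisted j c' q) x =
      mpoly_at ?a x * mpoly_at (pdiff j ?h) x + mpoly_at (pdiff j ?a) x * mpoly_at ?h x / 2"
      unfolding a by (simp add: mpoly_at_twisted mpoly_at_pdiff_mult s algebra_simps)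
  qed
  also have "\<dots> = 0" by (rule equil_integration_by_parts)
  finally show ?thesis by simp
qed

text \<open>
  The kernel \<open>v(x)^T B v(x)\<close> on the diagonal, as a polynomial.
\<close>

definition kernel_poly :: "nat \<Rightarrow> real mat \<Rightarrow> 'd::finite mpoly" where
  "kernel_poly k B = (\<Sum>i<num_mindices TYPE('d) k. \<Sum>l<num_mindices TYPE('d) k.
     Poly_Mapping.single (mindex_enum k i + mindex_enum k l) (B $$ (i, l)))"

lemma mpoly_at_kernel_poly:
  fixes x :: "real^'d::finite"
  assumes "B \<in> carrier_mat (num_mindices TYPE('d) k) (num_mindices TYPE('d) k)"
  shows "mpoly_at (kernel_poly k B) x = scalar_prod (monom_vec k x) (B *\<^sub>v monom_vec k x)"
  by (subst scalar_prod_mat_sum[OF assms]) (auto simp: monom_vec_def kernel_poly_def monom_at_add intro!: sum.cong)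

lemma pseudo_functional_kernel_poly:
  fixes g :: "'d::finite mpoly"
  shows "pseudo_functional y (g * kernel_poly k B) = frob (num_mindices TYPE('d) k) (localizing_mat k g y) B"
proof -
  let ?s = "num_mindices TYPE('d) k"
  have scale: "pseudo_functional y (g * Poly_Mapping.single \<alpha> c) = pseudo_functional y (g * Poly_Mapping.single \<alpha> 1) * c" for \<alpha> c
  proof (induction g rule: mpoly_induct)
    case (single \<beta> b)
    show ?case by (simp add: mult_single)
  qed (simp add: distrib_right pseudo_functional_add)
  have "pseudo_functional y (g * kernel_poly k B) =
     (\<Sum>i<?s. \<Sum>l<?s. pseudo_functional y (g * Poly_Mapping.single (mindex_enum k i + mindex_enum k l) (B $$ (i, l))))"
    by (simp add: kernel_poly_def sum_distrib_left pseudo_functional_sum)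
  also have "\<dots> = frob ?s (localizing_mat k g y) B"
    unfolding frob_def by (intro sum.cong refl) (subst scale, simp add: localizing_mat_def)
  finally show ?thesis .
qed

text \<open>
  By the product rule, s times the twisted derivative of a monomial is the derivative of that monomial
  in one argument of the kernel together with half of the derivative of \<open>s c\<close>; the two arguments
  contribute equally because B is symmetric.
\<close>

lemma pdiff_kernel:
  fixes s :: "'d::finite mpoly" and k :: nat
  defines "N \<equiv> num_mindices TYPE('d) k"
  assumes s: "pdiff j s = 0" and sym: "\<And>i l. i < N \<Longrightarrow> l < N \<Longrightarrow> B $$ (i, l) = B $$ (l, i)"
  shows "mpoly_at (pdiff j (s * c * kernel_poly k B)) x =
    2 * mpoly_at s x * (\<Sum>i<N. \<Sum>l<N. monom_at (mindex_enum k i) x * B $$ (i, l) *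
      mpoly_at (twisted j c (Poly_Mapping.single (mindex_enum k l) 1)) x)"
proof -
  define v where "v i = monom_at (mindex_enum k i) x" for i
  define v' where "v' i = mpoly_at (pdiff j (Poly_Mapping.single (mindex_enum k i) 1)) x" for i
  define K where "K = (\<Sum>i<N. \<Sum>l<N. v i * B $$ (i, l) * v l)"
  define W where "W = (\<Sum>i<N. \<Sum>l<N. v i * B $$ (i, l) * v' l)"
  have pd_sum: "pdiff j (\<Sum>i\<in>I. p i) = (\<Sum>i\<in>I. pdiff j (p i))" if "finite I" for I and p :: "nat \<Rightarrow> 'd mpoly"
    using that by (induction I rule: finite_induct) (simp_all add: pdiff_add pdiff_deg0)
  have "mpoly_at (pdiff j (kernel_poly k B)) x = (\<Sum>i<N. \<Sum>l<N. B $$ (i, l) * (v' i * v l + v i * v' l))"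
  proof -
    have "mpoly_at (pdiff j (Poly_Mapping.single (\<alpha> + \<beta>) c)) x =
      c * (mpoly_at (pdiff j (Poly_Mapping.single \<alpha> 1)) x * monom_at \<beta> x + monom_at \<alpha> x * mpoly_at (pdiff j (Poly_Mapping.single \<beta> 1)) x)" for \<alpha> \<beta> :: "'d mindex" and c
    proof -
      have "Poly_Mapping.single (\<alpha> + \<beta>) c = Poly_Mapping.single 0 c * (Poly_Mapping.single \<alpha> 1 * Poly_Mapping.single \<beta> 1)"
        by (simp add: mult_single)
      moreover have "mpoly_deg (Poly_Mapping.single 0 c :: 'd mpoly) = 0"
        using mpoly_deg_single_le[of 0 0 c] by simp
      ultimately show ?thesis by (simp only: mpoly_at_pdiff_mult pdiff_deg0) (simp add: algebra_simps)
    qed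
    then show ?thesis
      by (simp add: kernel_poly_def pd_sum N_def v_def v'_def)
  qed
  also have "\<dots> = (\<Sum>i<N. \<Sum>l<N. B $$ (i, l) * v' i * v l) + W"
    by (simp add: W_def algebra_simps sum.distrib)
  also have "(\<Sum>i<N. \<Sum>l<N. B $$ (i, l) * v' i * v l) = W"
    unfolding W_def by (subst sum.swap) (intro sum.cong refl, simp add: sym mult_ac)
  finally have dK: "mpoly_at (pdiff j (kernel_poly k B)) x = 2 * W" by simp
  have K: "mpoly_at (kernel_poly k B) x = K"
    by (simp add: kernel_poly_def K_def N_def v_def monom_at_add mult_ac)
  have "(\<Sum>i<N. \<Sum>l<N. v i * B $$ (i, l) * mpoly_at (twisted j c (Poly_Mapping.single (mindex_enum k l) 1)) x) =
      (\<Sum>i<N. \<Sum>l<N. mpoly_at c x * (v i * B $$ (i, l) * v' l) + mpoly_at (pdiff j c) x / 2 * (v i * B $$ (i, l) * v l))"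
    by (intro sum.cong refl) (simp add: mpoly_at_twisted v_def v'_def algebra_simps)
  also have "\<dots> = mpoly_at c x * W + mpoly_at (pdiff j c) x / 2 * K"
    by (simp add: W_def K_def sum.distrib sum_distrib_left)
  finally have "(\<Sum>i<N. \<Sum>l<N. v i * B $$ (i, l) * mpoly_at (twisted j c (Poly_Mapping.single (mindex_enum k l) 1)) x) =
    mpoly_at c x * W + mpoly_at (pdiff j c) x / 2 * K" .
  then show ?thesis
    by (simp add: mpoly_at_pdiff_mult s dK K v_def[symmetric] algebra_simps)
qed

text \<open>
  Expand the twisted derivative of the monomials for one generator by the reproducing kernel of its
  partner, move the derivation to the other side by skew-symmetry, and contract with the reproducing
  kernel of the first generator: the result is the negative of the same expression with both generators
  exchanged.
\<close>

lemma kernel_pair_cancel: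
  fixes s c c' :: "'d::finite mpoly" and k k' :: nat
  defines "N \<equiv> num_mindices TYPE('d) k" and "N' \<equiv> num_mindices TYPE('d) k'"
  assumes a: "face_poly sh j = c * c'" and s: "pdiff j s = 0"
    and c: "mpoly_deg c \<le> e" "k + e = k' + 1" and c': "mpoly_deg c' \<le> e'" "k' + e' = k + 1"
    and B: "B \<in> carrier_mat N N" "B * gram k (s * c) (equil sh) = 1\<^sub>m N" "transpose_mat B = B"
    and B': "B' \<in> carrier_mat N' N'" "B' * gram k' (s * c') (equil sh) = 1\<^sub>m N'" "transpose_mat B' = B'"
  shows "mpoly_at (pdiff j (s * c * kernel_poly k B)) x + mpoly_at (pdiff j (s * c' * kernel_poly k' B')) x = 0"
proof -
  let ?\<phi> = "equil sh :: (real^'d) measure"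
  have \<phi>: "?\<phi> \<in> prob_measures_on (region sh)" by (rule equil_in_prob_measures_on)
  define u where "u i = monom_at (mindex_enum k i) x" for i
  define u' where "u' i = monom_at (mindex_enum k' i) x" for i
  define m where "m i = (Poly_Mapping.single (mindex_enum k i) 1 :: 'd mpoly)" for i
  define m' where "m' i = (Poly_Mapping.single (mindex_enum k' i) 1 :: 'd mpoly)" for i
  have deg: "mpoly_deg (m l) \<le> k" if "l < N" for l
    unfolding m_def using that mindex_deg_enum by (intro mpoly_deg_single_le) (simp add: N_def)
  have deg': "mpoly_deg (m' l) \<le> k'" if "l < N'" for l
    unfolding m'_def using that mindex_deg_enum by (intro mpoly_deg_single_le) (simp add: N'_def)
  have sym: "B $$ (i, l) = B $$ (l, i)" if "i < N" "l < N" for i l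
    using B(1,3) that by (metis index_transpose_mat(1) carrier_matD)
  have sym': "B' $$ (i, l) = B' $$ (l, i)" if "i < N'" "l < N'" for i l
    using B'(1,3) that by (metis index_transpose_mat(1) carrier_matD)
  have "(\<Sum>i<N. \<Sum>l<N. u i * B $$ (i, l) * mpoly_at (twisted j c (m l)) x) =
    (\<Sum>i<N. \<Sum>l<N. \<Sum>a<N'. \<Sum>b<N'. u i * B $$ (i, l) * (u' a * B' $$ (a, b) * mexp ?\<phi> (s * c' * m' b * twisted j c (m l))))"
  proof (intro sum.cong refl)
    fix i l assume "i \<in> {..<N}" "l \<in> {..<N}"
    then have "mpoly_deg (twisted j c (m l)) \<le> k'" using mpoly_deg_twisted[OF c(1) deg c(2)] by simp
    from reproducing_property[OF \<phi> B'(1,2)[unfolded N'_def] this, of x]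
    have "mpoly_at (twisted j c (m l)) x = (\<Sum>a<N'. \<Sum>b<N'. u' a * B' $$ (a, b) * mexp ?\<phi> (s * c' * m' b * twisted j c (m l)))"
      by (simp add: u'_def m'_def N'_def)
    then show "u i * B $$ (i, l) * mpoly_at (twisted j c (m l)) x =
        (\<Sum>a<N'. \<Sum>b<N'. u i * B $$ (i, l) * (u' a * B' $$ (a, b) * mexp ?\<phi> (s * c' * m' b * twisted j c (m l))))"
      by (simp add: sum_distrib_left)
  qed
  also have "\<dots> = (\<Sum>i<N. \<Sum>l<N. \<Sum>a<N'. \<Sum>b<N'. - (u' a * B' $$ (a, b) * (u i * B $$ (i, l) * mexp ?\<phi> (s * c * m l * twisted j c' (m' b)))))"
    by (intro sum.cong refl) (simp add: twisted_skew[OF a s])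
  also have "\<dots> = (\<Sum>a<N'. \<Sum>b<N'. \<Sum>i<N. \<Sum>l<N. - (u' a * B' $$ (a, b) * (u i * B $$ (i, l) * mexp ?\<phi> (s * c * m l * twisted j c' (m' b)))))"
    (is "(\<Sum>i<N. \<Sum>l<N. \<Sum>a<N'. \<Sum>b<N'. ?t i l a b) = _")
  proof -
    have "(\<Sum>i<N. \<Sum>l<N. \<Sum>a<N'. \<Sum>b<N'. ?t i l a b) = (\<Sum>i<N. \<Sum>a<N'. \<Sum>l<N. \<Sum>b<N'. ?t i l a b)"
      by (intro sum.cong refl sum.swap)
    also have "\<dots> = (\<Sum>a<N'. \<Sum>i<N. \<Sum>b<N'. \<Sum>l<N. ?t i l a b)"
      by (subst sum.swap) (intro sum.cong refl sum.swap)
    also have "\<dots> = (\<Sum>a<N'. \<Sum>b<N'. \<Sum>i<N. \<Sum>l<N. ?t i l a b)"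
      by (intro sum.cong refl sum.swap)
    finally show ?thesis .
  qed
  also have "\<dots> = (\<Sum>a<N'. \<Sum>b<N'. - (u' a * B' $$ (a, b) * mpoly_at (twisted j c' (m' b)) x))"
  proof (intro sum.cong refl)
    fix a b assume "a \<in> {..<N'}" "b \<in> {..<N'}"
    then have "mpoly_deg (twisted j c' (m' b)) \<le> k" using mpoly_deg_twisted[OF c'(1) deg' c'(2)] by simp
    from reproducing_property[OF \<phi> B(1,2)[unfolded N_def] this, of x]
    have "mpoly_at (twisted j c' (m' b)) x = (\<Sum>i<N. \<Sum>l<N. u i * B $$ (i, l) * mexp ?\<phi> (s * c * m l * twisted j c' (m' b)))"
      by (simp add: u_def m_def N_def)
    then show "(\<Sum>i<N. \<Sum>l<N. - (u' a * B' $$ (a, b) * (u i * B $$ (i, l) * mexp ?\<phi> (s * c * m l * twisted j c' (m' b))))) =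
       - (u' a * B' $$ (a, b) * mpoly_at (twisted j c' (m' b)) x)"
      by (simp add: sum_distrib_left sum_negf)
  qed
  finally have "(\<Sum>i<N. \<Sum>l<N. u i * B $$ (i, l) * mpoly_at (twisted j c (m l)) x) =
     - (\<Sum>a<N'. \<Sum>b<N'. u' a * B' $$ (a, b) * mpoly_at (twisted j c' (m' b)) x)"
    by (simp add: sum_negf)
  then show ?thesis
    using pdiff_kernel[OF s, of k B c x] pdiff_kernel[OF s, of k' B' c' x] sym sym'
    by (simp add: u_def u'_def m_def m'_def N_def N'_def)
qed

section \<open>The generators as products of factors\<close>

text \<open>
  The factors that do not occur for a shape are set to 1, so that they do not depend on any variable.
\<close>

definition factor :: "shape \<Rightarrow> 'd::finite option \<Rightarrow> 'd mpoly" where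
  "factor sh b = (case sh of
      UnitBall \<Rightarrow> (case b of None \<Rightarrow> 1 - (\<Sum>i\<in>UNIV. mpoly_var i ^ 2) | Some j \<Rightarrow> 1)
    | UnitBox \<Rightarrow> (case b of None \<Rightarrow> 1 | Some j \<Rightarrow> 1 - mpoly_var j ^ 2)
    | UnitSimplex \<Rightarrow> (case b of None \<Rightarrow> 1 - (\<Sum>i\<in>UNIV. mpoly_var i) | Some j \<Rightarrow> mpoly_var j))"

definition factors :: "shape \<Rightarrow> 'd::finite option set" where
  "factors sh = (case sh of UnitBall \<Rightarrow> {None} | UnitBox \<Rightarrow> range Some | UnitSimplex \<Rightarrow> UNIV)"

definition factor_deg :: "shape \<Rightarrow> nat" where
  "factor_deg sh = (case sh of UnitBall \<Rightarrow> 2 | UnitBox \<Rightarrow> 2 | UnitSimplex \<Rightarrow> 1)"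

definition gen :: "shape \<Rightarrow> 'd::finite option set \<Rightarrow> 'd mpoly" where
  "gen sh B = (\<Prod>b\<in>B. factor sh b)"

definition gen_deg :: "shape \<Rightarrow> 'd option set \<Rightarrow> nat" where
  "gen_deg sh B = factor_deg sh * card B"

definition gen_index :: "shape \<Rightarrow> nat \<Rightarrow> 'd::finite option set set" where
  "gen_index sh n = {B. B \<subseteq> factors sh \<and> even (gen_deg sh B) \<and> gen_deg sh B \<le> 2 * n}"

text \<open>
  The factors of \<open>face_poly\<close>: the partner of a generator in direction j arises by exchanging those of
  them that occur in it with those that do not.
\<close>

definition flip :: "shape \<Rightarrow> 'd \<Rightarrow> 'd option set" where
  "flip sh j = (case sh of UnitBall \<Rightarrow> {None} | UnitBox \<Rightarrow> {Some j} | UnitSimplex \<Rightarrow> {Some j, None})"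

lemma face_poly_eq_gen: "face_poly sh j = gen sh (flip sh j)"
  by (cases sh) (auto simp: face_poly_def gen_def flip_def factor_def)

lemma flip_subset: "flip sh j \<subseteq> factors sh"
  by (cases sh) (auto simp: flip_def factors_def)

lemma gen_deg_flip: "gen_deg sh (flip sh j) = 2"
  by (cases sh) (auto simp: flip_def gen_deg_def factor_deg_def)

lemma finite_gen_index [simp]: "finite (gen_index sh n :: 'd::finite option set set)"
  by simp

lemma mpoly_at_gen: "mpoly_at (gen sh B) x = (\<Prod>b\<in>B. mpoly_at (factor sh b) x)"
  by (simp add: gen_def)

lemma factor_line:
  assumes "b \<in> factors sh" "b \<notin> flip sh j"
  shows "mpoly_at (factor sh b) (x + t *\<^sub>R axis j 1) = mpoly_at (factor sh b) x"
  using assms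
  by (cases sh; cases b) (auto simp: flip_def factors_def factor_def axis_def)

lemma pdiff_eq_0_if_constant_on_lines:
  assumes "\<And>x t. mpoly_at p (x + t *\<^sub>R axis j 1) = mpoly_at p x"
  shows "pdiff j p = 0"
proof (rule mpoly_eqI)
  fix x
  have "((\<lambda>t. mpoly_at p (x + t *\<^sub>R axis j 1)) has_real_derivative mpoly_at (pdiff j p) x) (at 0)"
    using has_derivative_mpoly_at_line[of p x j 0 UNIV] by simp
  then have "((\<lambda>t. mpoly_at p x) has_real_derivative mpoly_at (pdiff j p) x) (at 0)" by (simp only: assms)
  then have "mpoly_at (pdiff j p) x = 0" by (rule DERIV_unique) simp
  then show "mpoly_at (pdiff j p) x = mpoly_at 0 x" by simp
qed

lemma pdiff_gen_eq_0:
  assumes "B \<subseteq> factors sh" "B \<inter> flip sh j = {}"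
  shows "pdiff j (gen sh B) = 0"
proof (rule pdiff_eq_0_if_constant_on_lines)
  fix x t
  show "mpoly_at (gen sh B) (x + t *\<^sub>R axis j 1) = mpoly_at (gen sh B) x"
    unfolding mpoly_at_gen by (intro prod.cong refl factor_line) (use assms in auto)
qed

lemma mpoly_deg_one_minus: "mpoly_deg p \<le> k \<Longrightarrow> mpoly_deg (1 - p) \<le> k"
  by (rule mpoly_deg_diff) auto

lemma mpoly_deg_factor: "mpoly_deg (factor sh b) \<le> factor_deg sh"
proof -
  have sq: "mpoly_deg (mpoly_var i ^ 2 :: 'a mpoly) \<le> 2" for i
    using mpoly_deg_power[OF mpoly_deg_var_le, of i 2] by simp
  have lin: "mpoly_deg (mpoly_var i :: 'a mpoly) \<le> Suc 0" for i
    using mpoly_deg_var_le[of i] by simp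
  show ?thesis
    by (cases sh; cases b)
       (auto simp: factor_def factor_deg_def intro!: mpoly_deg_one_minus mpoly_deg_sum sq lin)
qed

lemma mpoly_deg_gen: "mpoly_deg (gen sh B) \<le> gen_deg sh B"
proof -
  have "mpoly_deg (gen sh B) \<le> (\<Sum>b\<in>B. factor_deg sh)"
    unfolding gen_def by (intro mpoly_deg_prod mpoly_deg_factor)
  then show ?thesis by (simp add: gen_deg_def mult.commute)
qed

text \<open>
  On the diagonal each factor becomes a univariate polynomial of full degree.
\<close>

lemma mpoly_deg_gen_eq:
  fixes B :: "'d::finite option set"
  assumes "B \<subseteq> factors sh"
  shows "mpoly_deg (gen sh B) = gen_deg sh B"
proof (rule antisym[OF mpoly_deg_gen])
  define r where "r b = (case sh of UnitBall \<Rightarrow> [:1, 0, - real CARD('d):] | UnitBox \<Rightarrow> [:1, 0, -1:]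
    | UnitSimplex \<Rightarrow> (case b of None \<Rightarrow> [:1, - real CARD('d):] | Some (j :: 'd) \<Rightarrow> [:0, 1:]))" for b
  have r: "mpoly_at (factor sh b) (\<chi> i. t) = poly (r b) t" if "b \<in> B" for b t
    using assms that
    by (cases sh; cases b) (auto simp: factor_def r_def factors_def power2_eq_square algebra_simps)
  have deg: "degree (r b) = factor_deg sh" "r b \<noteq> 0" for b
    by (cases sh; cases b; simp add: r_def factor_deg_def)+
  have "degree (\<Prod>b\<in>B. r b) = (\<Sum>b\<in>B. degree (r b))"
    using deg(2) by (intro degree_prod_eq_sum_degree) auto
  then have "degree (\<Prod>b\<in>B. r b) = gen_deg sh B" by (simp add: deg(1) gen_deg_def mult.commute)
  moreover have "degree (\<Prod>b\<in>B. r b) \<le> mpoly_deg (gen sh B)"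
    by (rule mpoly_deg_on_diagonal) (simp add: mpoly_at_gen poly_prod r)
  ultimately show "gen_deg sh B \<le> mpoly_deg (gen sh B)" by simp
qed

lemma half_deg_gen:
  fixes B :: "'d::finite option set"
  assumes "B \<subseteq> factors sh" "even (gen_deg sh B)"
  shows "half_deg (gen sh B) = gen_deg sh B div 2"
proof -
  obtain m where m: "gen_deg sh B = 2 * m" using assms(2) by blast
  show ?thesis by (simp add: half_deg_def mpoly_deg_gen_eq[OF assms(1)] m)
qed

lemma region_iff_factors:
  "x \<in> region sh \<longleftrightarrow> (\<forall>b\<in>factors sh. 0 \<le> mpoly_at (factor sh b) (x :: real^'d::finite))"
proof (cases sh)
  case UnitBall
  have "(norm x)\<^sup>2 = (\<Sum>i\<in>UNIV. (vec_nth x i)\<^sup>2)"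
    unfolding power2_norm_eq_inner inner_vec_def by (simp add: power2_eq_square)
  then show ?thesis using UnitBall by (simp add: region_def factors_def factor_def)
next
  case UnitBox
  then show ?thesis by (auto simp: region_def factors_def factor_def)
next
  case UnitSimplex
  have "(\<forall>b. P b) \<longleftrightarrow> (\<forall>j. P (Some j)) \<and> P None" for P :: "'d option \<Rightarrow> bool" by (metis option.exhaust)
  then show ?thesis using UnitSimplex by (simp add: region_def factors_def factor_def)
qed

lemma gen_nonneg:
  assumes "B \<subseteq> factors sh" "x \<in> region sh"
  shows "0 \<le> mpoly_at (gen sh B) x"
  unfolding mpoly_at_gen using assms by (intro prod_nonneg) (auto simp: region_iff_factors)

text \<open>
  The interior of the region, in a form in which positivity of the generators is immediate.
\<close>

definition core :: "shape \<Rightarrow> (real^'d::finite) set" where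
  "core sh = {x. \<forall>b\<in>factors sh. 0 < mpoly_at (factor sh b) x}"

lemma open_core: "open (core sh :: (real^'d::finite) set)"
proof -
  have "core sh = (\<Inter>b\<in>factors sh. {x :: real^'d. 0 < mpoly_at (factor sh b) x})" by (auto simp: core_def)
  then show ?thesis by (simp only:) (intro open_INT ballI open_Collect_less continuous_intros; simp)
qed

lemma core_nonempty: "(core sh :: (real^'d::finite) set) \<noteq> {}"
proof (cases sh)
  case UnitSimplex
  have "(\<chi> i. 1 / (2 * real CARD('d))) \<in> (core sh :: (real^'d) set)"
    unfolding core_def
  proof (intro CollectI ballI)
    fix b :: "'d option"
    show "0 < mpoly_at (factor sh b) (\<chi> i. 1 / (2 * real CARD('d)))"
      by (cases b) (auto simp: UnitSimplex factor_def)
  qed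
  then show ?thesis by blast
next
  case UnitBall
  then have "(0 :: real^'d) \<in> core sh" by (auto simp: core_def factors_def factor_def)
  then show ?thesis by blast
next
  case UnitBox
  then have "(0 :: real^'d) \<in> core sh" by (auto simp: core_def factors_def factor_def)
  then show ?thesis by blast
qed

lemma weight_pos_on_core:
  fixes x :: "real^'d::finite"
  assumes "x \<in> core sh"
  shows "0 < weight sh x"
proof -
  have b: "0 < mpoly_at (factor sh b) x" if "b \<in> factors sh" for b using assms that by (auto simp: core_def)
  have pos: "0 < inv_sqrt s" if "0 < s" for s using that by (simp add: inv_sqrt_def)
  show ?thesis
  proof (cases sh)
    case UnitBall
    have "(norm x)\<^sup>2 = (\<Sum>i\<in>UNIV. (vec_nth x i)\<^sup>2)"
      unfolding power2_norm_eq_inner inner_vec_def by (simp add: power2_eq_square)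
    then show ?thesis using b[of None] UnitBall norm_const_pos pos
      by (auto simp: weight_ball factors_def factor_def intro!: mult_pos_pos)
  next
    case UnitBox
    then have "(vec_nth x j)\<^sup>2 < 1" for j using b[of "Some j"] by (simp add: factors_def factor_def)
    then show ?thesis unfolding UnitBox weight_box by (intro prod_pos divide_pos_pos pos) auto
  next
    case UnitSimplex
    then have "0 < vec_nth x j" for j using b[of "Some j"] by (simp add: factors_def factor_def)
    moreover have "0 < 1 - (\<Sum>i\<in>UNIV. vec_nth x i)" using UnitSimplex b[of None] by (simp add: factors_def factor_def)
    ultimately show ?thesis unfolding UnitSimplex weight_simplex
      by (intro mult_pos_pos norm_const_pos prod_pos pos) auto
  qed
qed

text \<open>
  A point in the relative interior of a facet (for the ball: of the boundary).
\<close>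

lemma factors_separated:
  assumes "b \<in> factors sh"
  shows "\<exists>z :: real^'d::finite. \<forall>b'\<in>factors sh. mpoly_at (factor sh b') z = 0 \<longleftrightarrow> b' = b"
proof (cases sh)
  case UnitBall
  have "(vec_nth (axis undefined 1 :: real^'d) i)\<^sup>2 = (if i = undefined then 1 else 0)" for i
    by (simp add: axis_def)
  then show ?thesis
    by (intro exI[of _ "axis undefined 1"]) (use assms in \<open>simp add: UnitBall factors_def factor_def\<close>)
next
  case UnitBox
  then obtain j where "b = Some j" using assms by (auto simp: factors_def)
  then show ?thesis
    by (intro exI[of _ "axis j 1"]) (auto simp: UnitBox factors_def factor_def axis_def split: if_splits)
next
  case UnitSimplex
  show ?thesis
  proof (cases b)
    case None
    show ?thesis
      by (rule exI[of _ "\<chi> i. 1 / real CARD('d)"])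
         (auto simp: UnitSimplex None factor_def split: option.split)
  next
    case (Some j)
    define z :: "real^'d" where "z = (\<chi> i. if i = j then 0 else 1 / (2 * real CARD('d)))"
    have "(\<Sum>i\<in>UNIV. vec_nth z i) \<le> (\<Sum>i\<in>(UNIV :: 'd set). 1 / (2 * real CARD('d)))"
      by (intro sum_mono) (simp add: z_def)
    also have "\<dots> < 1" by simp
    finally have "1 - (\<Sum>i\<in>UNIV. vec_nth z i) \<noteq> 0" by simp
    then show ?thesis
      by (intro exI[of _ z]) (auto simp: UnitSimplex Some factor_def z_def split: option.split)
  qed
qed

lemma inj_on_gen: "inj_on (gen sh) (Pow (factors sh :: 'd::finite option set))"
proof (rule inj_onI)
  fix A B :: "'d option set"
  assume AB: "A \<in> Pow (factors sh)" "B \<in> Pow (factors sh)" and eq: "gen sh A = gen sh B"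
  have "b \<in> A \<longleftrightarrow> b \<in> B" if b: "b \<in> factors sh" for b
  proof -
    obtain z :: "real^'d" where z: "\<forall>b'\<in>factors sh. mpoly_at (factor sh b') z = 0 \<longleftrightarrow> b' = b"
      using factors_separated[OF b] ..
    have "b \<in> C \<longleftrightarrow> mpoly_at (gen sh C) z = 0" if "C \<subseteq> factors sh" for C
      using that z by (auto simp: mpoly_at_gen)
    then show ?thesis using AB eq by simp
  qed
  then show "A = B" using AB by blast
qed

lemma option_set_split:
  fixes B :: "'d::finite option set"
  shows "prod h B = (\<Prod>j\<in>{j. Some j \<in> B}. h (Some j)) * (if None \<in> B then h None else (1 :: 'a :: comm_monoid_mult))"
    and "card B = card {j. Some j \<in> B} + (if None \<in> B then 1 else 0)"
proof -
  let ?A = "{j. Some j \<in> B}" and ?N = "if None \<in> B then {None} else ({} :: 'd option set)"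
  have B: "B = Some ` ?A \<union> ?N"
  proof (intro equalityI subsetI)
    show "b \<in> Some ` ?A \<union> ?N" if "b \<in> B" for b using that by (cases b) auto
    show "b \<in> B" if "b \<in> Some ` ?A \<union> ?N" for b using that by (auto split: if_splits)
  qed
  have dis: "Some ` ?A \<inter> ?N = {}" by auto
  have "prod h B = prod h (Some ` ?A) * prod h ?N"
    by (subst (1) B) (rule prod.union_disjoint[OF _ _ dis], auto)
  then show "prod h B = (\<Prod>j\<in>{j. Some j \<in> B}. h (Some j)) * (if None \<in> B then h None else (1 :: 'a))"
    by (simp add: prod.reindex)
  have "card B = card (Some ` ?A) + card ?N"
    by (subst (1) B) (rule card_Un_disjoint[OF _ _ dis], auto)
  then show "card B = card {j. Some j \<in> B} + (if None \<in> B then 1 else 0)"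
    by (simp add: card_image)
qed

lemma zero_one_exponents:
  fixes \<epsilon> :: "'d::finite \<Rightarrow> nat"
  assumes "range \<epsilon> \<subseteq> {0, 1}"
  shows "(\<Prod>j\<in>UNIV. h j ^ \<epsilon> j) = (\<Prod>j\<in>{j. \<epsilon> j = 1}. h j :: 'a :: comm_monoid_mult)"
    and "(\<Sum>j\<in>UNIV. \<epsilon> j) = card {j. \<epsilon> j = 1}"
proof -
  have e: "\<epsilon> j = (if \<epsilon> j = 1 then 1 else 0)" for j using assms by (auto simp: image_subset_iff)
  have "(\<Prod>j\<in>UNIV. h j ^ \<epsilon> j) = (\<Prod>j\<in>UNIV. if \<epsilon> j = 1 then h j else 1)"
  proof (rule prod.cong[OF refl])
    fix j
    have "\<epsilon> j = 0 \<or> \<epsilon> j = 1" using assms by (auto simp: image_subset_iff)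
    then show "h j ^ \<epsilon> j = (if \<epsilon> j = 1 then h j else 1)" by auto
  qed
  then show "(\<Prod>j\<in>UNIV. h j ^ \<epsilon> j) = (\<Prod>j\<in>{j. \<epsilon> j = 1}. h j)"
    by (simp add: prod.If_cases)
  have "(\<Sum>j\<in>UNIV. \<epsilon> j) = (\<Sum>j\<in>UNIV. if \<epsilon> j = 1 then 1 else 0)"
    by (rule sum.cong[OF refl e])
  then show "(\<Sum>j\<in>UNIV. \<epsilon> j) = card {j. \<epsilon> j = 1}"
    by (simp add: sum.If_cases)
qed

text \<open>
  The exponents are 0 or 1, so they are the characteristic functions of subsets; the number of factors
  times their degree is the degree of the generator, which turns each condition on the sum of the
  exponents into the one for \<open>gen_index\<close>.
\<close>

lemma gens_eq_gen_image:
  assumes "1 \<le> n"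
  shows "gens sh n = gen sh ` (gen_index sh n :: 'd::finite option set set)"
proof (cases sh)
  case UnitBall
  have "(gen_index sh n :: 'd option set set) = {{}, {None}}"
    using assms by (auto simp: UnitBall gen_index_def gen_deg_def factor_deg_def factors_def)
  then show ?thesis by (simp add: UnitBall gens_def gen_def factor_def)
next
  case UnitBox
  have gen_eq: "gen UnitBox B = (\<Prod>j\<in>{j. Some j \<in> B}. 1 - mpoly_var j ^ 2)" for B :: "'d option set"
    by (simp add: gen_def option_set_split(1)[of _ B] factor_def)
  have idx: "B \<in> gen_index UnitBox n \<longleftrightarrow> None \<notin> B \<and> card {j. Some j \<in> B} \<le> n" for B :: "'d option set"
  proof -
    have "B \<subseteq> range Some \<longleftrightarrow> None \<notin> B"
    proof
      assume *: "None \<notin> B"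
      show "B \<subseteq> range Some"
      proof
        show "b \<in> range Some" if "b \<in> B" for b using that * by (cases b) auto
      qed
    qed auto
    then show ?thesis
      by (auto simp: gen_index_def gen_deg_def factor_deg_def factors_def option_set_split(2)[of B])
  qed
  show ?thesis
  proof (intro equalityI subsetI)
    fix g :: "'d mpoly" assume "g \<in> gens sh n"
    then obtain \<epsilon> :: "'d \<Rightarrow> nat" where \<epsilon>: "g = (\<Prod>j\<in>UNIV. (1 - mpoly_var j ^ 2) ^ \<epsilon> j)" "range \<epsilon> \<subseteq> {0, 1}" "(\<Sum>j\<in>UNIV. \<epsilon> j) \<le> n"
      by (auto simp: UnitBox gens_def)
    define B where "B = Some ` {j. \<epsilon> j = 1}"
    have B: "{j. Some j \<in> B} = {j. \<epsilon> j = 1}" "None \<notin> B" by (auto simp: B_def)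
    have "g = gen UnitBox B" unfolding \<epsilon>(1) gen_eq B zero_one_exponents(1)[OF \<epsilon>(2)] ..
    moreover have "B \<in> gen_index UnitBox n" using \<epsilon>(3) B by (simp add: idx zero_one_exponents(2)[OF \<epsilon>(2)])
    ultimately show "g \<in> gen sh ` gen_index sh n" by (simp add: UnitBox)
  next
    fix g :: "'d mpoly" assume "g \<in> gen sh ` gen_index sh n"
    then obtain B where B: "g = gen UnitBox B" "card {j. Some j \<in> B} \<le> n" by (auto simp: UnitBox idx)
    define \<epsilon> :: "'d \<Rightarrow> nat" where "\<epsilon> j = (if Some j \<in> B then 1 else 0)" for j
    have r: "range \<epsilon> \<subseteq> {0, 1}" by (auto simp: \<epsilon>_def)
    have e: "{j. \<epsilon> j = 1} = {j. Some j \<in> B}" by (auto simp: \<epsilon>_def)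
    have "g = (\<Prod>j\<in>UNIV. (1 - mpoly_var j ^ 2) ^ \<epsilon> j) \<and> range \<epsilon> \<subseteq> {0, 1} \<and> (\<Sum>j\<in>UNIV. \<epsilon> j) \<le> n"
      using B r by (simp only: gen_eq zero_one_exponents[OF r] e)
    then show "g \<in> gens sh n" unfolding gens_def UnitBox shape.case by blast
  qed
next
  case UnitSimplex
  let ?s = "1 - (\<Sum>j\<in>UNIV. mpoly_var j) :: 'd mpoly"
  have gen_eq: "gen UnitSimplex B = (\<Prod>j\<in>{j. Some j \<in> B}. mpoly_var j) * ?s ^ (if None \<in> B then 1 else 0)" for B :: "'d option set"
    by (simp add: gen_def option_set_split(1)[of _ B] factor_def)
  have idx: "B \<in> gen_index UnitSimplex n \<longleftrightarrow> even (card {j. Some j \<in> B} + (if None \<in> B then 1 else 0)) \<and>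
    (card {j. Some j \<in> B} + (if None \<in> B then 1 else 0)) div 2 \<le> n" for B :: "'d option set"
    unfolding option_set_split(2)[of B, symmetric]
    by (auto simp: gen_index_def gen_deg_def factor_deg_def factors_def elim!: evenE)
  show ?thesis
  proof (intro equalityI subsetI)
    fix g :: "'d mpoly" assume "g \<in> gens sh n"
    then obtain \<epsilon> :: "'d \<Rightarrow> nat" and \<epsilon>' where \<epsilon>: "g = (\<Prod>j\<in>UNIV. mpoly_var j ^ \<epsilon> j) * ?s ^ \<epsilon>'" "range \<epsilon> \<subseteq> {0, 1}"
      "\<epsilon>' \<in> {0, 1}" "even ((\<Sum>j\<in>UNIV. \<epsilon> j) + \<epsilon>')" "((\<Sum>j\<in>UNIV. \<epsilon> j) + \<epsilon>') div 2 \<le> n"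
      unfolding gens_def UnitSimplex shape.case by blast
    define B where "B = Some ` {j. \<epsilon> j = 1} \<union> (if \<epsilon>' = 1 then {None} else {})"
    have B: "{j. Some j \<in> B} = {j. \<epsilon> j = 1}" "None \<in> B \<longleftrightarrow> \<epsilon>' = 1" by (auto simp: B_def)
    have e': "(if None \<in> B then 1 else 0) = \<epsilon>'" using \<epsilon>(3) by (auto simp: B)
    have "g = gen UnitSimplex B" unfolding \<epsilon>(1) gen_eq e' B(1) zero_one_exponents(1)[OF \<epsilon>(2)] ..
    moreover have "B \<in> gen_index UnitSimplex n"
      unfolding idx e' B(1) using \<epsilon>(4,5) by (simp add: zero_one_exponents(2)[OF \<epsilon>(2)])
    ultimately show "g \<in> gen sh ` gen_index sh n" by (simp add: UnitSimplex)
  next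
    fix g :: "'d mpoly" assume "g \<in> gen sh ` gen_index sh n"
    then obtain B where B: "g = gen UnitSimplex B" "even (card {j. Some j \<in> B} + (if None \<in> B then 1 else 0))"
      "(card {j. Some j \<in> B} + (if None \<in> B then 1 else 0)) div 2 \<le> n" by (auto simp: UnitSimplex idx)
    define \<epsilon> :: "'d \<Rightarrow> nat" where "\<epsilon> j = (if Some j \<in> B then 1 else 0)" for j
    define \<epsilon>' :: nat where "\<epsilon>' = (if None \<in> B then 1 else 0)"
    have r: "range \<epsilon> \<subseteq> {0, 1}" by (auto simp: \<epsilon>_def)
    have e: "{j. \<epsilon> j = 1} = {j. Some j \<in> B}" by (auto simp: \<epsilon>_def)
    have "g = (\<Prod>j\<in>UNIV. mpoly_var j ^ \<epsilon> j) * ?s ^ \<epsilon>' \<and> range \<epsilon> \<subseteq> {0, 1} \<and> \<epsilon>' \<in> {0, 1} \<and>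
      even ((\<Sum>j\<in>UNIV. \<epsilon> j) + \<epsilon>') \<and> ((\<Sum>j\<in>UNIV. \<epsilon> j) + \<epsilon>') div 2 \<le> n"
      unfolding zero_one_exponents[OF r] e using B r
      by (simp only: gen_eq \<epsilon>'_def) simp
    then show "g \<in> gens sh n" unfolding gens_def UnitSimplex shape.case by blast
  qed
qed

section \<open>Positive definiteness and the partition of unity\<close>

definition vec_poly :: "nat \<Rightarrow> real Matrix.vec \<Rightarrow> 'd::finite mpoly" where
  "vec_poly k v = (\<Sum>i<num_mindices TYPE('d) k. Poly_Mapping.single (mindex_enum k i) (vec_index v i))"

lemma gram_quadratic_form:
  fixes g :: "'d::finite mpoly"
  assumes \<mu>: "\<mu> \<in> prob_measures_on (region sh)" and v: "v \<in> carrier_vec (num_mindices TYPE('d) k)"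
  shows "scalar_prod v (gram k g \<mu> *\<^sub>v v) = mexp \<mu> (g * (vec_poly k v * vec_poly k v))"
proof -
  let ?s = "num_mindices TYPE('d) k"
  have "g * (vec_poly k v * vec_poly k v) = (\<Sum>i<?s. \<Sum>j<?s. g * Poly_Mapping.single (mindex_enum k i + mindex_enum k j) (vec_index v i * vec_index v j))"
    unfolding vec_poly_def sum_product by (simp add: mult_single sum_distrib_left)
  then have "mexp \<mu> (g * (vec_poly k v * vec_poly k v)) =
      (\<Sum>i<?s. \<Sum>j<?s. mexp \<mu> (g * Poly_Mapping.single (mindex_enum k i + mindex_enum k j) (vec_index v i * vec_index v j)))"
    by (simp only: mexp_sum[OF \<mu>])
  also have "\<dots> = (\<Sum>i<?s. \<Sum>j<?s. vec_index v i * gram k g \<mu> $$ (i, j) * vec_index v j)"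
    by (intro sum.cong refl) (subst mexp_cmult, simp add: gram_def)
  also have "\<dots> = scalar_prod v (gram k g \<mu> *\<^sub>v v)"
    by (rule scalar_prod_mat_sum[OF gram_carrier v v, symmetric])
  finally show ?thesis ..
qed

lemma vec_poly_eq_0:
  assumes v: "v \<in> carrier_vec (num_mindices TYPE('d::finite) k)" and z: "(vec_poly k v :: 'd mpoly) = 0"
  shows "v = 0\<^sub>v (num_mindices TYPE('d) k)"
proof (rule eq_vecI)
  fix m assume "m < dim_vec (0\<^sub>v (num_mindices TYPE('d) k) :: real Matrix.vec)"
  then have m: "m < num_mindices TYPE('d) k" by simp
  have inj: "inj_on (mindex_enum k :: nat \<Rightarrow> 'd mindex) {..<num_mindices TYPE('d) k}"
    using bij_betw_mindex_enum[of k, where ?'d = 'd] by (simp add: bij_betw_def)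
  have "Poly_Mapping.lookup (vec_poly k v :: 'd mpoly) (mindex_enum k m) =
     (\<Sum>i<num_mindices TYPE('d) k. if i = m then vec_index v i else 0)"
    unfolding vec_poly_def lookup_sum
    by (intro sum.cong refl) (use inj m in \<open>auto simp: lookup_single when_def dest: inj_onD\<close>)
  then show "vec_index v m = vec_index (0\<^sub>v (num_mindices TYPE('d) k)) m" using m z by simp
qed (use v in simp)

lemma psd_gram:
  fixes g :: "'d::finite mpoly"
  assumes \<mu>: "\<mu> \<in> prob_measures_on (region sh)" and g: "\<And>x. x \<in> region sh \<Longrightarrow> 0 \<le> mpoly_at g x"
  shows "psd_mat (num_mindices TYPE('d) k) (gram k g \<mu>)"
proof -
  have "0 \<le> mexp \<mu> (g * (p * p))" for p
    unfolding mexp_def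
  proof (rule integral_nonneg_AE)
    show "AE x in \<mu>. 0 \<le> mpoly_at (g * (p * p)) x"
      using AE_prob_measures_on[OF \<mu> region_borel] by eventually_elim (simp add: g)
  qed
  then show ?thesis
    using gram_quadratic_form[OF \<mu>]
    by (auto simp: psd_mat_def gram_def add.commute intro!: eq_matI)
qed

text \<open>
  The density is positive on the open core, so q vanishes there almost everywhere and, by continuity,
  everywhere.
\<close>

lemma mexp_equil_eq_0D:
  fixes q :: "'d::finite mpoly"
  assumes q: "\<And>x. x \<in> region sh \<Longrightarrow> 0 \<le> mpoly_at q x" and z: "mexp (equil sh) q = 0" and x: "x \<in> core sh"
  shows "mpoly_at q x = 0"
proof (rule ccontr)
  assume ne: "mpoly_at q x \<noteq> 0"
  have nonneg: "0 \<le> weight sh y * mpoly_at q y" for y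
    by (cases "y \<in> region sh") (auto simp: q weight_outside)
  have "(\<integral>y. weight sh y * mpoly_at q y \<partial>lborel) = 0"
    using z integral_equil[OF borel_measurable_mpoly_at[of q], of sh] by (simp add: mexp_def)
  then have "AE y in lborel. weight sh y * mpoly_at q y = 0"
    using integral_nonneg_eq_0_iff_AE[OF integrable_weight_mpoly[of sh q]] nonneg by simp
  moreover define U where "U = core sh \<inter> {y. mpoly_at q y \<noteq> 0}"
  ultimately have AE: "AE y in lborel. y \<notin> U"
    by (elim eventually_mono) (auto dest: weight_pos_on_core)
  have "open {y. mpoly_at q y \<noteq> 0}"
    by (intro open_Collect_neq continuous_intros)
  then have U: "open U" unfolding U_def using open_core by (intro open_Int)
  then have "U \<in> null_sets lborel"
    using AE by (subst AE_iff_null_sets) auto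
  then have "negligible U"
    by (simp add: negligible_iff_null_sets null_sets_completionI)
  moreover have "x \<in> U" using x ne by (simp add: U_def)
  ultimately show False using open_not_negligible[OF U] by blast
qed

text \<open>
  If the quadratic form vanishes at v, then the polynomial with coefficient vector v vanishes on the core,
  which is open; so it is zero.
\<close>

lemma det_gram_pos:
  fixes B :: "'d::finite option set"
  assumes B: "B \<subseteq> factors sh"
  shows "0 < Determinant.det (gram k (gen sh B) (equil sh))"
proof (rule pos_def_det_pos)
  let ?\<phi> = "equil sh :: (real^'d) measure" and ?s = "num_mindices TYPE('d) k"
  have \<phi>: "?\<phi> \<in> prob_measures_on (region sh)" by (rule equil_in_prob_measures_on)
  show "psd_mat ?s (gram k (gen sh B) ?\<phi>)" by (rule psd_gram[OF \<phi>]) (rule gen_nonneg[OF B])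
  fix v :: "real Matrix.vec" assume v: "v \<in> carrier_vec ?s" "v \<noteq> 0\<^sub>v ?s"
  show "scalar_prod v (gram k (gen sh B) ?\<phi> *\<^sub>v v) \<noteq> 0"
  proof
    let ?p = "vec_poly k v :: 'd mpoly"
    assume "scalar_prod v (gram k (gen sh B) ?\<phi> *\<^sub>v v) = 0"
    then have z: "mexp ?\<phi> (gen sh B * (?p * ?p)) = 0" using gram_quadratic_form[OF \<phi> v(1)] by simp
    have "mpoly_at ?p x = 0" if x: "x \<in> core sh" for x
    proof -
      have "0 \<le> mpoly_at (gen sh B * (?p * ?p)) y" if "y \<in> region sh" for y
        using gen_nonneg[OF B that] by simp
      then have "mpoly_at (gen sh B * (?p * ?p)) x = 0" using z x by (rule mexp_equil_eq_0D)
      moreover have "0 < mpoly_at (gen sh B) x"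
        unfolding mpoly_at_gen using x B by (intro prod_pos) (auto simp: core_def)
      ultimately show ?thesis by simp
    qed
    then have "?p = 0" by (rule mpoly_eq_0_if_zero_on_open[OF open_core core_nonempty])
    then show False using vec_poly_eq_0[OF v(1)] v(2) by blast
  qed
qed

lemma mpoly_deg_kernel_poly: "mpoly_deg (kernel_poly k B :: 'd::finite mpoly) \<le> 2 * k"
  unfolding kernel_poly_def
proof (intro mpoly_deg_sum mpoly_deg_single_le)
  fix i j assume "i \<in> {..<num_mindices TYPE('d) k}" "j \<in> {..<num_mindices TYPE('d) k}"
  then show "mindex_deg (mindex_enum k i + mindex_enum k j :: 'd mindex) \<le> 2 * k"
    using mindex_deg_enum[of i k, where ?'d = 'd] mindex_deg_enum[of j k, where ?'d = 'd] by (simp add: mindex_deg_add)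
qed

lemma mexp_kernel_poly:
  fixes g :: "'d::finite mpoly"
  assumes \<mu>: "\<mu> \<in> prob_measures_on (region sh)"
  shows "mexp \<mu> (g * kernel_poly k B) = frob (num_mindices TYPE('d) k) (gram k g \<mu>) B"
proof -
  let ?m = "mpoly_deg g + 2 * k"
  have "mpoly_deg (g * kernel_poly k B) \<le> ?m"
    by (intro mpoly_deg_mult mpoly_deg_kernel_poly) simp
  then have "mexp \<mu> (g * kernel_poly k B) = pseudo_functional (moments ?m \<mu>) (g * kernel_poly k B)"
    by (rule mexp_eq_pseudo_functional[OF \<mu>, symmetric])
  also have "\<dots> = frob (num_mindices TYPE('d) k) (gram k g \<mu>) B"
    by (simp add: pseudo_functional_kernel_poly gram_eq_localizing_mat[OF \<mu>])
  finally show ?thesis .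
qed

lemma frob_inverse:
  assumes "B \<in> carrier_mat s s" "M \<in> carrier_mat s s" "transpose_mat M = M" "B * M = 1\<^sub>m s"
  shows "frob s M B = real s"
proof -
  have "(\<Sum>j<s. M $$ (i, j) * B $$ (i, j)) = 1" if i: "i < s" for i
  proof -
    have sym: "M $$ (i, j) = M $$ (j, i)" if "j < s" for j
      using assms(2,3) i that by (metis index_transpose_mat(1) carrier_matD)
    have "(B * M) $$ (i, i) = (\<Sum>j<s. B $$ (i, j) * M $$ (j, i))"
      using assms(1,2) i by (auto simp: scalar_prod_def atLeast0LessThan intro!: sum.cong)
    also have "\<dots> = (\<Sum>j<s. M $$ (i, j) * B $$ (i, j))"
      by (intro sum.cong refl) (simp add: sym)
    finally show ?thesis using assms(4) i by simp
  qed
  then show ?thesis by (simp add: frob_def)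
qed

lemma frob_commute: "frob s A B = frob s B A"
  by (simp add: frob_def mult.commute)

lemma pdiff_zero [simp]: "pdiff j 0 = 0"
  by (simp add: pdiff_deg0)

lemma pdiff_sum: "pdiff j (\<Sum>i\<in>I. p i) = (\<Sum>i\<in>I. pdiff j (p i))"
  by (induction I rule: infinite_finite_induct) (simp_all add: pdiff_add)

lemma gen_union_disjoint:
  "A \<inter> B = {} \<Longrightarrow> gen sh (A \<union> B) = gen sh A * gen sh (B :: 'd::finite option set)"
  "A \<inter> B = {} \<Longrightarrow> gen_deg sh (A \<union> B) = gen_deg sh A + gen_deg sh (B :: 'd::finite option set)"
  by (simp_all add: gen_def gen_deg_def prod.union_disjoint card_Un_disjoint distrib_left)

text \<open>
  The degree \<open>n - d_g\<close> for the generator g of an index set.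
\<close>

definition kernel_order :: "shape \<Rightarrow> nat \<Rightarrow> 'd option set \<Rightarrow> nat" where
  "kernel_order sh n B = n - gen_deg sh B div 2"

text \<open>
  For each direction j, exchanging the factors of \<open>a_j\<close> is an involution of the index sets.  It maps the
  derivative of a summand to its negative, so the derivative of the sum equals its own negative.  The
  exchange leaves \<open>gen_index\<close> only if the generator has degree 2n and no factor of \<open>a_j\<close>; then
  the kernel has degree 0 and the summand does not depend on \<open>x_j\<close>.
\<close>

lemma partition_of_unity_gen:
  fixes Q :: "'d::finite option set \<Rightarrow> real mat" and sh :: shape and n :: nat
  defines "k \<equiv> kernel_order sh n"
  defines "s \<equiv> (\<lambda>B. num_mindices TYPE('d) (k B))"
  assumes Q: "\<And>B. B \<in> gen_index sh n \<Longrightarrow> Q B \<in> carrier_mat (s B) (s B)"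
    "\<And>B. B \<in> gen_index sh n \<Longrightarrow> transpose_mat (Q B) = Q B"
    "\<And>B. B \<in> gen_index sh n \<Longrightarrow> Q B * gram (k B) (gen sh B) (equil sh) = 1\<^sub>m (s B)"
  shows "(\<Sum>B\<in>gen_index sh n. gen sh B * kernel_poly (k B) (Q B)) =
    Poly_Mapping.single 0 (\<Sum>B\<in>gen_index sh n. real (s B))"
proof -
  let ?I = "gen_index sh n :: 'd option set set"
  define P where "P = (\<Sum>B\<in>?I. gen sh B * kernel_poly (k B) (Q B))"
  have \<phi>: "(equil sh :: (real^'d) measure) \<in> prob_measures_on (region sh)" by (rule equil_in_prob_measures_on)
  have "pdiff j P = 0" for j
  proof (rule mpoly_eqI)
    fix x :: "real^'d"
    define f where "f B = mpoly_at (pdiff j (gen sh B * kernel_poly (k B) (Q B))) x" for B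
    define D where "D = flip sh j"
    define sd where "sd B = (B - D) \<union> (D - B)" for B
    \<comment> \<open>the exchange of factors, made total by fixing the index sets without a partner\<close>
    define \<tau> where "\<tau> B = (if sd B \<in> ?I then sd B else B)" for B
    have sd2: "sd (sd B) = B" for B by (auto simp: sd_def)
    have f\<tau>: "f (\<tau> B) = - f B" if B: "B \<in> ?I" for B
    proof -
      define R C C' where "R = B - D" and "C = B \<inter> D" and "C' = D - B"
      have decomp: "B = R \<union> C" "R \<inter> C = {}" "sd B = R \<union> C'" "R \<inter> C' = {}" "D = C \<union> C'" "C \<inter> C' = {}" "R \<inter> D = {}"
        by (auto simp: R_def C_def C'_def sd_def)
      have gB: "gen sh B = gen sh R * gen sh C" "gen_deg sh B = gen_deg sh R + gen_deg sh C"
        using gen_union_disjoint[OF decomp(2)] decomp(1) by simp_all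
      have gsd: "gen sh (sd B) = gen sh R * gen sh C'" "gen_deg sh (sd B) = gen_deg sh R + gen_deg sh C'"
        using gen_union_disjoint[OF decomp(4)] decomp(3) by simp_all
      have face: "face_poly sh j = gen sh C * gen sh C'" and two: "gen_deg sh C + gen_deg sh C' = 2"
        using gen_union_disjoint[OF decomp(6)] decomp(5) gen_deg_flip[of sh j]
        by (simp_all add: face_poly_eq_gen D_def[symmetric])
      have BF: "B \<subseteq> factors sh" using B by (simp add: gen_index_def)
      have RF: "R \<subseteq> factors sh" using BF by (auto simp: R_def)
      have sdF: "sd B \<subseteq> factors sh" using BF flip_subset[of sh j] by (auto simp: sd_def D_def)
      have sR: "pdiff j (gen sh R) = 0" using pdiff_gen_eq_0[OF RF] decomp(7) by (simp add: D_def)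
      have "even (gen_deg sh B)" "gen_deg sh B \<le> 2 * n" using B by (simp_all add: gen_index_def)
      then obtain m where "gen_deg sh B = 2 * m" by (elim evenE)
      then have m: "gen_deg sh R + gen_deg sh C = 2 * m" "m \<le> n"
        using gB(2) \<open>gen_deg sh B \<le> 2 * n\<close> by linarith+
      have kB: "k B = n - m" using m(1) gB(2) by (simp add: k_def kernel_order_def)
      show ?thesis
      proof (cases "sd B \<in> ?I")
        case True
        then have "even (gen_deg sh (sd B))" "gen_deg sh (sd B) \<le> 2 * n" by (simp_all add: gen_index_def)
        then obtain m' where "gen_deg sh (sd B) = 2 * m'" by (elim evenE)
        then have m': "gen_deg sh R + gen_deg sh C' = 2 * m'" "m' \<le> n"
          using gsd(2) \<open>gen_deg sh (sd B) \<le> 2 * n\<close> by linarith+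
        have ksd: "k (sd B) = n - m'" using m'(1) gsd(2) by (simp add: k_def kernel_order_def)
        have "mpoly_at (pdiff j (gen sh R * gen sh C * kernel_poly (k B) (Q B))) x +
          mpoly_at (pdiff j (gen sh R * gen sh C' * kernel_poly (k (sd B)) (Q (sd B)))) x = 0"
        proof (rule kernel_pair_cancel[OF face sR])
          show "mpoly_deg (gen sh C) \<le> gen_deg sh C" "mpoly_deg (gen sh C') \<le> gen_deg sh C'"
            by (rule mpoly_deg_gen)+
          show "k B + gen_deg sh C = k (sd B) + 1" "k (sd B) + gen_deg sh C' = k B + 1"
            using m m' two kB ksd by linarith+
        qed (use Q[OF B] Q[OF True] in \<open>simp_all add: s_def gB(1) gsd(1)\<close>)
        then show ?thesis using True by (simp add: f_def \<tau>_def gB(1) gsd(1))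
      next
        case False
        have e2: "even (gen_deg sh (sd B))"
        proof -
          have "gen_deg sh (sd B) + 2 * gen_deg sh C = 2 * m + 2" using gsd(2) m(1) two by linarith
          then show ?thesis by presburger
        qed
        then have "\<not> gen_deg sh (sd B) \<le> 2 * n" using False sdF by (simp add: gen_index_def)
        then have "m = n" "gen_deg sh C = 0" using gsd(2) m two by linarith+
        then have "C = {}" by (cases sh) (auto simp: gen_deg_def factor_deg_def)
        then have "pdiff j (gen sh B) = 0" using pdiff_gen_eq_0[OF BF] by (simp add: C_def D_def)
        moreover have "mpoly_deg (kernel_poly (k B) (Q B) :: 'd mpoly) = 0"
          using mpoly_deg_kernel_poly[of "k B" "Q B", where ?'d = 'd] kB \<open>m = n\<close> by simp
        then have "pdiff j (kernel_poly (k B) (Q B) :: 'd mpoly) = 0" by (rule pdiff_deg0)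
        ultimately have "f B = 0" by (simp add: f_def mpoly_at_pdiff_mult)
        then show ?thesis using False by (simp add: \<tau>_def)
      qed
    qed
    have "(\<Sum>B\<in>?I. f B) = (\<Sum>B\<in>?I. f (\<tau> B))"
      by (rule sum.reindex_bij_witness[of _ \<tau> \<tau>]) (auto simp: \<tau>_def sd2)
    also have "\<dots> = - (\<Sum>B\<in>?I. f B)" by (simp add: f\<tau> sum_negf)
    finally have "(\<Sum>B\<in>?I. f B) = 0" by simp
    then show "mpoly_at (pdiff j P) x = mpoly_at 0 x" by (simp add: P_def pdiff_sum f_def)
  qed
  then obtain c where c: "P = Poly_Mapping.single 0 c" by (rule mpoly_const)
  have "c = mexp (equil sh) P" by (simp only: c mexp_const[OF \<phi>])
  also have "\<dots> = (\<Sum>B\<in>?I. frob (s B) (gram (k B) (gen sh B) (equil sh)) (Q B))"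
    by (simp add: P_def mexp_sum[OF \<phi>] mexp_kernel_poly[OF \<phi>] s_def)
  also have "\<dots> = (\<Sum>B\<in>?I. real (s B))"
  proof (rule sum.cong[OF refl])
    fix B assume B: "B \<in> ?I"
    then have "psd_mat (s B) (gram (k B) (gen sh B) (equil sh))"
      unfolding s_def by (intro psd_gram[OF \<phi>] gen_nonneg) (auto simp: gen_index_def)
    then show "frob (s B) (gram (k B) (gen sh B) (equil sh)) (Q B) = real (s B)"
      by (intro frob_inverse Q[OF B] psd_matD)
  qed
  finally show ?thesis using c by (simp add: P_def)
qed

definition generator_inverse :: "shape \<Rightarrow> nat \<Rightarrow> 'd::finite mpoly \<Rightarrow> real mat" where
  "generator_inverse sh n g = the (mat_inverse (gram (n - half_deg g) g (equil sh)))"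

lemma gens_properties:
  fixes g :: "'d::finite mpoly"
  assumes n: "1 \<le> n" and g: "g \<in> gens sh n"
  defines "k \<equiv> n - half_deg g"
  defines "s \<equiv> num_mindices TYPE('d) k"
  defines "M \<equiv> gram k g (equil sh)"
  shows "\<And>x. x \<in> region sh \<Longrightarrow> 0 \<le> mpoly_at g x"
    and "mpoly_deg g + 2 * k \<le> 2 * n" and "psd_mat s M" and "0 < Determinant.det M"
    and "mat_inverse M = Some (generator_inverse sh n g)"
    and "M * generator_inverse sh n g = 1\<^sub>m s" "generator_inverse sh n g * M = 1\<^sub>m s"
    and "psd_mat s (generator_inverse sh n g)" and "0 < Determinant.det (generator_inverse sh n g)"
    and "ln (Determinant.det (generator_inverse sh n g)) = - ln (Determinant.det M)"
proof -
  obtain B where B: "B \<in> gen_index sh n" "g = gen sh B"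
    using g by (auto simp: gens_eq_gen_image[OF n])
  have BF: "B \<subseteq> factors sh" "even (gen_deg sh B)" "gen_deg sh B \<le> 2 * n" using B(1) by (auto simp: gen_index_def)
  show nn: "\<And>x. x \<in> region sh \<Longrightarrow> 0 \<le> mpoly_at g x" unfolding B(2) by (rule gen_nonneg[OF BF(1)])
  have "half_deg g = gen_deg sh B div 2" unfolding B(2) by (rule half_deg_gen[OF BF(1,2)])
  then show "mpoly_deg g + 2 * k \<le> 2 * n"
    using BF mpoly_deg_gen[of sh B] by (auto simp: k_def B(2) elim!: evenE)
  show psd: "psd_mat s M" unfolding M_def s_def by (rule psd_gram[OF equil_in_prob_measures_on nn])
  show det: "0 < Determinant.det M" unfolding M_def B(2) by (rule det_gram_pos[OF BF(1)])
  obtain C where C: "mat_inverse M = Some C" "M * C = 1\<^sub>m s" "C * M = 1\<^sub>m s" "C \<in> carrier_mat s s"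
    using mat_inverse_nonsingular[OF psd_matD(1)[OF psd]] det by (metis less_irrefl)
  have gi: "generator_inverse sh n g = C" using C(1) by (simp add: generator_inverse_def M_def k_def)
  show "mat_inverse M = Some (generator_inverse sh n g)" "M * generator_inverse sh n g = 1\<^sub>m s"
    "generator_inverse sh n g * M = 1\<^sub>m s" using C gi by simp_all
  show "psd_mat s (generator_inverse sh n g)" unfolding gi by (rule psd_mat_inverse(1)[OF psd C(2,4)])
  have d: "Determinant.det (generator_inverse sh n g) * Determinant.det M = 1"
    unfolding gi by (rule psd_mat_inverse(2)[OF psd C(2,4)])
  then have "0 < Determinant.det (generator_inverse sh n g) * Determinant.det M" by simp
  then show dp: "0 < Determinant.det (generator_inverse sh n g)"
    using det by (rule zero_less_mult_pos2)
  show "ln (Determinant.det (generator_inverse sh n g)) = - ln (Determinant.det M)"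
    using ln_mult[of "Determinant.det (generator_inverse sh n g)" "Determinant.det M"] d dp det by simp
qed

lemma partition_of_unity:
  assumes n: "1 \<le> n"
  shows "(\<Sum>g\<in>(gens sh n :: 'd::finite mpoly set). g * kernel_poly (n - half_deg g) (generator_inverse sh n g)) =
    Poly_Mapping.single 0 (real (total_size TYPE('d) sh n))"
proof -
  let ?I = "gen_index sh n :: 'd option set set"
  have inj: "inj_on (gen sh) ?I"
    by (rule inj_on_subset[OF inj_on_gen]) (auto simp: gen_index_def)
  have k: "n - half_deg (gen sh B) = kernel_order sh n B" if "B \<in> ?I" for B
    using that half_deg_gen[of B sh] by (simp add: kernel_order_def gen_index_def)
  have mem: "gen sh B \<in> gens sh n" if "B \<in> ?I" for B using that by (simp add: gens_eq_gen_image[OF n])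
  have "(\<Sum>B\<in>?I. gen sh B * kernel_poly (kernel_order sh n B) (generator_inverse sh n (gen sh B))) =
    Poly_Mapping.single 0 (\<Sum>B\<in>?I. real (num_mindices TYPE('d) (kernel_order sh n B)))"
  proof (rule partition_of_unity_gen)
    fix B assume B: "B \<in> ?I"
    note p = gens_properties[OF n mem[OF B]]
    show "generator_inverse sh n (gen sh B) \<in> carrier_mat (num_mindices TYPE('d) (kernel_order sh n B)) (num_mindices TYPE('d) (kernel_order sh n B))"
      "transpose_mat (generator_inverse sh n (gen sh B)) = generator_inverse sh n (gen sh B)"
      "generator_inverse sh n (gen sh B) * gram (kernel_order sh n B) (gen sh B) (equil sh) = 1\<^sub>m (num_mindices TYPE('d) (kernel_order sh n B))"
      using psd_matD(1,2)[OF p(8)] p(7) by (simp_all add: k[OF B])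
  qed
  moreover have "(\<Sum>g\<in>(gens sh n :: 'd mpoly set). g * kernel_poly (n - half_deg g) (generator_inverse sh n g)) =
      (\<Sum>B\<in>?I. gen sh B * kernel_poly (kernel_order sh n B) (generator_inverse sh n (gen sh B)))"
    unfolding gens_eq_gen_image[OF n] by (subst sum.reindex[OF inj]) (auto simp: k intro!: sum.cong)
  moreover have "real (total_size TYPE('d) sh n) = (\<Sum>B\<in>?I. real (num_mindices TYPE('d) (kernel_order sh n B)))"
    unfolding total_size_def gens_eq_gen_image[OF n] by (subst sum.reindex[OF inj]) (simp add: k)
  ultimately show ?thesis by simp
qed

lemma mindex_split:
  fixes \<alpha> :: "'d::finite mindex"
  assumes "m \<le> mindex_deg \<alpha>"
  shows "\<exists>\<beta> \<gamma>. \<alpha> = \<beta> + \<gamma> \<and> mindex_deg \<beta> = m"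
  using assms
proof (induction m)
  case 0
  show ?case by (intro exI[of _ 0] exI[of _ \<alpha>]) simp
next
  case (Suc m)
  then obtain \<beta> \<gamma> where bc: "\<alpha> = \<beta> + \<gamma>" "mindex_deg \<beta> = m" by auto
  then have "mindex_deg \<gamma> \<noteq> 0" using Suc.prems by (simp add: mindex_deg_add)
  then obtain j where "Poly_Mapping.lookup \<gamma> j \<noteq> 0" by (auto simp: mindex_deg_def)
  then have "\<gamma> - Poly_Mapping.single j 1 + Poly_Mapping.single j 1 = \<gamma>" by (rule mindex_diff_add_single)
  then have "\<alpha> = (\<beta> + Poly_Mapping.single j 1) + (\<gamma> - Poly_Mapping.single j 1)"
    unfolding bc(1) by (metis add.assoc add.commute)
  moreover have "mindex_deg (\<beta> + Poly_Mapping.single j 1) = Suc m" by (simp add: mindex_deg_add bc(2))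
  ultimately show ?case by blast
qed

text \<open>
  It follows that every pseudo-moment of degree at most 2n is an entry of the moment matrix of order n.
\<close>

lemma mindex_half_split:
  fixes \<alpha> :: "'d::finite mindex"
  assumes "\<alpha> \<in> mindices (2 * n)"
  obtains i j where "i < num_mindices TYPE('d) n" "j < num_mindices TYPE('d) n" "\<alpha> = mindex_enum n i + mindex_enum n j"
proof -
  have "\<exists>\<beta> \<gamma>. \<alpha> = \<beta> + \<gamma> \<and> mindex_deg \<beta> \<le> n \<and> mindex_deg \<gamma> \<le> n"
  proof (cases "mindex_deg \<alpha> \<le> n")
    case True
    then show ?thesis by (intro exI[of _ \<alpha>] exI[of _ 0]) simp
  next
    case False
    then obtain \<beta> \<gamma> where "\<alpha> = \<beta> + \<gamma>" "mindex_deg \<beta> = n" using mindex_split[of n \<alpha>] by auto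
    then show ?thesis using assms by (intro exI[of _ \<beta>] exI[of _ \<gamma>]) (simp add: mindices_def mindex_deg_add)
  qed
  then obtain \<beta> \<gamma> where bc: "\<alpha> = \<beta> + \<gamma>" "\<beta> \<in> mindices n" "\<gamma> \<in> mindices n" by (auto simp: mindices_def)
  then obtain i j where "i < num_mindices TYPE('d) n" "j < num_mindices TYPE('d) n" "\<beta> = mindex_enum n i" "\<gamma> = mindex_enum n j"
    unfolding bij_betw_imp_surj_on[OF bij_betw_mindex_enum[of n, where ?'d = 'd], symmetric] by auto
  then show ?thesis using that bc(1) by blast
qed

lemma one_in_gens: "1 \<le> n \<Longrightarrow> 1 \<in> gens sh n"
  using gens_eq_gen_image[of n sh] by (auto simp: gen_index_def gen_def gen_deg_def intro!: image_eqI[of _ _ "{}"])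

lemma half_deg_1 [simp]: "half_deg 1 = 0"
  by (simp add: half_deg_def)

section \<open>The optimization problems\<close>

definition optimal_value :: "'d::finite itself \<Rightarrow> shape \<Rightarrow> nat \<Rightarrow> real" where
  "optimal_value _ sh n = (\<Sum>g\<in>(gens sh n :: 'd mpoly set). ln (Determinant.det (gram (n - half_deg g) g (equil sh))))"

lemma sum_ln_det_generator_inverse:
  assumes "1 \<le> n"
  shows "(\<Sum>g\<in>(gens sh n :: 'd::finite mpoly set). ln (Determinant.det (generator_inverse sh n g))) = - optimal_value TYPE('d) sh n"
  using gens_properties(10)[OF assms, where ?'d = 'd] by (simp add: optimal_value_def sum_negf)

text \<open>
  Applying the functional to the partition of unity gives the trace condition of weak duality.
\<close>

lemma R_objective_bound:
  fixes y :: "'d::finite mindex \<Rightarrow> real"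
  assumes n: "1 \<le> n" and y: "R_feasible sh n y"
  shows "R_objective sh n y \<le> ereal (optimal_value TYPE('d) sh n)"
    and "R_objective sh n y = ereal (optimal_value TYPE('d) sh n) \<Longrightarrow> g \<in> gens sh n \<Longrightarrow>
      localizing_mat (n - half_deg g) g y = gram (n - half_deg g) g (equil sh)"
proof -
  let ?s = "\<lambda>g :: 'd mpoly. num_mindices TYPE('d) (n - half_deg g)"
  note p = gens_properties[OF n, where ?'d = 'd]
  have A: "psd_mat (?s g) (localizing_mat (n - half_deg g) g y)" if "g \<in> gens sh n" for g
    using y that by (simp add: R_feasible_def)
  have "pseudo_functional y 1 = 1" using y by (simp add: R_feasible_def)
  then have y0: "y 0 = 1" using pseudo_functional_single[of y 0 1] by simp
  have "(\<Sum>g\<in>gens sh n. frob (?s g) (localizing_mat (n - half_deg g) g y) (generator_inverse sh n g)) =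
    pseudo_functional y (\<Sum>g\<in>gens sh n. g * kernel_poly (n - half_deg g) (generator_inverse sh n g))"
    by (simp add: pseudo_functional_sum pseudo_functional_kernel_poly)
  also have "\<dots> = (\<Sum>g\<in>(gens sh n :: 'd mpoly set). real (?s g))"
    by (simp add: partition_of_unity[OF n] y0 total_size_def)
  finally have frob: "(\<Sum>g\<in>gens sh n. frob (?s g) (localizing_mat (n - half_deg g) g y) (generator_inverse sh n g)) =
    (\<Sum>g\<in>(gens sh n :: 'd mpoly set). real (?s g))" .
  note le = sum_log_det_le[OF finite_gens A p(8,9) frob, unfolded sum_ln_det_generator_inverse[OF n] minus_minus]
  show "R_objective sh n y \<le> ereal (optimal_value TYPE('d) sh n)"
    unfolding R_objective_def by (rule le(1))
  assume "R_objective sh n y = ereal (optimal_value TYPE('d) sh n)" and g: "g \<in> gens sh n"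
  then have eq: "localizing_mat (n - half_deg g) g y * generator_inverse sh n g = 1\<^sub>m (?s g)"
    unfolding R_objective_def by (intro le(2))
  let ?L = "localizing_mat (n - half_deg g) g y" and ?M = "gram (n - half_deg g) g (equil sh)" and ?C = "generator_inverse sh n g"
  note cL = psd_matD(1)[OF A[OF g]] and cC = psd_matD(1)[OF p(8)[OF g]] and cM = psd_matD(1)[OF p(3)[OF g]]
  have "?L = ?L * (?C * ?M)" using p(7)[OF g] cL by simp
  also have "\<dots> = (?L * ?C) * ?M" by (rule assoc_mult_mat[OF cL cC cM, symmetric])
  also have "\<dots> = ?M" unfolding eq by (rule left_mult_one_mat[OF cM])
  finally show "?L = ?M" .
qed

lemma R_feasible_moments:
  fixes \<mu> :: "(real^'d::finite) measure"
  assumes n: "1 \<le> n" and \<mu>: "\<mu> \<in> prob_measures_on (region sh)"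
  shows "R_feasible sh n (moments (2 * n) \<mu>)"
    and "R_objective sh n (moments (2 * n) \<mu>) = P_objective sh n \<mu>"
    and "\<And>g. g \<in> gens sh n \<Longrightarrow> moment_mat (n - half_deg g) (weighted g \<mu>) = gram (n - half_deg g) g \<mu>"
    and "\<And>g. g \<in> gens sh n \<Longrightarrow> localizing_mat (n - half_deg g) g (moments (2 * n) \<mu>) = gram (n - half_deg g) g \<mu>"
proof -
  note p = gens_properties[OF n, where ?'d = 'd]
  show 1: "moment_mat (n - half_deg g) (weighted g \<mu>) = gram (n - half_deg g) g \<mu>" if "g \<in> gens sh n" for g
    by (rule moment_mat_weighted_eq_gram[OF \<mu> p(1)[OF that]])
  show 2: "localizing_mat (n - half_deg g) g (moments (2 * n) \<mu>) = gram (n - half_deg g) g \<mu>" if "g \<in> gens sh n" for g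
    by (rule gram_eq_localizing_mat[OF \<mu> p(2)[OF that]])
  have "pseudo_functional (moments (2 * n) \<mu>) 1 = mexp \<mu> 1"
    by (rule mexp_eq_pseudo_functional[OF \<mu>]) simp
  also have "\<dots> = 1" using mexp_const[OF \<mu>, of 1] by simp
  finally have one: "pseudo_functional (moments (2 * n) \<mu>) 1 = 1" .
  have "psd_mat (num_mindices TYPE('d) (n - half_deg g)) (gram (n - half_deg g) g \<mu>)" if "g \<in> gens sh n" for g
    by (rule psd_gram[OF \<mu>]) (rule p(1)[OF that])
  moreover have "moments (2 * n) \<mu> \<in> extensional (mindices (2 * n))" by (simp add: moments_def)
  ultimately show "R_feasible sh n (moments (2 * n) \<mu>)"
    using one by (simp add: R_feasible_def 2)
  show "R_objective sh n (moments (2 * n) \<mu>) = P_objective sh n \<mu>"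
    by (simp add: R_objective_def P_objective_def 1 2)
qed

lemma R_objective_equil:
  assumes n: "1 \<le> n"
  shows "R_objective sh n (moments (2 * n) (equil sh :: (real^'d::finite) measure)) = ereal (optimal_value TYPE('d) sh n)"
proof -
  let ?\<phi> = "equil sh :: (real^'d) measure"
  have "R_objective sh n (moments (2 * n) ?\<phi>) = (\<Sum>g\<in>gens sh n. log_det (gram (n - half_deg g) g ?\<phi>))"
    unfolding R_objective_def
    by (intro sum.cong refl) (simp add: R_feasible_moments(4)[OF n equil_in_prob_measures_on])
  also have "\<dots> = ereal (\<Sum>g\<in>gens sh n. ln (Determinant.det (gram (n - half_deg g) g ?\<phi>)))"
    by (rule sum_log_det[OF finite_gens]) (rule gens_properties(4)[OF n])
  finally show ?thesis by (simp add: optimal_value_def)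
qed

lemma R_optimal_iff:
  fixes y :: "'d::finite mindex \<Rightarrow> real"
  assumes n: "1 \<le> n"
  shows "R_optimal sh n y \<longleftrightarrow> y = moments (2 * n) (equil sh)"
proof
  let ?y = "moments (2 * n) (equil sh) :: 'd mindex \<Rightarrow> real"
  note feas = R_feasible_moments[OF n equil_in_prob_measures_on[of sh, where ?'a = 'd]]
  {
    assume "y = ?y"
    then show "R_optimal sh n y"
      using feas(1) R_objective_bound(1)[OF n] R_objective_equil[OF n, of sh, where ?'d = 'd]
      by (auto simp: R_optimal_def is_arg_max_def not_less)
  }
  assume opt: "R_optimal sh n y"
  then have y: "R_feasible sh n y" by (simp add: R_optimal_def is_arg_max_def)
  have "\<not> R_objective sh n ?y > R_objective sh n y"
    using opt feas(1) by (auto simp: R_optimal_def is_arg_max_def)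
  then have "R_objective sh n y = ereal (optimal_value TYPE('d) sh n)"
    using R_objective_bound(1)[OF n y] R_objective_equil[OF n, of sh, where ?'d = 'd]
    by (intro antisym) (simp_all add: not_less)
  from R_objective_bound(2)[OF n y this one_in_gens[OF n]]
  have eq: "localizing_mat n 1 y = localizing_mat n 1 ?y"
    using feas(4)[OF one_in_gens[OF n]] by simp
  show "y = ?y"
  proof (rule extensionalityI[of _ "mindices (2 * n)"])
    show "y \<in> extensional (mindices (2 * n))" using y by (simp add: R_feasible_def)
    show "?y \<in> extensional (mindices (2 * n))" by (simp add: moments_def)
    fix \<alpha> :: "'d mindex" assume "\<alpha> \<in> mindices (2 * n)"
    then obtain i j where ij: "i < num_mindices TYPE('d) n" "j < num_mindices TYPE('d) n" "\<alpha> = mindex_enum n i + mindex_enum n j"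
      by (rule mindex_half_split)
    have entry: "localizing_mat n 1 z $$ (i, j) = z \<alpha>" for z
      using ij by (simp add: localizing_mat_def)
    show "y \<alpha> = ?y \<alpha>" using eq entry[of y] entry[of ?y] by simp
  qed
qed

lemma P_optimal_equil:
  assumes n: "1 \<le> n"
  shows "P_optimal sh n (equil sh :: (real^'d::finite) measure)"
  unfolding P_optimal_def is_arg_max_def
proof (intro conjI notI)
  let ?\<phi> = "equil sh :: (real^'d) measure"
  show \<phi>: "?\<phi> \<in> prob_measures_on (region sh)" by (rule equil_in_prob_measures_on)
  assume "\<exists>\<mu> :: (real^'d) measure. \<mu> \<in> prob_measures_on (region sh) \<and> P_objective sh n \<mu> > P_objective sh n ?\<phi>"
  then obtain \<mu> :: "(real^'d) measure" where \<mu>: "\<mu> \<in> prob_measures_on (region sh)" "P_objective sh n ?\<phi> < P_objective sh n \<mu>" by blast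
  have "P_objective sh n \<mu> \<le> ereal (optimal_value TYPE('d) sh n)"
    using R_objective_bound(1)[OF n R_feasible_moments(1)[OF n \<mu>(1)]] R_feasible_moments(2)[OF n \<mu>(1)] by simp
  moreover have "P_objective sh n ?\<phi> = ereal (optimal_value TYPE('d) sh n)"
    using R_objective_equil[OF n, of sh, where ?'d = 'd] R_feasible_moments(2)[OF n \<phi>] by simp
  ultimately show False using \<mu>(2) by simp
qed

lemma P_optimal_unique:
  fixes \<psi> :: "(real^'d::finite) measure"
  assumes n: "1 \<le> n" and opt: "P_optimal sh n \<psi>" and g: "g \<in> gens sh n"
  shows "moment_mat (n - half_deg g) (weighted g \<psi>) = moment_mat (n - half_deg g) (weighted g (equil sh))"
proof -
  have \<psi>: "\<psi> \<in> prob_measures_on (region sh)" using opt by (simp add: P_optimal_def is_arg_max_def)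
  have \<phi>: "(equil sh :: (real^'d) measure) \<in> prob_measures_on (region sh)" by (rule equil_in_prob_measures_on)
  note f = R_feasible_moments[OF n \<psi>]
  have "\<not> P_objective sh n (equil sh :: (real^'d) measure) > P_objective sh n \<psi>"
    using opt \<phi> by (auto simp: P_optimal_def is_arg_max_def)
  then have "R_objective sh n (moments (2 * n) \<psi>) = ereal (optimal_value TYPE('d) sh n)"
    using R_objective_bound(1)[OF n f(1)] R_objective_equil[OF n, of sh, where ?'d = 'd] f(2) R_feasible_moments(2)[OF n \<phi>]
    by (intro antisym) (simp_all add: not_less)
  from R_objective_bound(2)[OF n f(1) this g] show ?thesis
    using f(3,4)[OF g] R_feasible_moments(3)[OF n \<phi> g] by simp
qed

text \<open>
  Integrating the constraint gives the trace condition of weak duality.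
\<close>

lemma D_objective_bound:
  fixes A :: "'d::finite mpoly \<Rightarrow> real mat"
  assumes n: "1 \<le> n" and A: "D_feasible sh n A"
  shows "D_objective sh n A \<le> ereal (- optimal_value TYPE('d) sh n)"
    and "D_objective sh n A = ereal (- optimal_value TYPE('d) sh n) \<Longrightarrow> g \<in> gens sh n \<Longrightarrow> A g = generator_inverse sh n g"
proof -
  let ?s = "\<lambda>g :: 'd mpoly. num_mindices TYPE('d) (n - half_deg g)"
  note p = gens_properties[OF n, where ?'d = 'd]
  have \<phi>: "(equil sh :: (real^'d) measure) \<in> prob_measures_on (region sh)" by (rule equil_in_prob_measures_on)
  have psd: "psd_mat (?s g) (A g)" if "g \<in> gens sh n" for g
    using A that by (simp add: D_feasible_def)
  have "(\<Sum>g\<in>gens sh n. g * kernel_poly (n - half_deg g) (A g)) = Poly_Mapping.single 0 (real (total_size TYPE('d) sh n))"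
  proof (rule mpoly_eqI)
    fix x :: "real^'d"
    have "real (total_size TYPE('d) sh n) = (\<Sum>g\<in>gens sh n.
        scalar_prod (monom_vec (n - half_deg g) x) (A g *\<^sub>v monom_vec (n - half_deg g) x) * mpoly_at g x)"
      using A unfolding D_feasible_def by blast
    then show "mpoly_at (\<Sum>g\<in>gens sh n. g * kernel_poly (n - half_deg g) (A g)) x =
       mpoly_at (Poly_Mapping.single 0 (real (total_size TYPE('d) sh n))) x"
      using mpoly_at_kernel_poly[OF psd_matD(1)[OF psd]] by (simp add: mult.commute)
  qed
  then have "(\<Sum>g\<in>gens sh n. mexp (equil sh) (g * kernel_poly (n - half_deg g) (A g))) = real (total_size TYPE('d) sh n)"
    using mexp_sum[OF \<phi>] mexp_const[OF \<phi>] by metis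
  then have frob: "(\<Sum>g\<in>gens sh n. frob (?s g) (A g) (gram (n - half_deg g) g (equil sh))) = (\<Sum>g\<in>(gens sh n :: 'd mpoly set). real (?s g))"
    by (simp add: mexp_kernel_poly[OF \<phi>] frob_commute[of _ "A _"] total_size_def)
  note le = sum_log_det_le[OF finite_gens psd p(3,4) frob, folded optimal_value_def]
  show "D_objective sh n A \<le> ereal (- optimal_value TYPE('d) sh n)"
    unfolding D_objective_def optimal_value_def by (rule le(1)[unfolded optimal_value_def])
  assume "D_objective sh n A = ereal (- optimal_value TYPE('d) sh n)" and g: "g \<in> gens sh n"
  then have "A g * gram (n - half_deg g) g (equil sh) = 1\<^sub>m (?s g)"
    unfolding D_objective_def optimal_value_def by (intro sum_log_det_le(2)[OF finite_gens psd p(3,4) frob])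
  from mat_inverse_unique[OF psd_matD(1)[OF p(3)[OF g]] psd_matD(1)[OF psd[OF g]] this]
  show "A g = generator_inverse sh n g" using p(5)[OF g] by simp
qed

lemma D_optimal_iff:
  fixes A :: "'d::finite mpoly \<Rightarrow> real mat"
  assumes n: "1 \<le> n"
  shows "D_optimal sh n A \<longleftrightarrow> A = restrict (generator_inverse sh n) (gens sh n)"
proof
  let ?A = "restrict (generator_inverse sh n) (gens sh n) :: 'd mpoly \<Rightarrow> real mat"
  note p = gens_properties[OF n, where ?'d = 'd]
  have "real (total_size TYPE('d) sh n) = (\<Sum>g\<in>gens sh n.
        scalar_prod (monom_vec (n - half_deg g) x) (generator_inverse sh n g *\<^sub>v monom_vec (n - half_deg g) x) * mpoly_at g x)" for x :: "real^'d"
  proof -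
    have "mpoly_at (\<Sum>g\<in>gens sh n. g * kernel_poly (n - half_deg g) (generator_inverse sh n g)) x = real (total_size TYPE('d) sh n)"
      by (simp only: partition_of_unity[OF n] mpoly_at_single monom_at_0 mult_1_right)
    then show ?thesis using mpoly_at_kernel_poly[OF psd_matD(1)[OF p(8)]] by (simp add: mult.commute)
  qed
  then have feas: "D_feasible sh n ?A" using p(8) by (simp add: D_feasible_def)
  have val: "D_objective sh n ?A = ereal (- optimal_value TYPE('d) sh n)"
  proof -
    have "D_objective sh n ?A = (\<Sum>g\<in>(gens sh n :: 'd mpoly set). log_det (generator_inverse sh n g))"
      by (simp add: D_objective_def)
    also have "\<dots> = ereal (\<Sum>g\<in>(gens sh n :: 'd mpoly set). ln (Determinant.det (generator_inverse sh n g)))"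
      by (rule sum_log_det[OF finite_gens]) (rule p(9))
    finally show ?thesis by (simp add: sum_ln_det_generator_inverse[OF n])
  qed
  {
    assume "A = ?A"
    then show "D_optimal sh n A"
      using feas val D_objective_bound(1)[OF n] by (auto simp: D_optimal_def is_arg_max_def not_less)
  }
  assume opt: "D_optimal sh n A"
  then have A: "D_feasible sh n A" by (simp add: D_optimal_def is_arg_max_def)
  have "\<not> D_objective sh n ?A > D_objective sh n A"
    using opt feas by (auto simp: D_optimal_def is_arg_max_def)
  then have "D_objective sh n A = ereal (- optimal_value TYPE('d) sh n)"
    using D_objective_bound(1)[OF n A] val by (intro antisym) (simp_all add: not_less)
  then have "A g = ?A g" if "g \<in> gens sh n" for g using D_objective_bound(2)[OF n A _ that] that by simp
  moreover have "A \<in> extensional (gens sh n)" using A by (simp add: D_feasible_def)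
  ultimately show "A = ?A" by (intro extensionalityI[of _ "gens sh n"]) auto
qed

section \<open>Weak convergence of cubatures\<close>

lemma real_polynomial_function_is_mpoly:
  fixes f :: "real^'d::finite \<Rightarrow> real"
  assumes "real_polynomial_function f"
  shows "\<exists>p. \<forall>x. f x = mpoly_at p x"
  using assms
proof (induction rule: real_polynomial_function.induct)
  case (linear f)
  have "f x = mpoly_at (\<Sum>i\<in>UNIV. mpoly_var i * Poly_Mapping.single 0 (f (axis i 1))) x" for x
  proof -
    interpret bounded_linear f by fact
    have "f x = f (\<Sum>i\<in>UNIV. vec_nth x i *\<^sub>R axis i 1)"
      using basis_expansion[of x] by (simp add: scalar_mult_eq_scaleR)
    also have "\<dots> = (\<Sum>i\<in>UNIV. vec_nth x i * f (axis i 1))" by (simp add: sum scaleR)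
    finally show ?thesis by simp
  qed
  then show ?case by blast
next
  case (const c)
  show ?case by (rule exI[of _ "Poly_Mapping.single 0 c"]) simp
next
  case (add f g)
  then obtain p q where "\<forall>x. f x = mpoly_at p x" "\<forall>x. g x = mpoly_at q x" by blast
  then show ?case by (intro exI[of _ "p + q"]) simp
next
  case (mult f g)
  then obtain p q where "\<forall>x. f x = mpoly_at p x" "\<forall>x. g x = mpoly_at q x" by blast
  then show ?case by (intro exI[of _ "p * q"]) simp
qed

lemma mpoly_approximation:
  fixes f :: "real^'d::finite \<Rightarrow> real"
  assumes "compact S" "continuous_on S f" "0 < e"
  shows "\<exists>p. \<forall>x\<in>S. \<bar>f x - mpoly_at p x\<bar> < e"
proof -
  obtain g where "real_polynomial_function g" "\<And>x. x \<in> S \<Longrightarrow> \<bar>f x - g x\<bar> < e"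
    using Stone_Weierstrass_real_polynomial_function[OF assms] by blast
  then obtain p where "\<forall>x. g x = mpoly_at p x" using real_polynomial_function_is_mpoly[of g] by blast
  then have "\<forall>x\<in>S. \<bar>f x - mpoly_at p x\<bar> < e" using \<open>\<And>x. x \<in> S \<Longrightarrow> \<bar>f x - g x\<bar> < e\<close> by simp
  then show ?thesis by blast
qed

lemma set_integrable_prob_measures_on:
  fixes f :: "real^'d::finite \<Rightarrow> real"
  assumes \<mu>: "\<mu> \<in> prob_measures_on (region sh)" and f: "continuous_on (region sh) f"
  shows "integrable \<mu> (\<lambda>x. indicator (region sh) x * f x)"
proof -
  note m = prob_measures_onD[OF \<mu>]
  interpret prob_space \<mu> by (rule m(2))
  have "compact (f ` region sh)" using f compact_region by (rule compact_continuous_image)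
  then obtain C where C: "\<And>x. x \<in> region sh \<Longrightarrow> \<bar>f x\<bar> \<le> C"
    using compact_imp_bounded bounded_iff by (metis imageI real_norm_def)
  have C0: "0 \<le> C" using C region_nonempty[of sh, where ?'d = 'd] by force
  show ?thesis
  proof (rule integrable_const_bound)
    show "AE x in \<mu>. norm (indicator (region sh) x * f x) \<le> C"
      using C C0 by (auto simp: indicator_def)
    have "(\<lambda>x. indicator (region sh) x *\<^sub>R f x) \<in> borel_measurable borel"
      using region_borel f by (rule borel_measurable_continuous_on_indicator)
    then show "(\<lambda>x. indicator (region sh) x * f x) \<in> borel_measurable \<mu>"
      by (subst measurable_cong_sets[OF m(1) refl]) simp
  qed
qed

lemma set_integral_approximation:
  fixes f :: "real^'d::finite \<Rightarrow> real"
  assumes \<mu>: "\<mu> \<in> prob_measures_on (region sh)" and f: "continuous_on (region sh) f"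
    and p: "\<And>x. x \<in> region sh \<Longrightarrow> \<bar>f x - mpoly_at p x\<bar> \<le> e"
  shows "\<bar>(LINT x:region sh|\<mu>. f x) - mexp \<mu> p\<bar> \<le> e"
proof -
  note m = prob_measures_onD[OF \<mu>]
  interpret prob_space \<mu> by (rule m(2))
  have fi: "integrable \<mu> (\<lambda>x. indicator (region sh) x * f x)" by (rule set_integrable_prob_measures_on[OF \<mu> f])
  have pi: "integrable \<mu> (mpoly_at p)" by (rule integrable_mpoly[OF \<mu>])
  have "(LINT x:region sh|\<mu>. f x) - mexp \<mu> p = (\<integral>x. indicator (region sh) x * f x - mpoly_at p x \<partial>\<mu>)"
    using fi pi by (simp add: set_lebesgue_integral_def mexp_def)
  also have "\<bar>\<dots>\<bar> \<le> (\<integral>x. \<bar>indicator (region sh) x * f x - mpoly_at p x\<bar> \<partial>\<mu>)"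
    by (rule integral_abs_bound)
  also have "\<dots> \<le> (\<integral>x. e \<partial>\<mu>)"
  proof (rule integral_mono_AE)
    show "integrable \<mu> (\<lambda>x. \<bar>indicator (region sh) x * f x - mpoly_at p x\<bar>)" using fi pi by auto
    show "AE x in \<mu>. \<bar>indicator (region sh) x * f x - mpoly_at p x\<bar> \<le> e"
      using AE_prob_measures_on[OF \<mu> region_borel] by eventually_elim (simp add: p)
  qed simp
  finally show ?thesis by (simp add: prob_space)
qed

lemma cubature_in_prob_measures_on:
  assumes "is_cubature sh n \<nu>"
  shows "\<nu> \<in> prob_measures_on (region sh)"
proof -
  obtain m X \<gamma> where X: "X ` {..<m} \<subseteq> region sh" "\<nu> = atomic_measure m X \<gamma>" and "prob_space \<nu>"
    using assms by (auto simp: is_cubature_def)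
  have "emeasure \<nu> (- region sh) = 0"
    unfolding X(2) using X(1) by (subst emeasure_atomic_measure) (auto simp: region_borel)
  then show ?thesis using \<open>prob_space \<nu>\<close> by (simp add: prob_measures_on_def X(2))
qed

lemma mexp_cong_moments:
  fixes \<mu> \<nu> :: "(real^'d::finite) measure"
  assumes \<mu>: "\<mu> \<in> prob_measures_on (region sh)" and \<nu>: "\<nu> \<in> prob_measures_on (region sh)"
    and eq: "\<And>\<alpha>. \<alpha> \<in> mindices k \<Longrightarrow> (\<integral>x. monom_at \<alpha> x \<partial>\<nu>) = (\<integral>x. monom_at \<alpha> x \<partial>\<mu>)"
    and p: "mpoly_deg p \<le> k"
  shows "mexp \<nu> p = mexp \<mu> p"
proof -
  have "moments k \<nu> = moments k \<mu>" by (auto simp: moments_def fun_eq_iff restrict_def eq)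
  then show ?thesis using mexp_eq_pseudo_functional[OF \<mu> p] mexp_eq_pseudo_functional[OF \<nu> p] by simp
qed

text \<open>
  On polynomials the integrals agree with the limit from some index on, and polynomials are uniformly
  dense in the continuous functions on the region.
\<close>

lemma cubature_weak_convergence:
  fixes \<nu> :: "nat \<Rightarrow> (real^'d::finite) measure" and f :: "real^'d \<Rightarrow> real"
  assumes \<nu>: "\<And>k. 1 \<le> k \<Longrightarrow> is_cubature sh k (\<nu> k)" and f: "continuous_on (region sh) f"
  shows "(\<lambda>k. LINT x:region sh|\<nu> k. f x) \<longlonglongrightarrow> (LINT x:region sh|equil sh. f x)"
proof (rule LIMSEQ_I)
  fix r :: real assume r: "0 < r"
  have \<phi>: "(equil sh :: (real^'d) measure) \<in> prob_measures_on (region sh)" by (rule equil_in_prob_measures_on)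
  from mpoly_approximation[OF compact_region f, of "r / 3"] r
  obtain p where p: "\<forall>x\<in>region sh. \<bar>f x - mpoly_at p x\<bar> < r / 3" by auto
  then have p': "\<bar>f x - mpoly_at p x\<bar> \<le> r / 3" if "x \<in> region sh" for x using that by (simp add: less_imp_le)
  show "\<exists>N. \<forall>k\<ge>N. norm ((LINT x:region sh|\<nu> k. f x) - (LINT x:region sh|equil sh. f x)) < r"
  proof (intro exI[of _ "Suc (mpoly_deg p)"] allI impI)
    fix k assume k: "Suc (mpoly_deg p) \<le> k"
    then have cub: "is_cubature sh k (\<nu> k)" using \<nu> by simp
    have \<nu>k: "\<nu> k \<in> prob_measures_on (region sh)" by (rule cubature_in_prob_measures_on[OF cub])
    have "mexp (\<nu> k) p = mexp (equil sh) p"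
      by (rule mexp_cong_moments[OF \<phi> \<nu>k, of "2 * k"]) (use cub k in \<open>auto simp: is_cubature_def\<close>)
    then show "norm ((LINT x:region sh|\<nu> k. f x) - (LINT x:region sh|equil sh. f x)) < r"
      using set_integral_approximation[OF \<nu>k f p'] set_integral_approximation[OF \<phi> f p'] r
      unfolding real_norm_def by linarith
  qed
qed

section \<open>Vertices and the zeros of the generators\<close>

text \<open>
  A point with a coordinate in the open interval is the midpoint of two points of the box; conversely,
  strict convexity of the square excludes a proper segment through a point whose coordinates are \<open>\<plusminus> 1\<close>.
\<close>

lemma vertices_box:
  "vertices (region UnitBox :: (real^'d::finite) set) = {x. \<forall>j. (vec_nth x j)\<^sup>2 = 1}"
proof (intro equalityI subsetI CollectI allI)
  fix x :: "real^'d" and j assume "x \<in> vertices (region UnitBox)"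
  then have x: "x \<in> region UnitBox" and ext: "\<And>a b. a \<in> region UnitBox \<Longrightarrow> b \<in> region UnitBox \<Longrightarrow> x \<notin> open_segment a b"
    by (auto simp: vertices_def extreme_point_of_def)
  show "(vec_nth x j)\<^sup>2 = 1"
  proof (rule ccontr)
    assume "(vec_nth x j)\<^sup>2 \<noteq> 1"
    then have "(vec_nth x j)\<^sup>2 < 1" using x by (auto simp: region_def less_le)
    then have xj: "\<bar>vec_nth x j\<bar> < 1" by (simp add: abs_square_less_1)
    define \<delta> where "\<delta> = 1 - \<bar>vec_nth x j\<bar>"
    have \<delta>: "0 < \<delta>" using xj by (simp add: \<delta>_def)
    have mem: "x + t *\<^sub>R axis j 1 \<in> region UnitBox" if "\<bar>t\<bar> \<le> \<delta>" for t
    proof -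
      have "0 \<le> 1 - (vec_nth (x + t *\<^sub>R axis j 1) i)\<^sup>2" for i
      proof (cases "i = j")
        case True
        have "\<bar>vec_nth x j + t\<bar> \<le> 1" using that by (auto simp: \<delta>_def)
        then have "(vec_nth x j + t)\<^sup>2 \<le> 1" by (simp add: abs_square_le_1)
        then show ?thesis unfolding True vec_nth_axis_shift(2) by simp
      next
        case False
        then show ?thesis using x unfolding vec_nth_axis_shift(1)[OF False] by (simp add: region_def)
      qed
      then show ?thesis by (simp add: region_def)
    qed
    have "x \<in> open_segment (x + (- \<delta>) *\<^sub>R axis j 1) (x + \<delta> *\<^sub>R axis j 1)"
      unfolding in_segment
    proof (intro conjI exI[of _ "1 / 2"])
      show "x + (- \<delta>) *\<^sub>R axis j 1 \<noteq> x + \<delta> *\<^sub>R axis j 1"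
      proof
        assume "x + (- \<delta>) *\<^sub>R axis j 1 = x + \<delta> *\<^sub>R axis j 1"
        then have "vec_nth (x + (- \<delta>) *\<^sub>R axis j 1) j = vec_nth (x + \<delta> *\<^sub>R axis j 1) j"
          by (rule arg_cong)
        then show False using \<delta> unfolding vec_nth_axis_shift(2) by simp
      qed
      show "x = (1 - 1 / 2) *\<^sub>R (x + (- \<delta>) *\<^sub>R axis j 1) + (1 / 2) *\<^sub>R (x + \<delta> *\<^sub>R axis j 1)"
        by (simp add: algebra_simps flip: scaleR_left.add)
    qed auto
    then show False using ext mem[of "- \<delta>"] mem[of \<delta>] \<delta> by simp
  qed
next
  fix x :: "real^'d" assume "x \<in> {x. \<forall>j. (vec_nth x j)\<^sup>2 = 1}"
  then have x: "(vec_nth x j)\<^sup>2 = 1" for j by simp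
  show "x \<in> vertices (region UnitBox)"
    unfolding vertices_def extreme_point_of_def
  proof (intro CollectI conjI ballI notI)
    show "x \<in> region UnitBox" by (simp add: region_def x)
    fix a b :: "real^'d" assume a: "a \<in> region UnitBox" and b: "b \<in> region UnitBox" and "x \<in> open_segment a b"
    then obtain u where ne: "a \<noteq> b" and u: "0 < u" "u < 1" "x = (1 - u) *\<^sub>R a + u *\<^sub>R b"
      by (auto simp: in_segment)
    have "vec_nth a j = vec_nth b j" for j
    proof (rule ccontr)
      assume nej: "vec_nth a j \<noteq> vec_nth b j"
      define p q where "p = vec_nth a j" and "q = vec_nth b j"
      have "p\<^sup>2 \<le> 1" "q\<^sup>2 \<le> 1" using a b by (auto simp: region_def p_def q_def)
      have "1 = ((1 - u) * p + u * q)\<^sup>2" using x[of j] by (simp add: u(3) p_def q_def)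
      also have "\<dots> = (1 - u) * p\<^sup>2 + u * q\<^sup>2 - u * (1 - u) * (p - q)\<^sup>2"
        by (simp add: power2_eq_square algebra_simps)
      also have "\<dots> < (1 - u) * p\<^sup>2 + u * q\<^sup>2"
        using nej u by (simp add: p_def q_def)
      also have "\<dots> \<le> (1 - u) * 1 + u * 1"
        using u \<open>p\<^sup>2 \<le> 1\<close> \<open>q\<^sup>2 \<le> 1\<close> by (intro add_mono mult_left_mono) auto
      finally show False by simp
    qed
    then show False using ne by (simp add: Finite_Cartesian_Product.vec_eq_iff)
  qed
qed

lemma card_vertices_box: "card (vertices (region UnitBox :: (real^'d::finite) set)) = 2 ^ CARD('d)"
proof -
  let ?F = "(UNIV :: 'd set) \<rightarrow>\<^sub>E {-1, 1 :: real}"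
  have "vertices (region UnitBox :: (real^'d) set) = (\<lambda>f. \<chi> j. f j) ` ?F"
  proof (intro equalityI subsetI)
    fix x :: "real^'d" assume "x \<in> vertices (region UnitBox)"
    then have "vec_nth x j = 1 \<or> vec_nth x j = -1" for j by (simp add: vertices_box power2_eq_1_iff)
    then have "vec_nth x \<in> ?F" by (auto simp: PiE_UNIV_domain)
    then show "x \<in> (\<lambda>f. \<chi> j. f j) ` ?F" by (intro image_eqI[of _ _ "vec_nth x"]) auto
  next
    fix x :: "real^'d" assume "x \<in> (\<lambda>f. \<chi> j. f j) ` ?F"
    then obtain f where f: "f \<in> ?F" "x = (\<chi> j. f j)" by blast
    have "f j = -1 \<or> f j = 1" for j using PiE_mem[OF f(1), of j] by simp
    then have "(f j)\<^sup>2 = 1" for j by (auto simp: power2_eq_1_iff)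
    then show "x \<in> vertices (region UnitBox)" by (simp add: vertices_box f(2))
  qed
  moreover have "inj_on (\<lambda>f. (\<chi> j. f j) :: real^'d) ?F" by (rule inj_onI) (simp add: Finite_Cartesian_Product.vec_eq_iff fun_eq_iff)
  ultimately have "card (vertices (region UnitBox :: (real^'d) set)) = card ?F" by (simp add: card_image)
  also have "\<dots> = 2 ^ CARD('d)" by (subst card_PiE) (auto simp: numeral_2_eq_2)
  finally show ?thesis .
qed

lemma vertices_simplex: "vertices (region UnitSimplex :: (real^'d::finite) set) = insert 0 Basis"
proof -
  have "\<not> affine_dependent (insert 0 (Basis :: (real^'d) set))"
    using independent_Basis[where ?'a = "real^'d"]
    by (subst affine_dependent_iff_dependent) (auto simp: nonzero_Basis)
  then show ?thesis
    unfolding vertices_def region_simplex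
    by (auto simp: extreme_point_of_convex_hull_affine_independent)
qed

lemma card_vertices_simplex: "card (vertices (region UnitSimplex :: (real^'d::finite) set)) = CARD('d) + 1"
proof -
  have "0 \<notin> (Basis :: (real^'d) set)" using nonzero_Basis by blast
  then show ?thesis by (simp add: vertices_simplex)
qed

lemma gen_eq_1_iff:
  assumes "B \<subseteq> factors sh"
  shows "gen sh B = 1 \<longleftrightarrow> B = {}"
proof -
  have "gen sh B = gen sh {} \<longleftrightarrow> B = {}"
    using inj_on_eq_iff[OF inj_on_gen[of sh], of B "{}"] assms by simp
  then show ?thesis by (simp add: gen_def)
qed

text \<open>
  The generators other than 1 include the single factor (ball), each factor (box), or each product of two
  factors (simplex), and all of them are multiples of these.
\<close>

lemma contact_set:
  fixes x :: "real^'d::finite"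
  assumes n: "1 \<le> n" and x: "x \<in> region sh"
  shows "(\<forall>g\<in>gens sh n - {1}. mpoly_at g x = 0) \<longleftrightarrow>
    (case sh of UnitBall \<Rightarrow> x \<in> frontier (region sh) | UnitBox \<Rightarrow> x \<in> vertices (region sh) | UnitSimplex \<Rightarrow> x \<in> vertices (region sh))"
proof -
  define Z where "Z b \<longleftrightarrow> mpoly_at (factor sh b) x = 0" for b
  have *: "(\<forall>g\<in>gens sh n - {1}. mpoly_at g x = 0) \<longleftrightarrow> (\<forall>B\<in>gen_index sh n - {{}}. \<exists>b\<in>B. Z b)"
  proof -
    have eq: "gens sh n - {1} = gen sh ` (gen_index sh n - {{}})"
      using gen_eq_1_iff[of _ sh] by (auto simp: gens_eq_gen_image[OF n] gen_index_def)
    show ?thesis unfolding eq by (simp add: mpoly_at_gen Z_def)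
  qed
  show ?thesis
  proof (cases sh)
    case UnitBall
    have "(gen_index sh n :: 'd option set set) = {{}, {None}}"
      using n by (auto simp: UnitBall gen_index_def gen_deg_def factor_deg_def factors_def)
    then have "(\<forall>g\<in>gens sh n - {1}. mpoly_at g x = 0) \<longleftrightarrow> Z None" unfolding * by auto
    also have "\<dots> \<longleftrightarrow> norm x = 1"
    proof -
      have "(norm x)\<^sup>2 = (\<Sum>i\<in>UNIV. (vec_nth x i)\<^sup>2)"
        unfolding power2_norm_eq_inner inner_vec_def by (simp add: power2_eq_square)
      then have "Z None \<longleftrightarrow> (norm x)\<^sup>2 = 1" by (auto simp: Z_def UnitBall factor_def)
      also have "\<dots> \<longleftrightarrow> norm x = 1" using norm_ge_zero[of x] unfolding power2_eq_1_iff by linarith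
      finally show ?thesis .
    qed
    finally show ?thesis by (simp add: UnitBall region_ball)
  next
    case UnitBox
    have "(\<forall>B\<in>gen_index sh n - {{}}. \<exists>b\<in>B. Z b) \<longleftrightarrow> (\<forall>j. Z (Some j))"
    proof
      assume a: "\<forall>B\<in>gen_index sh n - {{}}. \<exists>b\<in>B. Z b"
      show "\<forall>j. Z (Some j)"
      proof
        fix j :: 'd
        have "{Some j} \<in> gen_index sh n - {{}}"
          using n by (auto simp: UnitBox gen_index_def gen_deg_def factor_deg_def factors_def)
        from bspec[OF a this] show "Z (Some j)" by simp
      qed
    next
      assume a: "\<forall>j. Z (Some j)"
      show "\<forall>B\<in>gen_index sh n - {{}}. \<exists>b\<in>B. Z b"
        using a by (force simp: UnitBox gen_index_def factors_def)
    qed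
    also have "\<dots> \<longleftrightarrow> (\<forall>j. (vec_nth x j)\<^sup>2 = 1)" by (auto simp: Z_def UnitBox factor_def)
    finally show ?thesis unfolding * by (simp add: UnitBox vertices_box)
  next
    case UnitSimplex
    have "(\<forall>B\<in>gen_index sh n - {{}}. \<exists>b\<in>B. Z b) \<longleftrightarrow> (\<forall>b b'. b \<noteq> b' \<longrightarrow> Z b \<or> Z b')"
    proof
      assume a: "\<forall>B\<in>gen_index sh n - {{}}. \<exists>b\<in>B. Z b"
      show "\<forall>b b'. b \<noteq> b' \<longrightarrow> Z b \<or> Z b'"
      proof (intro allI impI)
        fix b b' :: "'d option" assume "b \<noteq> b'"
        then have "{b, b'} \<in> gen_index sh n - {{}}"
          using n by (auto simp: UnitSimplex gen_index_def gen_deg_def factor_deg_def factors_def)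
        from bspec[OF a this] show "Z b \<or> Z b'" by auto
      qed
    next
      assume a: "\<forall>b b'. b \<noteq> b' \<longrightarrow> Z b \<or> Z b'"
      show "\<forall>B\<in>gen_index sh n - {{}}. \<exists>b\<in>B. Z b"
      proof
        fix B :: "'d option set" assume B: "B \<in> gen_index sh n - {{}}"
        then have ev: "even (card B)" by (simp add: UnitSimplex gen_index_def gen_deg_def factor_deg_def)
        obtain b where b: "b \<in> B" using B by blast
        obtain b' where "b' \<in> B" "b' \<noteq> b"
        proof -
          have "B \<noteq> {b}" using ev by auto
          then show thesis using that b by blast
        qed
        then show "\<exists>b\<in>B. Z b" using a b by blast
      qed
    qed
    also have "\<dots> \<longleftrightarrow> x \<in> insert 0 Basis"
    proof
      assume a: "\<forall>b b'. b \<noteq> b' \<longrightarrow> Z b \<or> Z b'"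
      have ZS: "Z (Some j) \<longleftrightarrow> vec_nth x j = 0" and ZN: "Z None \<longleftrightarrow> (\<Sum>i\<in>UNIV. vec_nth x i) = 1" for j
        by (auto simp: Z_def UnitSimplex factor_def)
      show "x \<in> insert 0 Basis"
      proof (cases "\<exists>j. \<not> Z (Some j)")
        case False
        then have "x = 0" by (simp add: ZS Finite_Cartesian_Product.vec_eq_iff)
        then show ?thesis by simp
      next
        case True
        then obtain j where j: "\<not> Z (Some j)" by blast
        have "Z None" using a[rule_format, of None "Some j"] j by simp
        have z: "vec_nth x i = 0" if "i \<noteq> j" for i
          using a[rule_format, of "Some i" "Some j"] j that ZS[of i] by simp
        have "(\<Sum>i\<in>UNIV. vec_nth x i) = 1" using \<open>Z None\<close> by (simp add: ZN)
        moreover have "(\<Sum>i\<in>UNIV. vec_nth x i) = vec_nth x j"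
          using z by (subst sum.remove[of _ j]) auto
        ultimately have "x = axis j 1" using z by (auto simp: Finite_Cartesian_Product.vec_eq_iff axis_def)
        then show ?thesis by simp
      qed
    next
      assume "x \<in> insert 0 Basis"
      then consider "x = 0" | j where "x = axis j 1" by (auto simp: Basis_vec_def)
      then have "\<exists>b0. \<forall>b. b \<noteq> b0 \<longrightarrow> Z b"
      proof cases
        case 1
        then have "Z b" if "b \<noteq> None" for b using that by (cases b) (auto simp: Z_def UnitSimplex factor_def)
        then show ?thesis by blast
      next
        case (2 j)
        then have "Z b" if "b \<noteq> Some j" for b
          using that by (cases b) (auto simp: Z_def UnitSimplex factor_def axis_def)
        then show ?thesis by blast
      qed
      then show "\<forall>b b'. b \<noteq> b' \<longrightarrow> Z b \<or> Z b'" by metis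
    qed
    finally show ?thesis unfolding * by (simp add: UnitSimplex vertices_simplex)
  qed
qed

section \<open>Existence of cubatures and the maximum of the kernel\<close>

lemma mpoly_deg_vec_poly: "mpoly_deg (vec_poly k v :: 'd::finite mpoly) \<le> k"
  unfolding vec_poly_def by (intro mpoly_deg_sum mpoly_deg_single_le) (simp add: mindex_deg_enum)

text \<open>
  With fewer than \<open>s_n\<close> atoms there is a nonzero polynomial p of degree at most n that vanishes at all of
  them; then \<open>p^2\<close> has integral zero, which contradicts the nonsingularity of the moment matrix.
\<close>

lemma cubature_exists:
  assumes n: "1 \<le> n"
  shows "\<exists>\<nu> :: (real^'d::finite) measure. is_cubature sh n \<nu>"
proof -
  let ?\<phi> = "equil sh :: (real^'d) measure"
  let ?N = "num_mindices TYPE('d) (2 * n)" and ?s = "num_mindices TYPE('d) n"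
  have \<phi>: "?\<phi> \<in> prob_measures_on (region sh)" by (rule equil_in_prob_measures_on)
  define f where "f i = monom_at (mindex_enum (2 * n) i :: 'd mindex)" for i
  have surj: "mindex_enum (2 * n) ` {..<?N} = (mindices (2 * n) :: 'd mindex set)"
    using bij_betw_mindex_enum[of "2 * n", where ?'d = 'd] by (simp add: bij_betw_def)
  have "0 \<in> (mindices (2 * n) :: 'd mindex set)" by (simp add: mindices_def)
  then obtain i0 where i0: "i0 < ?N" "mindex_enum (2 * n) i0 = (0 :: 'd mindex)"
    unfolding surj[symmetric] by auto
  have one: "f i0 = (\<lambda>_. 1)" by (simp add: f_def i0(2) fun_eq_iff)
  have "\<exists>P w. finite P \<and> P \<subseteq> region sh \<and> card P \<le> ?N \<and> (\<forall>p\<in>P. 0 < w p) \<and>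
    (\<forall>i<?N. (\<Sum>p\<in>P. w p * f i p) = (\<integral>x. f i x \<partial>?\<phi>))"
    using prob_measures_onD[OF \<phi>] i0(1) one
    by (intro tchakaloff[of "region sh" ?\<phi> ?N f i0] compact_region convex_region region_nonempty)
       (auto simp: f_def intro: continuous_intros)
  then obtain P w where P: "finite P" "P \<subseteq> region sh" "card P \<le> ?N" "\<forall>p\<in>P. 0 < w p"
    "\<forall>i<?N. (\<Sum>p\<in>P. w p * f i p) = (\<integral>x. f i x \<partial>?\<phi>)" by (elim exE conjE)
  define m where "m = card P"
  define X where "X = from_nat_into P"
  define \<gamma> where "\<gamma> j = w (X j)" for j
  define \<nu> where "\<nu> = atomic_measure m X \<gamma>"
  have bij: "bij_betw X {..<m} P" unfolding X_def m_def by (rule bij_betw_from_nat_into_finite[OF P(1)])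
  have XP: "X j \<in> P" if "j < m" for j using bij_betwE[OF bij] that by simp
  have \<gamma>: "0 < \<gamma> j" if "j < m" for j using XP[OF that] P(4) by (simp add: \<gamma>_def)
  have int: "(\<integral>x. h x \<partial>\<nu>) = (\<Sum>p\<in>P. w p * h p)" if [measurable]: "h \<in> borel_measurable borel" for h
  proof -
    have "(\<integral>x. h x \<partial>\<nu>) = (\<Sum>j<m. \<gamma> j * h (X j))"
      unfolding \<nu>_def using \<gamma> by (intro integral_atomic_measure) (auto simp: less_imp_le)
    then show ?thesis using sum.reindex_bij_betw[OF bij, of "\<lambda>p. w p * h p"] by (simp add: \<gamma>_def)
  qed
  have moments: "(\<integral>x. monom_at \<alpha> x \<partial>\<nu>) = (\<integral>x. monom_at \<alpha> x \<partial>?\<phi>)" if \<alpha>: "\<alpha> \<in> mindices (2 * n)" for \<alpha>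
  proof -
    obtain i where "i < ?N" "\<alpha> = mindex_enum (2 * n) i" using \<alpha> unfolding surj[symmetric] by auto
    then show ?thesis using P(5) by (simp add: int f_def)
  qed
  have "(\<Sum>p\<in>P. w p) = 1"
    using P(5)[rule_format, OF i0(1)] prob_space.prob_space[OF prob_measures_onD(2)[OF \<phi>]]
    by (simp add: one)
  then have total: "(\<Sum>j<m. \<gamma> j) = 1" using sum.reindex_bij_betw[OF bij, of w] by (simp add: \<gamma>_def)
  have "(\<Sum>j<m. ennreal (\<gamma> j)) = ennreal 1"
    unfolding total[symmetric] by (rule sum_ennreal) (use \<gamma> in \<open>auto simp: less_imp_le\<close>)
  then have "emeasure \<nu> UNIV = 1"
    unfolding \<nu>_def by (subst emeasure_atomic_measure) auto
  then have prob: "prob_space \<nu>"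
    by (intro prob_spaceI) (simp add: \<nu>_def atomic_measure_def)
  have XR: "X j \<in> region sh" if "j < m" for j using XP[OF that] P(2) by blast
  have "(\<Sum>j<m. ennreal (\<gamma> j) * indicator (- region sh) (X j)) = 0"
    by (rule sum.neutral) (simp add: XR)
  then have carried: "emeasure \<nu> (- region sh) = 0"
    unfolding \<nu>_def by (subst emeasure_atomic_measure) (auto simp: region_borel)
  have \<nu>: "\<nu> \<in> prob_measures_on (region sh)"
    using prob carried by (simp add: prob_measures_on_def \<nu>_def)
  have "?s \<le> m"
  proof (rule ccontr)
    assume "\<not> ?s \<le> m"
    then have "m < ?s" by simp
    then obtain c where c: "\<exists>j<?s. c j \<noteq> 0"
      "\<And>i. i < m \<Longrightarrow> (\<Sum>j<?s. c j * monom_at (mindex_enum n j :: 'd mindex) (X i)) = 0"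
      using linear_dependence[of m ?s "\<lambda>i j. monom_at (mindex_enum n j :: 'd mindex) (X i)"] by metis
    define v where "v = Matrix.vec ?s c"
    have v: "v \<in> carrier_vec ?s" by (simp add: v_def)
    have v0: "v \<noteq> 0\<^sub>v ?s" using c(1) by (metis v_def index_vec index_zero_vec(1))
    let ?p = "vec_poly n v :: 'd mpoly"
    have zero: "mpoly_at ?p p = 0" if p: "p \<in> P" for p
    proof -
      obtain i where i: "i < m" "p = X i" using p bij by (auto simp: bij_betw_def)
      have "mpoly_at ?p p = (\<Sum>j<?s. c j * monom_at (mindex_enum n j :: 'd mindex) (X i))"
        by (simp add: vec_poly_def v_def i(2))
      then show ?thesis using c(2)[OF i(1)] by simp
    qed
    have "mpoly_deg (1 * (?p * ?p)) \<le> 0 + (n + n)"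
      by (intro mpoly_deg_mult mpoly_deg_vec_poly) simp
    then have "mexp ?\<phi> (1 * (?p * ?p)) = mexp \<nu> (1 * (?p * ?p))"
      using mexp_cong_moments[OF \<phi> \<nu> moments, where p = "1 * (?p * ?p)"] by simp
    also have "\<dots> = 0" unfolding mexp_def by (subst int) (simp_all add: zero)
    finally have "scalar_prod v (gram n 1 ?\<phi> *\<^sub>v v) = 0" using gram_quadratic_form[OF \<phi> v, of 1] by simp
    moreover have "0 < scalar_prod v (gram n 1 ?\<phi> *\<^sub>v v)"
      using gens_properties(3,4)[OF n one_in_gens[OF n, of sh, where ?'a = 'd]] v v0
      by (intro psd_mat_pos) auto
    ultimately show False by simp
  qed
  then have "is_cubature sh n \<nu>"
    unfolding is_cubature_def
  proof (intro conjI exI[of _ m] exI[of _ X] exI[of _ \<gamma>] prob ballI moments)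
    show "m \<le> ?N" using P(3) by (simp add: m_def)
    show "inj_on X {..<m}" using bij by (simp add: bij_betw_def)
    show "X ` {..<m} \<subseteq> region sh" using XP P(2) by auto
  qed (use \<gamma> \<nu>_def in auto)
  then show ?thesis by blast
qed

lemma weighted_1: "weighted 1 \<mu> = \<mu>"
  by (simp add: weighted_def density_1)

lemma cd_kernel_weighted_equil:
  fixes g :: "'d::finite mpoly"
  assumes n: "1 \<le> n" and g: "g \<in> gens sh n"
  shows "cd_kernel (n - half_deg g) (weighted g (equil sh)) x x =
    mpoly_at (kernel_poly (n - half_deg g) (generator_inverse sh n g)) x"
  using mpoly_at_kernel_poly[OF psd_matD(1)[OF gens_properties(8)[OF n g]], of x]
  by (simp add: cd_kernel_def R_feasible_moments(3)[OF n equil_in_prob_measures_on g] generator_inverse_def)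

lemma christoffel_darboux_identity:
  fixes x :: "real^'d::finite"
  assumes n: "1 \<le> n"
  shows "real (total_size TYPE('d) sh n) =
    (\<Sum>g\<in>gens sh n. cd_kernel (n - half_deg g) (weighted g (equil sh)) x x * mpoly_at g x)"
proof -
  have "(\<Sum>g\<in>gens sh n. cd_kernel (n - half_deg g) (weighted g (equil sh)) x x * mpoly_at g x) =
      mpoly_at (\<Sum>g\<in>gens sh n. g * kernel_poly (n - half_deg g) (generator_inverse sh n g)) x"
    by (simp add: cd_kernel_weighted_equil[OF n] mult.commute)
  also have "\<dots> = real (total_size TYPE('d) sh n)"
    by (simp only: partition_of_unity[OF n] mpoly_at_single monom_at_0 mult_1_right)
  finally show ?thesis ..
qed

lemma cd_kernel_pos:
  fixes g :: "'d::finite mpoly"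
  assumes n: "1 \<le> n" and g: "g \<in> gens sh n"
  shows "0 < cd_kernel (n - half_deg g) (weighted g (equil sh)) x x"
proof -
  let ?k = "n - half_deg g"
  note p = gens_properties[OF n g]
  have "0 \<in> (mindices ?k :: 'd mindex set)" by (simp add: mindices_def)
  then obtain i where i: "i < num_mindices TYPE('d) ?k" "mindex_enum ?k i = (0 :: 'd mindex)"
    unfolding bij_betw_imp_surj_on[OF bij_betw_mindex_enum[of ?k, where ?'d = 'd], symmetric] by auto
  have "vec_index (monom_vec ?k x) i = 1" using i by (simp add: monom_vec_def)
  then have "monom_vec ?k x \<noteq> 0\<^sub>v (num_mindices TYPE('d) ?k)" using i(1) by auto
  then have "0 < scalar_prod (monom_vec ?k x) (generator_inverse sh n g *\<^sub>v monom_vec ?k x)"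
    using p(8,9) by (intro psd_mat_pos) (auto simp: monom_vec_def)
  then show ?thesis
    using mpoly_at_kernel_poly[OF psd_matD(1)[OF p(8)], of x] by (simp add: cd_kernel_weighted_equil[OF n g])
qed

text \<open>
  The other summands of the partition of unity are products of a positive kernel and a generator that is
  nonnegative on the region.
\<close>

lemma cd_kernel_maximum:
  fixes x :: "real^'d::finite"
  assumes n: "1 \<le> n" and x: "x \<in> region sh"
  shows "cd_kernel n (equil sh) x x \<le> real (total_size TYPE('d) sh n)"
    and "cd_kernel n (equil sh) x x = real (total_size TYPE('d) sh n) \<longleftrightarrow> (\<forall>g\<in>gens sh n - {1}. mpoly_at g x = 0)"
proof -
  let ?K = "\<lambda>g. cd_kernel (n - half_deg g) (weighted g (equil sh)) x x"
  let ?r = "\<Sum>g\<in>gens sh n - {1}. ?K g * mpoly_at g x"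
  have eq: "real (total_size TYPE('d) sh n) = cd_kernel n (equil sh) x x + ?r"
    using christoffel_darboux_identity[OF n, of sh x] one_in_gens[OF n, of sh, where ?'a = 'd]
    by (simp add: sum.remove[OF finite_gens] weighted_1)
  have nn: "0 \<le> ?K g * mpoly_at g x" if "g \<in> gens sh n - {1}" for g
    using that cd_kernel_pos[OF n, of g sh x] gens_properties(1)[OF n _ x, of g] by simp
  then have r: "0 \<le> ?r" by (rule sum_nonneg)
  then show "cd_kernel n (equil sh) x x \<le> real (total_size TYPE('d) sh n)" using eq by simp
  have "cd_kernel n (equil sh) x x = real (total_size TYPE('d) sh n) \<longleftrightarrow> ?r = 0" using eq by linarith
  also have "\<dots> \<longleftrightarrow> (\<forall>g\<in>gens sh n - {1}. ?K g * mpoly_at g x = 0)"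
    using nn by (intro sum_nonneg_eq_0_iff) (auto simp: finite_gens)
  also have "\<dots> \<longleftrightarrow> (\<forall>g\<in>gens sh n - {1}. mpoly_at g x = 0)"
    using cd_kernel_pos[OF n, of _ sh x] by (metis DiffD1 less_irrefl mult_eq_0_iff)
  finally show "cd_kernel n (equil sh) x x = real (total_size TYPE('d) sh n) \<longleftrightarrow> (\<forall>g\<in>gens sh n - {1}. mpoly_at g x = 0)" .
qed

lemma contact_points_subset:
  "frontier (region UnitBall :: (real^'d::finite) set) \<subseteq> region UnitBall"
  "vertices S \<subseteq> S"
  by (auto simp: region_ball vertices_def extreme_point_of_def)

lemma contact_point_exists:
  "\<exists>x :: real^'d::finite. case sh of UnitBall \<Rightarrow> x \<in> frontier (region sh) | UnitBox \<Rightarrow> x \<in> vertices (region sh)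
     | UnitSimplex \<Rightarrow> x \<in> vertices (region sh)"
proof (cases sh)
  case UnitBall
  have "axis undefined 1 \<in> frontier (region UnitBall :: (real^'d) set)" by (simp add: region_ball)
  then show ?thesis using UnitBall by auto
next
  case UnitBox
  have "(\<chi> i. 1) \<in> vertices (region UnitBox :: (real^'d) set)" by (simp add: vertices_box)
  then show ?thesis using UnitBox by auto
next
  case UnitSimplex
  have "0 \<in> vertices (region UnitSimplex :: (real^'d) set)" by (simp add: vertices_simplex)
  then show ?thesis using UnitSimplex by auto
qed

theorem theorem1:
  fixes sh :: shape and n :: nat and \<phi> :: "(real^'d::finite) measure"
  assumes n: "n \<ge> 1"
    and \<phi>: "\<phi> = equil sh"
  shows
    "(P_optimal sh n \<phi> \<and>
      (\<forall>\<psi>. P_optimal sh n \<psi> \<longrightarrow> (\<forall>g\<in>gens sh n.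
         moment_mat (n - half_deg g) (weighted g \<psi>) = moment_mat (n - half_deg g) (weighted g \<phi>))) \<and>
      (\<forall>y. R_optimal sh n y \<longleftrightarrow> y = moments (2 * n) \<phi>))
   \<and> ((\<exists>!A :: 'd mpoly \<Rightarrow> real mat. D_optimal sh n A) \<and>
      (\<forall>A :: 'd mpoly \<Rightarrow> real mat. D_optimal sh n A \<longrightarrow> (\<forall>g\<in>gens sh n.
         mat_inverse (moment_mat (n - half_deg g) (weighted g \<phi>)) = Some (A g))) \<and>
      (\<forall>x :: real^'d.
         real (total_size TYPE('d) sh n) =
           (\<Sum>g\<in>gens sh n. inverse (christoffel (n - half_deg g) (weighted g \<phi>) x) * mpoly_at g x) \<and>
         real (total_size TYPE('d) sh n) =
           (\<Sum>g\<in>gens sh n. cd_kernel (n - half_deg g) (weighted g \<phi>) x x * mpoly_at g x)))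
   \<and> ((\<exists>\<nu> :: (real^'d) measure. is_cubature sh n \<nu>) \<and>
      (\<forall>x\<in>region sh. cd_kernel n \<phi> x x \<le> real (total_size TYPE('d) sh n)) \<and>
      (\<exists>x\<in>region sh. cd_kernel n \<phi> x x = real (total_size TYPE('d) sh n)) \<and>
      (case sh of
         UnitBall \<Rightarrow> \<forall>x\<in>frontier (region sh). cd_kernel n \<phi> x x = real (total_size TYPE('d) sh n)
       | UnitBox \<Rightarrow> {x\<in>region sh. cd_kernel n \<phi> x x = real (total_size TYPE('d) sh n)} = vertices (region sh) \<and>
           card (vertices (region sh :: (real^'d) set)) = 2 ^ CARD('d)
       | UnitSimplex \<Rightarrow> {x\<in>region sh. cd_kernel n \<phi> x x = real (total_size TYPE('d) sh n)} = vertices (region sh) \<and>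
           card (vertices (region sh :: (real^'d) set)) = CARD('d) + 1))
   \<and> (\<forall>\<nu> :: nat \<Rightarrow> (real^'d) measure. (\<forall>k\<ge>1. is_cubature sh k (\<nu> k)) \<longrightarrow>
        (\<forall>f :: real^'d \<Rightarrow> real. continuous_on (region sh) f \<longrightarrow>
           (\<lambda>k. LINT x:region sh|\<nu> k. f x) \<longlonglongrightarrow> (LINT x:region sh|\<phi>. f x)))"
proof -
  let ?M = "\<lambda>g :: 'd mpoly. moment_mat (n - half_deg g) (weighted g \<phi>)"
  let ?T = "real (total_size TYPE('d) sh n)"
  have M: "?M g = gram (n - half_deg g) g (equil sh)" if "g \<in> gens sh n" for g
    unfolding \<phi> by (rule R_feasible_moments(3)[OF n equil_in_prob_measures_on that])
  have part1: "P_optimal sh n \<phi> \<and>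
      (\<forall>\<psi>. P_optimal sh n \<psi> \<longrightarrow> (\<forall>g\<in>gens sh n. moment_mat (n - half_deg g) (weighted g \<psi>) = ?M g)) \<and>
      (\<forall>y. R_optimal sh n y \<longleftrightarrow> y = moments (2 * n) \<phi>)"
    unfolding \<phi> using P_optimal_equil[OF n] P_optimal_unique[OF n] R_optimal_iff[OF n] by blast
  have D: "D_optimal sh n A \<longleftrightarrow> A = restrict (generator_inverse sh n) (gens sh n)" for A :: "'d mpoly \<Rightarrow> real mat"
    by (rule D_optimal_iff[OF n])
  have part2a: "\<exists>!A :: 'd mpoly \<Rightarrow> real mat. D_optimal sh n A" unfolding D by blast
  have part2b: "\<forall>A :: 'd mpoly \<Rightarrow> real mat. D_optimal sh n A \<longrightarrow> (\<forall>g\<in>gens sh n. mat_inverse (?M g) = Some (A g))"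
    unfolding D using gens_properties(5)[OF n, where ?'d = 'd] by (simp add: M)
  have part2c: "?T = (\<Sum>g\<in>gens sh n. inverse (christoffel (n - half_deg g) (weighted g \<phi>) x) * mpoly_at g x) \<and>
      ?T = (\<Sum>g\<in>gens sh n. cd_kernel (n - half_deg g) (weighted g \<phi>) x x * mpoly_at g x)" for x :: "real^'d"
    using christoffel_darboux_identity[OF n, of sh x] by (simp add: christoffel_def \<phi>)
  have eq_iff: "cd_kernel n \<phi> x x = ?T \<longleftrightarrow>
     (case sh of UnitBall \<Rightarrow> x \<in> frontier (region sh) | UnitBox \<Rightarrow> x \<in> vertices (region sh) | UnitSimplex \<Rightarrow> x \<in> vertices (region sh))"
    if "x \<in> region sh" for x :: "real^'d"
    unfolding \<phi> cd_kernel_maximum(2)[OF n that] by (rule contact_set[OF n that])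
  have part3b: "\<forall>x\<in>region sh. cd_kernel n \<phi> x x \<le> ?T"
    unfolding \<phi> using cd_kernel_maximum(1)[OF n] by blast
  obtain x0 :: "real^'d" where x0: "case sh of UnitBall \<Rightarrow> x0 \<in> frontier (region sh) | UnitBox \<Rightarrow> x0 \<in> vertices (region sh)
     | UnitSimplex \<Rightarrow> x0 \<in> vertices (region sh)"
    using contact_point_exists[of sh, where ?'d = 'd] ..
  then have "x0 \<in> region sh" using contact_points_subset by (cases sh) auto
  then have part3c: "\<exists>x\<in>region sh. cd_kernel n \<phi> x x = ?T" using eq_iff x0 by blast
  have part3d: "case sh of
         UnitBall \<Rightarrow> \<forall>x\<in>frontier (region sh). cd_kernel n \<phi> x x = ?T
       | UnitBox \<Rightarrow> {x\<in>region sh. cd_kernel n \<phi> x x = ?T} = vertices (region sh) \<and>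
           card (vertices (region sh :: (real^'d) set)) = 2 ^ CARD('d)
       | UnitSimplex \<Rightarrow> {x\<in>region sh. cd_kernel n \<phi> x x = ?T} = vertices (region sh) \<and>
           card (vertices (region sh :: (real^'d) set)) = CARD('d) + 1"
    using eq_iff contact_points_subset
    by (cases sh) (auto simp: card_vertices_box card_vertices_simplex)
  have part4: "\<forall>\<nu> :: nat \<Rightarrow> (real^'d) measure. (\<forall>k\<ge>1. is_cubature sh k (\<nu> k)) \<longrightarrow>
        (\<forall>f :: real^'d \<Rightarrow> real. continuous_on (region sh) f \<longrightarrow>
           (\<lambda>k. LINT x:region sh|\<nu> k. f x) \<longlonglongrightarrow> (LINT x:region sh|\<phi>. f x))"
    unfolding \<phi>
  proof (intro allI impI)
    fix \<nu> :: "nat \<Rightarrow> (real^'d) measure" and f :: "real^'d \<Rightarrow> real"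
    assume "\<forall>k\<ge>1. is_cubature sh k (\<nu> k)" "continuous_on (region sh) f"
    then show "(\<lambda>k. LINT x:region sh|\<nu> k. f x) \<longlonglongrightarrow> (LINT x:region sh|equil sh. f x)"
      by (intro cubature_weak_convergence) auto
  qed
  show ?thesis
    by (rule conjI[OF part1 conjI[OF conjI[OF part2a conjI[OF part2b allI[OF part2c]]]
      conjI[OF conjI[OF cubature_exists[OF n] conjI[OF part3b conjI[OF part3c part3d]]] part4]]])
qed

end
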